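(* There exist $p\in\mathrm{poly}$, a constant $\alpha>0$, and a classical two-prover one-round interactive proof system for the Succinct Circuit Value problem such that: (completeness) for every yes-instance $x$ there is a no-signaling strategy making the verifier accept with probability $1$; (soundness) for every no-instance $x$, every no-signaling strategy makes the verifier accept with probability at most $1-2^{-2^{p(|x|)}}$. In particular $\text{Succinct Circuit Value}\in\mathrm{MIP}^{\mathrm{ns}}_{1,1-2^{-2^{\mathrm{poly}}}}(2,1)$. Moreover, for infinitely many input strings $x$, the soundness error of this proof system on $x$ (the maximum acceptance probability over no-signaling strategies) is at least $1-2^{-2^{|x|^\alpha}}$.
   Context: $\mathrm{poly}$ is the set of functions $p\colon\mathbb{N}\to\mathbb{N}$ such that some polynomial-time deterministic Turing machine outputs $1^{p(n)}$ on input $1^n$. Succinct Circuit Value: for a Boolean circuit $C$ with gates $g_0,\dots,g_{N-1}$ of fan-in at most two, where $g_j$ is an input to $g_i$ only if $j<i$, a succinct representation is a pair $(N,D)$ where $D$ is a Boolean circuit that on input $0\le i\le N-1$ returns the kind of gate $g_i$ (ZERO, ONE, AND, OR, or NOT) and the indices of the gates feeding $g_i$. An instance is a succinct representation $(N,D)$ together with an integer $0\le k\le N-1$; the question is whether gate $g_k$ has value $1$. In a two-prover one-round interactive proof system, a randomized polynomial-time verifier, on input $x$, sends polynomial-length questions $s$ to prover Alice and $t$ to prover Bob (drawn from some distribution), receives polynomial-length answers $y$ from Alice and $z$ from Bob, and accepts with some probability $R(y,z\mid s,t)$. A strategy is a family of probability distributions $p(\cdot,\cdot\mid s,t)$ over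 answer pairs $(y,z)$ indexed by question pairs; it is no-signaling if $\sum_y p(y,z\mid s,t)=\sum_y p(y,z\mid s',t)$ for all $s,s',t,z$ and $\sum_z p(y,z\mid s,t)=\sum_z p(y,z\mid s,t')$ for all $s,t,t',y$. For $a,b\colon\mathbb{N}\to[0,1]$, $\mathrm{MIP}^{\mathrm{ns}}_{a,b}(2,1)$ is the class of promise problems $A=(A_{\mathrm{yes}},A_{\mathrm{no}})$ having such a system where for each $x\in A_{\mathrm{yes}}$ some no-signaling strategy gives acceptance probability at least $a(|x|)$, and for each $x\in A_{\mathrm{no}}$ every no-signaling strategy gives acceptance probability at most $b(|x|)$; $\mathrm{MIP}^{\mathrm{ns}}_{1,1-2^{-2^{\mathrm{poly}}}}(2,1)=\bigcup_{p\in\mathrm{poly}}\mathrm{MIP}^{\mathrm{ns}}_{1,1-2^{-2^{p}}}(2,1)$. *)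

theory Defs
  imports Complex_Main
begin

text \<open>Strings over the alphabet {0,1} are bool lists (True = 1).
  A tuple of strings is encoded self-delimitingly: every bit b is doubled to bb,
  and each component is terminated by the separator 10.\<close>

definition dbl :: "bool list \<Rightarrow> bool list" where
  "dbl w = concat (map (\<lambda>b. [b, b]) w)"

definition enc_tuple :: "bool list list \<Rightarrow> bool list" where
  "enc_tuple ws = concat (map (\<lambda>w. dbl w @ [True, False]) ws)"

fun nat_bits :: "nat \<Rightarrow> bool list" where
  "nat_bits n = (if n = 0 then [] else odd n # nat_bits (n div 2))"

definition nat_to_bits :: "nat \<Rightarrow> nat \<Rightarrow> bool list" where
  "nat_to_bits m i = map (\<lambda>j. odd (i div 2 ^ j)) [0..<m]"

definition bits_to_nat :: "bool list \<Rightarrow> nat" where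
  "bits_to_nat bs = (\<Sum>j<length bs. if bs ! j then 2 ^ j else 0)"

text \<open>Single-tape deterministic Turing machines over the tape alphabet
  {0,1,blank} (blank = None). A machine is a pair (q, \<delta>) with states
  0..q-1, start state 0 and halting state 1; \<delta> s a = (s', b, d) means:
  in state s reading a, go to state s', write b and move the head by d.\<close>

type_synonym tm = "nat \<times> (nat \<Rightarrow> bool option \<Rightarrow> nat \<times> bool option \<times> int)"
type_synonym config = "nat \<times> (int \<Rightarrow> bool option) \<times> int"

definition tm_wf :: "tm \<Rightarrow> bool" where
  "tm_wf M = (2 \<le> fst M \<and>
     (\<forall>s < fst M. \<forall>a. (case snd M s a of (s', b, d) \<Rightarrow> s' < fst M \<and> d \<in> {-1, 0, 1})))"

definition tm_step :: "tm \<Rightarrow> config \<Rightarrow> config" where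
  "tm_step M c = (case c of (s, tp, h) \<Rightarrow>
     if s = 1 then (s, tp, h)
     else (case snd M s (tp h) of (s', b, d) \<Rightarrow> (s', tp(h := b), h + d)))"

definition tm_init :: "bool list \<Rightarrow> config" where
  "tm_init x = (0, (\<lambda>i. if 0 \<le> i \<and> i < int (length x) then Some (x ! nat i) else None), 0)"

definition tm_run :: "tm \<Rightarrow> bool list \<Rightarrow> nat \<Rightarrow> config" where
  "tm_run M x t = (tm_step M ^^ t) (tm_init x)"

definition tm_halted :: "config \<Rightarrow> bool" where
  "tm_halted c = (fst c = 1)"

definition tm_output :: "config \<Rightarrow> bool list" where
  "tm_output c = (let tp = fst (snd c) in
     map (\<lambda>i. the (tp (int i))) [0..<(LEAST n. tp (int n) = None)])"

definition poly_computes_on :: "tm \<Rightarrow> bool list set \<Rightarrow> (bool list \<Rightarrow> bool list) \<Rightarrow> bool" where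
  "poly_computes_on M D f = (tm_wf M \<and> (\<exists>c k::nat. \<forall>w \<in> D. \<exists>t. t \<le> c * (length w + 1) ^ k \<and>
      tm_halted (tm_run M w t) \<and> tm_output (tm_run M w t) = f w))"

definition poly :: "(nat \<Rightarrow> nat) set" where
  "poly = {p. \<exists>M. poly_computes_on M (range (\<lambda>n. replicate n True))
                    (\<lambda>w. replicate (p (length w)) True)}"

datatype gkind = ZERO | ONE | AND | OR | NOT

definition gate_val :: "gkind \<Rightarrow> bool \<Rightarrow> bool \<Rightarrow> bool" where
  "gate_val g u v = (case g of ZERO \<Rightarrow> False | ONE \<Rightarrow> True | AND \<Rightarrow> u \<and> v
                     | OR \<Rightarrow> u \<or> v | NOT \<Rightarrow> \<not> u)"

text \<open>An ordinary Boolean circuit with m input bits: (m, gates, outs).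
  Wire w < m is input bit w, wire m + j is gate j; gate j = (g, a, b) has kind g
  and reads wires a and b (ignored if not needed), which must precede it.
  outs lists the output wires.\<close>
type_synonym circuit = "nat \<times> (gkind \<times> nat \<times> nat) list \<times> nat list"

definition circuit_wf :: "circuit \<Rightarrow> bool" where
  "circuit_wf C = (case C of (m, gs, outs) \<Rightarrow>
     (\<forall>j < length gs. case gs ! j of (g, a, b) \<Rightarrow> a < m + j \<and> b < m + j) \<and>
     (\<forall>w \<in> set outs. w < m + length gs))"

definition circuit_eval :: "circuit \<Rightarrow> bool list \<Rightarrow> bool list" where
  "circuit_eval C inp = (case C of (m, gs, outs) \<Rightarrow>
     (let ws = foldl (\<lambda>vs (g, a, b). vs @ [gate_val g (vs ! a) (vs ! b)]) inp gs
      in map (\<lambda>w. ws ! w) outs))"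

definition kind_of_code :: "nat \<Rightarrow> gkind" where
  "kind_of_code c = (if c = 0 then ZERO else if c = 1 then ONE else if c = 2 then AND
                     else if c = 3 then OR else NOT)"

definition code_of_kind :: "gkind \<Rightarrow> nat" where
  "code_of_kind g = (case g of ZERO \<Rightarrow> 0 | ONE \<Rightarrow> 1 | AND \<Rightarrow> 2 | OR \<Rightarrow> 3 | NOT \<Rightarrow> 4)"

text \<open>A succinct Circuit Value instance (N, D, k). D has m inputs (the index i in
  m-bit binary) and 3 + 2m outputs: a 3-bit kind code (0..4 for
  ZERO, ONE, AND, OR, NOT) followed by the indices of the two gates feeding g_i,
  each in m-bit binary.\<close>
type_synonym scv_instance = "nat \<times> circuit \<times> nat"

definition D_out :: "circuit \<Rightarrow> nat \<Rightarrow> bool list" where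
  "D_out D i = circuit_eval D (nat_to_bits (fst D) i)"

definition D_code :: "circuit \<Rightarrow> nat \<Rightarrow> nat" where
  "D_code D i = bits_to_nat (take 3 (D_out D i))"

definition D_in1 :: "circuit \<Rightarrow> nat \<Rightarrow> nat" where
  "D_in1 D i = bits_to_nat (take (fst D) (drop 3 (D_out D i)))"

definition D_in2 :: "circuit \<Rightarrow> nat \<Rightarrow> nat" where
  "D_in2 D i = bits_to_nat (drop (3 + fst D) (D_out D i))"

definition scv_wf :: "scv_instance \<Rightarrow> bool" where
  "scv_wf I = (case I of (N, D, k) \<Rightarrow>
     circuit_wf D \<and> length (snd (snd D)) = 3 + 2 * fst D \<and>
     1 \<le> N \<and> N \<le> 2 ^ fst D \<and> k < N \<and>
     (\<forall>i < N. D_code D i \<le> 4 \<and>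
        (kind_of_code (D_code D i) \<in> {AND, OR, NOT} \<longrightarrow> D_in1 D i < i) \<and>
        (kind_of_code (D_code D i) \<in> {AND, OR} \<longrightarrow> D_in2 D i < i)))"

fun scv_vals :: "circuit \<Rightarrow> nat \<Rightarrow> bool list" where
  "scv_vals D 0 = []"
| "scv_vals D (Suc i) = (let vs = scv_vals D i in
     vs @ [gate_val (kind_of_code (D_code D i)) (vs ! D_in1 D i) (vs ! D_in2 D i)])"

definition scv_value :: "scv_instance \<Rightarrow> bool" where
  "scv_value I = (case I of (N, D, k) \<Rightarrow> scv_vals D (Suc k) ! k)"

definition scv_enc :: "scv_instance \<Rightarrow> bool list" where
  "scv_enc I = (case I of (N, (m, gs, outs), k) \<Rightarrow>
     enc_tuple (map nat_bits ([N, k, m, length gs] @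
        concat (map (\<lambda>(g, a, b). [code_of_kind g, a, b]) gs) @ outs)))"

definition SCV_yes :: "bool list set" where
  "SCV_yes = {scv_enc I | I. scv_wf I \<and> scv_value I}"

definition SCV_no :: "bool list set" where
  "SCV_no = {scv_enc I | I. scv_wf I \<and> \<not> scv_value I}"

text \<open>A verifier (r, l, Q, Dec): on input x it draws a uniformly random string
  \<rho> of length r |x|, computes the questions (s, t) = Q x \<rho> for Alice and Bob,
  receives answers y, z of length l |x|, and accepts iff Dec x \<rho> y z.\<close>
type_synonym verifier = "(nat \<Rightarrow> nat) \<times> (nat \<Rightarrow> nat) \<times>
   (bool list \<Rightarrow> bool list \<Rightarrow> bool list \<times> bool list) \<times>
   (bool list \<Rightarrow> bool list \<Rightarrow> bool list \<Rightarrow> bool list \<Rightarrow> bool)"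

definition v_rand :: "verifier \<Rightarrow> nat \<Rightarrow> nat" where "v_rand V = fst V"
definition v_alen :: "verifier \<Rightarrow> nat \<Rightarrow> nat" where "v_alen V = fst (snd V)"
definition v_ques :: "verifier \<Rightarrow> bool list \<Rightarrow> bool list \<Rightarrow> bool list \<times> bool list" where
  "v_ques V = fst (snd (snd V))"
definition v_dec :: "verifier \<Rightarrow> bool list \<Rightarrow> bool list \<Rightarrow> bool list \<Rightarrow> bool list \<Rightarrow> bool" where
  "v_dec V = snd (snd (snd V))"

definition poly_verifier :: "verifier \<Rightarrow> bool" where
  "poly_verifier V = (v_rand V \<in> poly \<and> v_alen V \<in> poly \<and>
     (\<exists>M. poly_computes_on M
        {enc_tuple [x, \<rho>] | x \<rho>. length \<rho> = v_rand V (length x)}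
        (\<lambda>w. SOME out. \<exists>x \<rho>. w = enc_tuple [x, \<rho>] \<and> length \<rho> = v_rand V (length x) \<and>
            out = enc_tuple [fst (v_ques V x \<rho>), snd (v_ques V x \<rho>)])) \<and>
     (\<exists>M. poly_computes_on M
        {enc_tuple [x, \<rho>, y, z] | x \<rho> y z. length \<rho> = v_rand V (length x) \<and>
            length y = v_alen V (length x) \<and> length z = v_alen V (length x)}
        (\<lambda>w. SOME out. \<exists>x \<rho> y z. w = enc_tuple [x, \<rho>, y, z] \<and> length \<rho> = v_rand V (length x) \<and>
            length y = v_alen V (length x) \<and> length z = v_alen V (length x) \<and>
            out = [v_dec V x \<rho> y z])))"

definition answers :: "verifier \<Rightarrow> bool list \<Rightarrow> bool list set" where
  "answers V x = {y. length y = v_alen V (length x)}"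

definition strategy :: "verifier \<Rightarrow> bool list \<Rightarrow>
    (bool list \<Rightarrow> bool list \<Rightarrow> bool list \<Rightarrow> bool list \<Rightarrow> real) \<Rightarrow> bool" where
  "strategy V x P = (\<forall>s t. (\<forall>y \<in> answers V x. \<forall>z \<in> answers V x. 0 \<le> P s t y z) \<and>
       (\<Sum>y \<in> answers V x. \<Sum>z \<in> answers V x. P s t y z) = 1)"

definition no_signaling :: "verifier \<Rightarrow> bool list \<Rightarrow>
    (bool list \<Rightarrow> bool list \<Rightarrow> bool list \<Rightarrow> bool list \<Rightarrow> real) \<Rightarrow> bool" where
  "no_signaling V x P = (strategy V x P \<and>
     (\<forall>s s' t. \<forall>z \<in> answers V x.
        (\<Sum>y \<in> answers V x. P s t y z) = (\<Sum>y \<in> answers V x. P s' t y z)) \<and>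
     (\<forall>s t t'. \<forall>y \<in> answers V x.
        (\<Sum>z \<in> answers V x. P s t y z) = (\<Sum>z \<in> answers V x. P s t' y z)))"

definition accept_prob :: "verifier \<Rightarrow> bool list \<Rightarrow>
    (bool list \<Rightarrow> bool list \<Rightarrow> bool list \<Rightarrow> bool list \<Rightarrow> real) \<Rightarrow> real" where
  "accept_prob V x P =
     (\<Sum>\<rho> \<in> {\<rho>. length \<rho> = v_rand V (length x)}.
        \<Sum>y \<in> answers V x. \<Sum>z \<in> answers V x.
          P (fst (v_ques V x \<rho>)) (snd (v_ques V x \<rho>)) y z *
          (if v_dec V x \<rho> y z then 1 else 0)) / 2 ^ v_rand V (length x)"

end

theory Submission
  imports Defs
begin

text \<open>Alice is asked for a gate i and answers with claimed values of its two inputs; Bob is asked for a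
  gate j and answers with its claimed value. The verifier evaluates D on i and rejects if Bob answers 0 for
  j = k, or if j is i or an input of i and Bob's bit disagrees with what Alice's bits say about j.

  By no-signaling, Bob's marginal at every gate is well defined. If every question pair is rejected with
  probability at most d, then the probability e(i) that Bob errs at gate i satisfies
  e(i) \<le> e(a) + e(b) + 3d for the inputs a, b of i, hence e(k) < 3d 2^(k+1), whereas e(k) \<ge> 1 - d on a
  no-instance. So d is at least 2^-O(N). This doubling is attained by two parallel chains of OR gates
  over ZERO gates: at level l Bob answers 1 with probability 2^(l-M), and Alice makes her two bits disjoint, so
  that only the ZERO gates are ever caught, with probability 2^-M, where M is exponential in the size of D.\<close>

section \<open>Stack programs on Turing machines\<close>

text \<open>\<open>poly_verifier\<close> asks for actual single-tape Turing machines. The question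
  map and the decision are therefore written as programs over finitely many stacks, and
  \<open>compile_poly\<close> turns such a program, given a polynomial time bound, into a machine.
  Loops of these programs are driven by the contents of a stack. As the input gives the number of
  gates of D only in binary, the random string also supplies it in unary, and random strings with
  wrong lengths are accepted.

  The random string consists of |x| uniform bits, so every pair of gate indices is asked with
  probability at least 2^-|x|, and d is at most 2^|x| times the total rejection probability. This
  factor and the 2^O(N) of the recurrence together stay below 2^(2^|x|), because N is at most 2^m
  and the encoding is longer than 4 m. Hence p can be the identity.

  Two chains up to level M = 2^L - 1 are described by O(L) numbers of O(L) bits, so |x| is O(L^2);
  the exponent 1/4 leaves room for the constants.\<close>

datatype com = Skip | Push nat bool | Seq com com
  | Case nat com "bool \<Rightarrow> com" | Loop nat "bool \<Rightarrow> com"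

type_synonym store = "nat \<Rightarrow> bool list"

text \<open>The number is an upper bound on the running time, not the exact time.\<close>

inductive exec :: "com \<Rightarrow> store \<Rightarrow> nat \<Rightarrow> store \<Rightarrow> bool" where
  exec_Skip: "0 < t \<Longrightarrow> exec Skip R t R"
| exec_Push: "0 < t \<Longrightarrow> exec (Push r b) R t (R(r := b # R r))"
| exec_Seq: "exec c R t1 S \<Longrightarrow> exec d S t2 T \<Longrightarrow> t1 + t2 < t \<Longrightarrow> exec (Seq c d) R t T"
| exec_Case_Nil: "R r = [] \<Longrightarrow> exec c R t1 S \<Longrightarrow> t1 < t \<Longrightarrow> exec (Case r c f) R t S"
| exec_Case_Cons: "R r = b # bs \<Longrightarrow> exec (f b) (R(r := bs)) t1 S \<Longrightarrow> t1 < t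
    \<Longrightarrow> exec (Case r c f) R t S"
| exec_Loop_Nil: "R r = [] \<Longrightarrow> 0 < t \<Longrightarrow> exec (Loop r f) R t R"
| exec_Loop_Cons: "R r = b # bs \<Longrightarrow> exec (f b) (R(r := bs)) t1 S \<Longrightarrow> exec (Loop r f) S t2 T
    \<Longrightarrow> t1 + t2 < t \<Longrightarrow> exec (Loop r f) R t T"

primrec regs_below :: "nat \<Rightarrow> com \<Rightarrow> bool" where
  "regs_below k Skip = True"
| "regs_below k (Push r b) = (r < k)"
| "regs_below k (Seq c d) = (regs_below k c \<and> regs_below k d)"
| "regs_below k (Case r c f) = (r < k \<and> regs_below k c \<and> (\<forall>b. regs_below k (f b)))"
| "regs_below k (Loop r f) = (r < k \<and> (\<forall>b. regs_below k (f b)))"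

text \<open>The tape holds the encoded tuple of all registers, starting at cell 0. A state carries the list of
  commands still to be executed. \<open>Skp n\<close> skips n registers; \<open>Ins\<close> shifts the rest of the tape right
  by two cells to make room for a pushed bit; a popped bit is blanked by \<open>PopA\<close> and \<open>Del1\<close>, and the gap
  is closed from the right end by \<open>DelL\<close>; \<open>Bck\<close> returns to cell 0. The flag q of \<open>delta\<close> selects
  the output: registers 0 and 1 as a pair, or the first bit of register 0. Only the cell behind the output is
  blanked.\<close>

datatype act = APush bool "com list" | APop "com list" "bool \<Rightarrow> com list" | AFin

datatype st = Ini | App nat | App1 nat | Rdy "com list" | Skp nat act | Skq bool nat act
  | Ins bool bool "com list" | Ins1 bool "com list"
  | PopA bool "com list" "bool \<Rightarrow> com list"
  | Del1 "com list" | Del2 "com list" | DelR "com list"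
  | DelL "bool option" "bool option" "com list" | DelM "bool option" "com list"
  | Bck "com list" | Fin | Halt

fun delta :: "bool \<Rightarrow> com \<Rightarrow> nat \<Rightarrow> st \<Rightarrow> bool option \<Rightarrow> st \<times> bool option \<times> int" where
  "delta q p e Ini a = (if a = None then (App e, None, 0) else (Ini, a, 1))"
| "delta q p e (App 0) a = (Bck [p], a, -1)"
| "delta q p e (App (Suc j)) a = (App1 j, Some True, 1)"
| "delta q p e (App1 j) a = (App j, Some False, 1)"
| "delta q p e (Rdy []) a = (if q then (Skp 2 AFin, a, 0) else (Fin, a, 1))"
| "delta q p e (Rdy (Skip # K)) a = (Rdy K, a, 0)"
| "delta q p e (Rdy (Seq c d # K)) a = (Rdy (c # d # K), a, 0)"
| "delta q p e (Rdy (Push r b # K)) a = (Skp r (APush b K), a, 0)"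
| "delta q p e (Rdy (Case r c f # K)) a = (Skp r (APop (c # K) (\<lambda>b. f b # K)), a, 0)"
| "delta q p e (Rdy (Loop r f # K)) a = (Skp r (APop K (\<lambda>b. f b # Loop r f # K)), a, 0)"
| "delta q p e (Skp (Suc n) A) a = (Skq (a = Some True) n A, a, 1)"
| "delta q p e (Skq b n A) a = (if a = Some b then Skp (Suc n) A else Skp n A, a, 1)"
| "delta q p e (Skp 0 (APush b K)) a = (Ins b b K, a, 0)"
| "delta q p e (Skp 0 (APop K f)) a = (PopA (a = Some True) K f, a, 1)"
| "delta q p e (Skp 0 AFin) a = (Halt, None, 0)"
| "delta q p e (Ins b c K) (Some d) = (Ins c d K, Some b, 1)"
| "delta q p e (Ins b c K) None = (Ins1 c K, Some b, 1)"
| "delta q p e (Ins1 c K) a = (Bck K, Some c, -1)"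
| "delta q p e (PopA b K f) a = (if a = Some b then (Del1 (f b), None, -1) else (Bck K, a, -1))"
| "delta q p e (Del1 K) a = (Del2 K, None, 1)"
| "delta q p e (Del2 K) a = (DelR K, None, 1)"
| "delta q p e (DelR K) a = (if a = None then (DelL None None K, None, -1) else (DelR K, a, 1))"
| "delta q p e (DelL x y K) (Some d) = (DelL y (Some d) K, x, -1)"
| "delta q p e (DelL x y K) None = (DelM y K, x, -1)"
| "delta q p e (DelM y K) a = (Bck K, y, -1)"
| "delta q p e (Bck K) a = (if a = None then (Rdy K, None, 1) else (Bck K, a, -1))"
| "delta q p e Fin a = (Halt, None, 0)"
| "delta q p e Halt a = (Halt, a, 0)"

section \<open>Tape configurations as zippers, and the sweeps of the automaton\<close>

type_synonym 's conf = "'s \<times> (int \<Rightarrow> bool option) \<times> int"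

text \<open>The analogue of \<open>tm_step\<close> over an arbitrary state type. Halting is not
  built in; it is a state that loops in place.\<close>

definition astep :: "('s \<Rightarrow> bool option \<Rightarrow> 's \<times> bool option \<times> int) \<Rightarrow> 's conf \<Rightarrow> 's conf" where
  "astep D c = (case c of (s, tp, h) \<Rightarrow> case D s (tp h) of (s', b, d) \<Rightarrow> (s', tp(h := b), h + d))"

definition rch :: "('s \<Rightarrow> bool option \<Rightarrow> 's \<times> bool option \<times> int) \<Rightarrow> nat \<Rightarrow> 's conf \<Rightarrow> 's conf \<Rightarrow> bool" where
  "rch D t c c' = (\<exists>t' \<le> t. (astep D ^^ t') c = c')"

lemma rch_refl: "rch D t c c"
  unfolding rch_def by (rule exI[of _ 0]) simp

lemma rch_trans: "rch D t c c' \<Longrightarrow> rch D u c' c'' \<Longrightarrow> t + u \<le> v \<Longrightarrow> rch D v c c''"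
  unfolding rch_def
proof (elim exE conjE)
  fix t' u' assume a: "t + u \<le> v" "t' \<le> t" "(astep D ^^ t') c = c'" "u' \<le> u" "(astep D ^^ u') c' = c''"
  have "(astep D ^^ (u' + t')) c = c''" using a by (simp add: funpow_add)
  moreover have "u' + t' \<le> v" using a by simp
  ultimately show "\<exists>t'\<le>v. (astep D ^^ t') c = c''" by blast
qed

lemma rch_mono: "rch D t c c' \<Longrightarrow> t \<le> v \<Longrightarrow> rch D v c c'"
  unfolding rch_def using le_trans by blast

lemma rch_step: "astep D c = c' \<Longrightarrow> rch D t c' c'' \<Longrightarrow> t < v \<Longrightarrow> rch D v c c''"
proof -
  assume a: "astep D c = c'" "rch D t c' c''" "t < v"
  have "rch D 1 c c'" unfolding rch_def using a(1) by (intro exI[of _ 1]) simp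
  from rch_trans[OF this a(2)] a(3) show ?thesis by simp
qed

definition otp :: "bool option list \<Rightarrow> int \<Rightarrow> bool option" where
  "otp xs = (\<lambda>i. if 0 \<le> i \<and> i < int (length xs) then xs ! nat i else None)"

text \<open>The head stands on the first cell of \<open>ys\<close>, or on the blank behind the
  contents if \<open>ys\<close> is empty.\<close>

definition zip_conf :: "'s \<Rightarrow> bool option list \<Rightarrow> bool option list \<Rightarrow> 's conf" where
  "zip_conf q xs ys = (q, otp (xs @ ys), int (length xs))"

lemma otp_upd: "(otp (xs @ a # ys))(int (length xs) := b) = otp (xs @ b # ys)"
  by (rule ext) (auto simp: otp_def nth_append nth_Cons')

lemma otp_at: "otp (xs @ a # ys) (int (length xs)) = a"
  by (auto simp: otp_def nth_append)

text \<open>Trailing blanks are invisible, so the blank behind the contents can be treated as one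
  more cell and the step lemmas apply at the right end too.\<close>

lemma otp_None: "otp (xs @ [None]) = otp xs"
  by (rule ext) (auto simp: otp_def nth_append)

lemma zip_conf_None: "zip_conf q xs [None] = zip_conf q xs []"
  by (simp add: zip_conf_def otp_None)

lemma zip_step:
  assumes "D q a = (q', b, d)"
  shows "astep D (zip_conf q xs (a # ys)) = (q', otp (xs @ b # ys), int (length xs) + d)"
  using assms by (simp add: zip_conf_def astep_def otp_at otp_upd)

lemma zip_step_right:
  assumes "D q a = (q', b, 1)"
  shows "astep D (zip_conf q xs (a # ys)) = zip_conf q' (xs @ [b]) ys"
  using zip_step[of D q a q' b 1 xs ys] assms by (simp add: zip_conf_def)

lemma zip_step_stay:
  assumes "D q a = (q', b, 0)"
  shows "astep D (zip_conf q xs (a # ys)) = zip_conf q' xs (b # ys)"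
  using zip_step[of D q a q' b 0 xs ys] assms by (simp add: zip_conf_def)

lemma zip_step_left:
  assumes "D q a = (q', b, -1)"
  shows "astep D (zip_conf q (xs @ [x]) (a # ys)) = zip_conf q' xs (x # b # ys)"
  using zip_step[of D q a q' b "-1" "xs @ [x]" ys] assms by (simp add: zip_conf_def)

text \<open>The blank at cell -1 serves as the left end marker. The cells crossed on the way must be
  nonblank, which is why a gap has to be closed before returning.\<close>

lemma rch_Bck:
  assumes "tp (-1) = None" "\<And>i. 0 \<le> i \<Longrightarrow> i \<le> h \<Longrightarrow> tp i \<noteq> None" "- 1 \<le> h" "nat (h + 2) \<le> t"
  shows "rch (delta q p e) t (Bck K, tp, h) (Rdy K, tp, 0)"
  using assms
proof (induction "nat (h + 1)" arbitrary: h t)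
  case 0
  then have h: "h = -1" by simp
  have "astep (delta q p e) (Bck K, tp, h) = (Rdy K, tp, 0)"
    using 0 h by (auto simp: astep_def)
  then show ?case using 0 by (intro rch_step[OF _ rch_refl[of _ 0]]) auto
next
  case (Suc n)
  have "tp h \<noteq> None" using Suc by auto
  then have s: "astep (delta q p e) (Bck K, tp, h) = (Bck K, tp, h - 1)"
    by (auto simp: astep_def)
  have "rch (delta q p e) (nat (h + 1)) (Bck K, tp, h - 1) (Rdy K, tp, 0)"
    using Suc.prems Suc.hyps(2) by (intro Suc.hyps(1)) auto
  from rch_step[OF s this] show ?case using Suc by auto
qed

lemma rch_Bck_zip:
  assumes "length xs + 2 \<le> t"
  shows "rch (delta q p e) t (Bck K, otp (map Some (xs @ ys)), int (length xs) - 1)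
     (zip_conf (Rdy K) [] (map Some (xs @ ys)))"
  unfolding zip_conf_def
proof (simp, rule rch_Bck)
  show "otp (map Some xs @ map Some ys) (-1) = None" by (simp add: otp_def)
  fix i assume "0 \<le> i" "i \<le> int (length xs) - 1"
  then show "otp (map Some xs @ map Some ys) i \<noteq> None"
    by (auto simp: otp_def nth_append)
qed (use assms in auto)

lemma enc_tuple_Nil [simp]: "enc_tuple [] = []"
  and enc_tuple_Cons: "enc_tuple (w # ws) = dbl w @ [True, False] @ enc_tuple ws"
  by (simp_all add: enc_tuple_def)

lemma enc_tuple_append: "enc_tuple (vs @ ws) = enc_tuple vs @ enc_tuple ws"
  by (simp add: enc_tuple_def)

lemma dbl_simps [simp]: "dbl [] = []" "dbl (b # w) = b # b # dbl w" "dbl (v @ w) = dbl v @ dbl w"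
  by (simp_all add: dbl_def)

lemma length_dbl [simp]: "length (dbl w) = 2 * length w"
  by (induction w) auto

text \<open>\<open>Skp\<close> reads the first cell of a pair and \<open>Skq\<close> the second.
  Equal cells are a bit of the current register and restore the counter; unequal cells are the
  separator and leave it decremented.\<close>

lemma rch_Skp1:
  assumes "2 * length w + 2 \<le> t"
  shows "rch (delta q p e) t (zip_conf (Skp (Suc n) A) xs (map Some (dbl w @ [True, False]) @ ys))
     (zip_conf (Skp n A) (xs @ map Some (dbl w @ [True, False])) ys)" (is "rch ?D _ _ _")
  using assms
proof (induction w arbitrary: xs t)
  case Nil
  then show ?case
    by (simp, intro rch_step[OF zip_step_right, of _ _ _ _ _ 1] rch_step[OF zip_step_right, of _ _ _ _ _ 0])
      (auto intro: rch_refl)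
next
  case (Cons b w)
  have "rch ?D (2 * length w + 2) (zip_conf (Skp (Suc n) A) ((xs @ [Some b]) @ [Some b]) (map Some (dbl w @ [True, False]) @ ys))
     (zip_conf (Skp n A) (((xs @ [Some b]) @ [Some b]) @ map Some (dbl w @ [True, False])) ys)"
    by (rule Cons.IH) simp
  then show ?case using Cons.prems
    by (simp, intro rch_step[OF zip_step_right, of _ _ _ _ _ "2 * length w + 3"]
        rch_step[OF zip_step_right, of _ _ _ _ _ "2 * length w + 2"]) auto
qed

lemma rch_Skp:
  assumes "length (enc_tuple ws) \<le> t"
  shows "rch (delta q p e) t (zip_conf (Skp (length ws) A) xs (map Some (enc_tuple ws) @ ys))
     (zip_conf (Skp 0 A) (xs @ map Some (enc_tuple ws)) ys)" (is "rch ?D _ _ _")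
  using assms
proof (induction ws arbitrary: xs t)
  case Nil
  then show ?case by (auto intro: rch_refl)
next
  case (Cons w ws)
  have "rch ?D (2 * length w + 2) (zip_conf (Skp (Suc (length ws)) A) xs (map Some (dbl w @ [True, False]) @ (map Some (enc_tuple ws) @ ys)))
     (zip_conf (Skp (length ws) A) (xs @ map Some (dbl w @ [True, False])) (map Some (enc_tuple ws) @ ys))"
    by (rule rch_Skp1) simp
  from rch_trans[OF this Cons.IH[OF le_refl]] Cons.prems show ?case
    by (simp add: enc_tuple_Cons)
qed

text \<open>The state holds the two bits still to be written. Each step writes the older one and
  picks up the bit under the head, which shifts the contents by two cells in a single sweep.\<close>

lemma rch_Ins:
  assumes "length ds + 2 \<le> t"
  shows "rch (delta q p e) t (zip_conf (Ins b c K) (map Some xs) (map Some ds))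
     (Bck K, otp (map Some (xs @ b # c # ds)), int (length xs + length ds))" (is "rch ?D _ _ _")
  using assms
proof (induction ds arbitrary: xs b c t)
  case Nil
  have s1: "astep ?D (zip_conf (Ins b c K) (map Some xs) [])
      = zip_conf (Ins1 c K) (map Some xs @ [Some b]) []"
    by (subst zip_conf_None[symmetric], rule zip_step_right) simp
  have s2: "astep ?D (zip_conf (Ins1 c K) (map Some xs @ [Some b]) [])
      = zip_conf (Bck K) (map Some xs) [Some b, Some c]"
    by (subst zip_conf_None[symmetric], rule zip_step_left) simp
  show ?case using Nil
    by (simp, intro rch_step[OF s1, of 1] rch_step[OF s2, of 0])
      (auto intro: rch_refl simp: zip_conf_def)
next
  case (Cons d ds)
  have s: "astep ?D (zip_conf (Ins b c K) (map Some xs) (map Some (d # ds)))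
      = zip_conf (Ins c d K) (map Some (xs @ [b])) (map Some ds)"
    using zip_step_right[of "?D" "Ins b c K" "Some d" "Ins c d K" "Some b"] by simp
  show ?case using Cons.IH[OF le_refl, of c d "xs @ [b]"] Cons.prems
    by (intro rch_step[OF s, of "length ds + 2"]) auto
qed

lemma rch_DelR:
  assumes "length ds < t"
  shows "rch (delta q p e) t (zip_conf (DelR K) xs (map Some ds))
     (DelL None None K, otp (xs @ map Some ds), int (length xs + length ds) - 1)" (is "rch ?D _ _ _")
  using assms
proof (induction ds arbitrary: xs t)
  case Nil
  have s: "astep ?D (zip_conf (DelR K) xs [])
      = (DelL None None K, otp xs, int (length xs) - 1)"
    using zip_step[of "?D" "DelR K" None _ _ _ xs "[]"] by (simp add: zip_conf_None otp_None)
  show ?case using Nil rch_step[OF s rch_refl[of _ 0], of t] by simp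
next
  case (Cons d ds)
  have s: "astep ?D (zip_conf (DelR K) xs (map Some (d # ds)))
      = zip_conf (DelR K) (xs @ [Some d]) (map Some ds)"
    using zip_step_right[of "?D" "DelR K" "Some d"] by simp
  show ?case using Cons.IH[of "Suc (length ds)" "xs @ [Some d]"] Cons.prems
    by (intro rch_step[OF s, of "Suc (length ds)"]) auto
qed

text \<open>The mirror image of \<open>Ins\<close>, from right to left: \<open>u\<close> is written
  before \<open>v\<close> and so lands to its right. Started with two blanks in the buffer, this
  exchanges the gap and the block \<open>ds\<close>.\<close>

lemma rch_DelL:
  assumes "length ds + 2 \<le> t"
  shows "rch (delta q p e) t (DelL u v K, otp (xs @ [None, None] @ map Some ds @ ys), int (length xs + 2 + length ds) - 1)
     (Bck K, otp (xs @ map Some ds @ v # u # ys), int (length xs) - 1)" (is "rch ?D _ _ _")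
  using assms
proof (induction ds arbitrary: u v t ys rule: rev_induct)
  case Nil
  have s1: "astep ?D (DelL u v K, otp (xs @ [None, None] @ ys), int (length xs + 2) - 1)
      = zip_conf (DelM v K) xs (None # u # ys)"
    using zip_step_left[of "?D" "DelL u v K" None "DelM v K" u xs None ys]
    by (simp add: zip_conf_def)
  have s2: "astep ?D (zip_conf (DelM v K) xs (None # u # ys))
      = (Bck K, otp (xs @ v # u # ys), int (length xs) - 1)"
    using zip_step[of "?D" "DelM v K" None _ _ _ xs "u # ys"] by simp
  show ?case using Nil rch_step[OF s1 rch_step[OF s2 rch_refl[of _ 0], of 1], of t]
    by simp
next
  case (snoc d ds)
  have s: "astep ?D (DelL u v K, otp (xs @ [None, None] @ map Some (ds @ [d]) @ ys), int (length xs + 2 + length (ds @ [d])) - 1)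
      = (DelL v (Some d) K, otp (xs @ [None, None] @ map Some ds @ u # ys), int (length xs + 2 + length ds) - 1)"
    using zip_step[of "?D" "DelL u v K" "Some d" "DelL v (Some d) K" u "-1" "xs @ [None, None] @ map Some ds" ys]
    by (simp add: zip_conf_def algebra_simps)
  show ?case using snoc.IH[OF le_refl, of v "Some d" "u # ys"] snoc.prems
    by (intro rch_step[OF s, of "length ds + 2"]) auto
qed

section \<open>Simulation of programs by the automaton\<close>

definition enc_store :: "nat \<Rightarrow> store \<Rightarrow> bool list" where
  "enc_store k R = enc_tuple (map R [0..<k])"

lemma upt_split: "r < k \<Longrightarrow> [0..<k] = [0..<r] @ r # [Suc r..<k]"
  by (metis le_add_diff_inverse less_imp_le_nat upt_add_eq_append upt_conv_Cons zero_le)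

lemma enc_store_split:
  assumes "r < k"
  shows "enc_store k R = enc_tuple (map R [0..<r]) @ dbl (R r) @ [True, False] @ enc_tuple (map R [Suc r..<k])"
  unfolding enc_store_def upt_split[OF assms] by (simp add: enc_tuple_append enc_tuple_Cons)

lemma enc_store_upd:
  assumes "r < k"
  shows "enc_store k (R(r := w)) = enc_tuple (map R [0..<r]) @ dbl w @ [True, False] @ enc_tuple (map R [Suc r..<k])"
proof -
  have "map (R(r := w)) [0..<r] = map R [0..<r]" "map (R(r := w)) [Suc r..<k] = map R [Suc r..<k]" by auto
  then show ?thesis unfolding enc_store_split[OF assms] by simp
qed

definition rdy_conf :: "nat \<Rightarrow> com list \<Rightarrow> store \<Rightarrow> st conf" where
  "rdy_conf k K R = zip_conf (Rdy K) [] (map Some (enc_store k R))"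

definition enter_conf :: "nat \<Rightarrow> st \<Rightarrow> store \<Rightarrow> st conf" where
  "enter_conf k q R = zip_conf q [] (map Some (enc_store k R))"

lemma rch_stay:
  assumes "\<And>a. delta q p e s a = (s', a, 0)" "rch (delta q p e) t (zip_conf s' [] ys) c" "t < v"
  shows "rch (delta q p e) v (zip_conf s [] ys) c"
proof (rule rch_step)
  show "astep (delta q p e) (zip_conf s [] ys) = zip_conf s' [] ys"
    using assms(1) by (simp add: astep_def zip_conf_def)
qed (use assms in auto)

lemma rch_push:
  assumes "r < k" "4 * length (enc_store k R) + 10 \<le> t"
  shows "rch (delta q p e) t (enter_conf k (Skp r (APush b K)) R) (rdy_conf k K (R(r := b # R r)))" (is "rch ?D _ _ _")
proof -
  let ?p = "enc_tuple (map R [0..<r])"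
  let ?d = "dbl (R r) @ [True, False] @ enc_tuple (map R [Suc r..<k])"
  have E: "enc_store k R = ?p @ ?d" using enc_store_split[OF assms(1)] .
  have E': "enc_store k (R(r := b # R r)) = ?p @ b # b # ?d" using enc_store_upd[OF assms(1)] by simp
  have len: "length (enc_store k R) = length ?p + length ?d" unfolding E by simp
  have 1: "rch ?D (length ?p) (enter_conf k (Skp r (APush b K)) R)
      (zip_conf (Skp 0 (APush b K)) (map Some ?p) (map Some ?d))"
    using rch_Skp[OF le_refl, of q p e "map R [0..<r]" "APush b K" "[]" "map Some ?d"]
    unfolding enter_conf_def E by simp
  have 2: "rch ?D 1 (zip_conf (Skp 0 (APush b K)) (map Some ?p) (map Some ?d))
     (zip_conf (Ins b b K) (map Some ?p) (map Some ?d))"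
    by (rule rch_step[OF _ rch_refl[of _ 0]]) (auto simp: astep_def zip_conf_def)
  have 3: "rch ?D (length ?d + 2) (zip_conf (Ins b b K) (map Some ?p) (map Some ?d))
     (Bck K, otp (map Some (?p @ b # b # ?d)), int (length ?p + length ?d))"
    by (rule rch_Ins) simp
  have 4: "rch ?D (length ?p + length ?d + 4) (Bck K, otp (map Some (?p @ b # b # ?d)), int (length ?p + length ?d))
    (rdy_conf k K (R(r := b # R r)))"
    unfolding rdy_conf_def zip_conf_def E' append_Nil list.size int_ops
    by (rule rch_Bck) (auto simp: otp_def nth_append nth_Cons')
  show ?thesis using assms(2) len
    by (intro rch_trans[OF rch_trans[OF rch_trans[OF 1 2 le_refl] 3 le_refl] 4]) auto
qed

lemma rch_pop_Nil:
  assumes "r < k" "4 * length (enc_store k R) + 10 \<le> t" "R r = []"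
  shows "rch (delta q p e) t (enter_conf k (Skp r (APop K f)) R) (rdy_conf k K R)" (is "rch ?D _ _ _")
proof -
  let ?p = "enc_tuple (map R [0..<r])"
  let ?e = "enc_tuple (map R [Suc r..<k])"
  have E: "enc_store k R = ?p @ True # False # ?e" using enc_store_split[OF assms(1), of R] assms(3) by simp
  have len: "length (enc_store k R) = length ?p + 2 + length ?e" unfolding E by simp
  have 1: "rch ?D (length ?p) (enter_conf k (Skp r (APop K f)) R)
      (zip_conf (Skp 0 (APop K f)) (map Some ?p) (map Some (True # False # ?e)))"
    using rch_Skp[OF le_refl, of q p e "map R [0..<r]" _ "[]" "map Some (True # False # ?e)"]
    unfolding enter_conf_def E by simp
  have 2: "rch ?D 1 (zip_conf (Skp 0 (APop K f)) (map Some ?p) (map Some (True # False # ?e)))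
     (zip_conf (PopA True K f) (map Some ?p @ [Some True]) (map Some (False # ?e)))"
    by (rule rch_step[OF _ rch_refl[of _ 0]]) (auto intro!: zip_step_right)
  have 3: "rch ?D 1 (zip_conf (PopA True K f) (map Some ?p @ [Some True]) (map Some (False # ?e)))
     (Bck K, otp (map Some (?p @ True # False # ?e)), int (length ?p))"
    using zip_step_left[of "?D" "PopA True K f" "Some False" "Bck K" "Some False" "map Some ?p" "Some True" "map Some ?e"]
    by (intro rch_step[OF _ rch_refl[of _ 0]]) (auto simp: zip_conf_def)
  have 4: "rch ?D (length ?p + 4) (Bck K, otp (map Some (?p @ True # False # ?e)), int (length ?p))
    (rdy_conf k K R)"
    unfolding rdy_conf_def zip_conf_def E append_Nil list.size int_ops
    by (rule rch_Bck) (auto simp: otp_def nth_append nth_Cons')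
  show ?thesis using assms(2) len
    by (intro rch_trans[OF rch_trans[OF rch_trans[OF 1 2 le_refl] 3 le_refl] 4]) auto
qed

lemma rch_pop_Cons:
  assumes "r < k" "4 * length (enc_store k R) + 10 \<le> t" "R r = b # bs"
  shows "rch (delta q p e) t (enter_conf k (Skp r (APop K f)) R) (rdy_conf k (f b) (R(r := bs)))" (is "rch ?D _ _ _")
proof -
  let ?p = "enc_tuple (map R [0..<r])"
  let ?d = "dbl bs @ [True, False] @ enc_tuple (map R [Suc r..<k])"
  have E: "enc_store k R = ?p @ b # b # ?d" using enc_store_split[OF assms(1), of R] assms(3) by simp
  have E': "enc_store k (R(r := bs)) = ?p @ ?d" using enc_store_upd[OF assms(1)] by simp
  have len: "length (enc_store k R) = length ?p + 2 + length ?d" unfolding E by simp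
  have 1: "rch ?D (length ?p) (enter_conf k (Skp r (APop K f)) R)
      (zip_conf (Skp 0 (APop K f)) (map Some ?p) (map Some (b # b # ?d)))"
    using rch_Skp[OF le_refl, of q p e "map R [0..<r]" _ "[]" "map Some (b # b # ?d)"]
    unfolding enter_conf_def E by simp
  have 2: "rch ?D 1 (zip_conf (Skp 0 (APop K f)) (map Some ?p) (map Some (b # b # ?d)))
     (zip_conf (PopA b K f) (map Some ?p @ [Some b]) (map Some (b # ?d)))"
    by (rule rch_step[OF _ rch_refl[of _ 0]]) (auto intro!: zip_step_right)
  have 3: "rch ?D 1 (zip_conf (PopA b K f) (map Some ?p @ [Some b]) (map Some (b # ?d)))
     (zip_conf (Del1 (f b)) (map Some ?p) (Some b # None # map Some ?d))"
    using zip_step_left[of "?D" "PopA b K f" "Some b" "Del1 (f b)" "None" "map Some ?p" "Some b" "map Some ?d"]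
    by (intro rch_step[OF _ rch_refl[of _ 0]]) auto
  have 4: "rch ?D 1 (zip_conf (Del1 (f b)) (map Some ?p) (Some b # None # map Some ?d))
     (zip_conf (Del2 (f b)) (map Some ?p @ [None]) (None # map Some ?d))"
    by (rule rch_step[OF _ rch_refl[of _ 0]]) (auto intro!: zip_step_right)
  have 5: "rch ?D 1 (zip_conf (Del2 (f b)) (map Some ?p @ [None]) (None # map Some ?d))
     (zip_conf (DelR (f b)) ((map Some ?p @ [None]) @ [None]) (map Some ?d))"
    by (intro rch_step[OF zip_step_right rch_refl[of _ 0]]) auto
  have 6: "rch ?D (length ?d + 1) (zip_conf (DelR (f b)) ((map Some ?p @ [None]) @ [None]) (map Some ?d))
     (DelL None None (f b), otp (map Some ?p @ [None, None] @ map Some ?d @ []), int (length (map Some ?p) + 2 + length ?d) - 1)"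
    using rch_DelR[of ?d "length ?d + 1" q p e "f b" "(map Some ?p @ [None]) @ [None]"] by simp
  have 7: "rch ?D (length ?d + 2) (DelL None None (f b), otp (map Some ?p @ [None, None] @ map Some ?d @ []), int (length (map Some ?p) + 2 + length ?d) - 1)
     (Bck (f b), otp (map Some ?p @ map Some ?d @ [None, None]), int (length (map Some ?p)) - 1)"
    by (rule rch_DelL) simp
  have o: "otp (map Some ?p @ map Some ?d @ [None, None]) = otp (map Some (?p @ ?d))"
    using otp_None[of "map Some ?p @ map Some ?d @ [None]"] otp_None[of "map Some ?p @ map Some ?d"] by simp
  have 8: "rch ?D (length ?p + 2) (Bck (f b), otp (map Some ?p @ map Some ?d @ [None, None]), int (length (map Some ?p)) - 1)
    (rdy_conf k (f b) (R(r := bs)))"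
    unfolding rdy_conf_def E' o using rch_Bck_zip[OF le_refl, where xs="?p" and ys="?d"] by simp
  show ?thesis using assms(2) len
    by (intro rch_trans[OF rch_trans[OF rch_trans[OF rch_trans[OF rch_trans[OF rch_trans[OF rch_trans[OF 1 2 le_refl] 3 le_refl] 4 le_refl] 5 le_refl] 6 le_refl] 7 le_refl] 8]) auto
qed

lemma length_enc_store_upd:
  assumes "r < k"
  shows "length (enc_store k (R(r := w))) + 2 * length (R r) = length (enc_store k R) + 2 * length w"
  unfolding enc_store_upd[OF assms] enc_store_split[OF assms, of R] by simp

text \<open>Only \<open>Push\<close> lengthens a register, by one bit and thus two tape cells, and
  every push is charged at least one unit of time.\<close>

lemma exec_length:
  assumes "exec c R t S" "regs_below k c"
  shows "length (enc_store k S) \<le> length (enc_store k R) + 2 * t"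
  using assms
proof (induction rule: exec.induct)
  case (exec_Push t r b R)
  then show ?case using length_enc_store_upd[of r k R "b # R r"] by (simp add: fun_upd_def)
next
  case (exec_Case_Cons R r b bs f t1 S t c)
  then show ?case using length_enc_store_upd[of r k R bs] by (simp add: fun_upd_def)
next
  case (exec_Loop_Cons R r b bs f t1 S t2 T t)
  then show ?case using length_enc_store_upd[of r k R bs] by (simp add: fun_upd_def)
qed auto

text \<open>By \<open>exec_length\<close>, \<open>M\<close> bounds the tape length throughout the
  run, so a register access is a sweep of at most 4 * M + 10 steps. The rest of the factor pays for
  unfolding the program in the control.\<close>

theorem exec_rch:
  assumes "exec c R t S" "regs_below k c" "length (enc_store k R) + 2 * t \<le> M"
  shows "rch (delta q p e) (t * (4 * M + 20)) (rdy_conf k (c # K) R) (rdy_conf k K S)" (is "rch ?D (_ * ?B) _ _")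
  using assms
proof (induction arbitrary: K rule: exec.induct)
  case (exec_Skip t R)
  have "1 * ?B \<le> t * ?B" using exec_Skip by (intro mult_right_mono) auto
  then show ?case unfolding rdy_conf_def by (intro rch_stay[OF _ rch_refl[of _ 0]]) auto
next
  case (exec_Push t r b R)
  have "1 * ?B \<le> t * ?B" using exec_Push by (intro mult_right_mono) auto
  then have "?B \<le> t * ?B" by (simp only: mult_1)
  then have "4 * M + 10 < t * ?B" by arith
  moreover have "rch ?D (4 * M + 10) (enter_conf k (Skp r (APush b K)) R) (rdy_conf k K (R(r := b # R r)))"
    using exec_Push by (intro rch_push) auto
  ultimately show ?case unfolding rdy_conf_def enter_conf_def
    by (intro rch_stay[of _ _ _ "Rdy _" "Skp r (APush b K)" "4 * M + 10"]) auto
next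
  case (exec_Seq c R t1 S d t2 T t)
  have len: "length (enc_store k S) \<le> length (enc_store k R) + 2 * t1"
    using exec_length exec_Seq by auto
  have "rch ?D (t1 * ?B) (rdy_conf k (c # d # K) R) (rdy_conf k (d # K) S)"
    using exec_Seq by auto
  moreover have "rch ?D (t2 * ?B) (rdy_conf k (d # K) S) (rdy_conf k K T)"
    using exec_Seq len by auto
  ultimately have "rch ?D (t1 * ?B + t2 * ?B) (rdy_conf k (c # d # K) R) (rdy_conf k K T)"
    using rch_trans by blast
  moreover have "(t1 + t2 + 1) * ?B \<le> t * ?B" using exec_Seq by (intro mult_right_mono) auto
  ultimately show ?case unfolding rdy_conf_def
    by (intro rch_stay[of _ _ _ "Rdy (Seq c d # K)" "Rdy (c # d # K)" "t1 * ?B + t2 * ?B"])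
      (auto simp: algebra_simps)
next
  case (exec_Case_Nil R r c t1 S t f)
  have 1: "rch ?D (4 * M + 10) (enter_conf k (Skp r (APop (c # K) (\<lambda>b. f b # K))) R) (rdy_conf k (c # K) R)"
    using exec_Case_Nil by (intro rch_pop_Nil) auto
  have 2: "rch ?D (t1 * ?B) (rdy_conf k (c # K) R) (rdy_conf k K S)"
    using exec_Case_Nil by auto
  have "(t1 + 1) * ?B \<le> t * ?B" using exec_Case_Nil by (intro mult_right_mono) auto
  then show ?case using rch_trans[OF 1 2 le_refl] unfolding rdy_conf_def enter_conf_def
    by (intro rch_stay[of _ _ _ "Rdy _" "Skp r (APop (c # K) (\<lambda>b. f b # K))" "4 * M + 10 + t1 * ?B"])
      (auto simp: algebra_simps)
next
  case (exec_Case_Cons R r b bs f t1 S t c)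
  have 1: "rch ?D (4 * M + 10) (enter_conf k (Skp r (APop (c # K) (\<lambda>b. f b # K))) R) (rdy_conf k (f b # K) (R(r := bs)))"
    using exec_Case_Cons rch_pop_Cons[where f="\<lambda>b. f b # K"] by auto
  have 2: "rch ?D (t1 * ?B) (rdy_conf k (f b # K) (R(r := bs))) (rdy_conf k K S)"
    using exec_Case_Cons length_enc_store_upd[of r k R bs] by (auto simp: fun_upd_def)
  have "(t1 + 1) * ?B \<le> t * ?B" using exec_Case_Cons by (intro mult_right_mono) auto
  then show ?case using rch_trans[OF 1 2 le_refl] unfolding rdy_conf_def enter_conf_def
    by (intro rch_stay[of _ _ _ "Rdy _" "Skp r (APop (c # K) (\<lambda>b. f b # K))" "4 * M + 10 + t1 * ?B"])
      (auto simp: algebra_simps)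
next
  case (exec_Loop_Nil R r t f)
  have 1: "rch ?D (4 * M + 10) (enter_conf k (Skp r (APop K (\<lambda>b. f b # Loop r f # K))) R) (rdy_conf k K R)"
    using exec_Loop_Nil by (intro rch_pop_Nil) auto
  have "1 * ?B \<le> t * ?B" using exec_Loop_Nil by (intro mult_right_mono) auto
  then have "?B \<le> t * ?B" by (simp only: mult_1)
  then have "4 * M + 10 < t * ?B" by arith
  then show ?case using 1 unfolding rdy_conf_def enter_conf_def
    by (intro rch_stay[of _ _ _ "Rdy _" "Skp r (APop K (\<lambda>b. f b # Loop r f # K))" "4 * M + 10"])
      (auto simp: algebra_simps)
next
  case (exec_Loop_Cons R r b bs f t1 S t2 T t)
  have len: "length (enc_store k S) \<le> length (enc_store k (R(r := bs))) + 2 * t1"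
    using exec_length exec_Loop_Cons by (auto simp: fun_upd_def)
  have len': "length (enc_store k (R(r := bs))) \<le> length (enc_store k R)"
    using exec_Loop_Cons length_enc_store_upd[of r k R bs] by (auto simp: fun_upd_def)
  have 1: "rch ?D (4 * M + 10) (enter_conf k (Skp r (APop K (\<lambda>b. f b # Loop r f # K))) R) (rdy_conf k (f b # Loop r f # K) (R(r := bs)))"
    using exec_Loop_Cons rch_pop_Cons[where f="\<lambda>b. f b # Loop r f # K"] by auto
  have 2: "rch ?D (t1 * ?B) (rdy_conf k (f b # Loop r f # K) (R(r := bs))) (rdy_conf k (Loop r f # K) S)"
    using exec_Loop_Cons len' by (auto simp: fun_upd_def)
  have 3: "rch ?D (t2 * ?B) (rdy_conf k (Loop r f # K) S) (rdy_conf k K T)"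
    using exec_Loop_Cons len len' by (auto simp: fun_upd_def)
  have "(t1 + t2 + 1) * ?B \<le> t * ?B" using exec_Loop_Cons by (intro mult_right_mono) auto
  then show ?case using rch_trans[OF rch_trans[OF 1 2 le_refl] 3 le_refl] unfolding rdy_conf_def enter_conf_def
    by (intro rch_stay[of _ _ _ "Rdy _" "Skp r (APop K (\<lambda>b. f b # Loop r f # K))" "4 * M + 10 + t1 * ?B + t2 * ?B"])
      (auto simp: algebra_simps)
qed

section \<open>Finiteness of the control, and numbering of the states\<close>

fun acts_on :: "com list set \<Rightarrow> act \<Rightarrow> bool" where
  "acts_on C (APush b K) = (K \<in> C)"
| "acts_on C (APop K f) = (K \<in> C \<and> (\<forall>b. f b \<in> C))"
| "acts_on C AFin = True"

text \<open>States carry continuation lists, of which there are infinitely many.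
  \<open>conts c K\<close> collects those met while \<open>c\<close> runs with \<open>K\<close>
  pending, up to the return to \<open>K\<close>; it is finite because a loop re-enters the same
  list.\<close>

primrec conts :: "com \<Rightarrow> com list \<Rightarrow> com list set" where
  "conts Skip K = {Skip # K}"
| "conts (Push r b) K = {Push r b # K}"
| "conts (Seq c d) K = insert (Seq c d # K) (conts c (d # K) \<union> conts d K)"
| "conts (Case r c f) K = insert (Case r c f # K) (conts c K \<union> (\<Union>b. conts (f b) K))"
| "conts (Loop r f) K = insert (Loop r f # K) (\<Union>b. conts (f b) (Loop r f # K))"

lemma finite_conts: "finite (conts c K)"
  by (induction c arbitrary: K) auto

lemma conts_self: "c # K \<in> conts c K"
  by (cases c) auto

fun succs :: "com list \<Rightarrow> com list set" where
  "succs [] = {}"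
| "succs (Skip # K) = {K}"
| "succs (Push r b # K) = {K}"
| "succs (Seq c d # K) = {c # d # K}"
| "succs (Case r c f # K) = insert (c # K) (range (\<lambda>b. f b # K))"
| "succs (Loop r f # K) = insert K (range (\<lambda>b. f b # Loop r f # K))"

lemma conts_closed: "L \<in> conts c K \<Longrightarrow> succs L \<subseteq> insert K (conts c K)"
proof (induction c arbitrary: K)
  case (Seq c d)
  from Seq.prems consider "L = Seq c d # K" | "L \<in> conts c (d # K)" | "L \<in> conts d K" by auto
  then show ?case
  proof cases
    case 1 then show ?thesis using conts_self by simp
  next
    case 2 then show ?thesis using Seq.IH(1)[of "d # K"] conts_self[of d K] by (simp add: subset_iff) blast
  next
    case 3 then show ?thesis using Seq.IH(2)[of K] by (simp add: subset_iff) blast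
  qed
next
  case (Case r c f)
  have "succs L \<subseteq> insert K (conts c K \<union> (\<Union>b. conts (f b) K))" if "L \<noteq> Case r c f # K"
  proof -
    from that Case.prems consider "L \<in> conts c K" | b where "L \<in> conts (f b) K" by auto
    then show ?thesis
    proof cases
      case 1 then show ?thesis using Case.IH(1) by blast
    next
      case (2 b) then show ?thesis using Case.IH(2)[of "f b" K] by blast
    qed
  qed
  moreover have "succs (Case r c f # K) \<subseteq> insert K (conts c K \<union> (\<Union>b. conts (f b) K))"
    using conts_self[of c K] conts_self[of _ K] by auto
  ultimately show ?case by (cases "L = Case r c f # K") auto
next
  case (Loop r f)
  have "succs L \<subseteq> insert (Loop r f # K) (\<Union>b. conts (f b) (Loop r f # K))" if "L \<noteq> Loop r f # K"
  proof -
    from that Loop.prems obtain b where "L \<in> conts (f b) (Loop r f # K)" by auto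
    then show ?thesis using Loop.IH[of "f b" "Loop r f # K"] by blast
  qed
  moreover have "succs (Loop r f # K) \<subseteq> insert K (\<Union>b. conts (f b) (Loop r f # K))"
    using conts_self[of _ "Loop r f # K"] by auto
  ultimately show ?case by (cases "L = Loop r f # K") auto
qed auto

fun ok_state :: "com list set \<Rightarrow> nat \<Rightarrow> nat \<Rightarrow> st \<Rightarrow> bool" where
  "ok_state C e k (App n) = (n \<le> e)"
| "ok_state C e k (App1 n) = (n \<le> e)"
| "ok_state C e k (Rdy K) = (K \<in> C)"
| "ok_state C e k (Skp n A) = (n \<le> k \<and> acts_on C A)"
| "ok_state C e k (Skq b n A) = (n < k \<and> acts_on C A)"
| "ok_state C e k (Ins b c K) = (K \<in> C)"
| "ok_state C e k (Ins1 b K) = (K \<in> C)"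
| "ok_state C e k (PopA b K f) = (K \<in> C \<and> (\<forall>b. f b \<in> C))"
| "ok_state C e k (Del1 K) = (K \<in> C)"
| "ok_state C e k (Del2 K) = (K \<in> C)"
| "ok_state C e k (DelR K) = (K \<in> C)"
| "ok_state C e k (DelL x y K) = (K \<in> C)"
| "ok_state C e k (DelM x K) = (K \<in> C)"
| "ok_state C e k (Bck K) = (K \<in> C)"
| "ok_state C e k _ = True"

lemma finite_bool_fun: "finite C \<Longrightarrow> finite {f :: bool \<Rightarrow> 'a. \<forall>b. f b \<in> C}"
proof -
  assume "finite C"
  moreover have "{f :: bool \<Rightarrow> 'a. \<forall>b. f b \<in> C} \<subseteq> (\<lambda>(x, y) b. if b then x else y) ` (C \<times> C)"
  proof
    fix f :: "bool \<Rightarrow> 'a" assume "f \<in> {f. \<forall>b. f b \<in> C}"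
    moreover have "f = (\<lambda>b. if b then f True else f False)" by (rule ext) auto
    ultimately show "f \<in> (\<lambda>(x, y) b. if b then x else y) ` (C \<times> C)"
      by (intro image_eqI[of _ _ "(f True, f False)"]) auto
  qed
  ultimately show ?thesis by (meson finite_SigmaI finite_imageI finite_subset)
qed

lemma finite_acts: "finite C \<Longrightarrow> finite {A. acts_on C A}"
proof -
  assume C: "finite C"
  have "{A. acts_on C A} \<subseteq> insert AFin ((\<lambda>(b, K). APush b K) ` (UNIV \<times> C)
      \<union> (\<lambda>(K, f). APop K f) ` (C \<times> {f. \<forall>b. f b \<in> C}))" (is "_ \<subseteq> ?S")
  proof
    fix A assume "A \<in> {A. acts_on C A}"
    then show "A \<in> ?S" by (cases A) (auto simp: image_iff)
  qed
  moreover have "finite ?S" using C finite_bool_fun[OF C] by auto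
  ultimately show ?thesis by (rule finite_subset)
qed

lemma finite_states:
  assumes C: "finite C"
  shows "finite {s. ok_state C e k s}"
proof -
  let ?A = "{A. acts_on C A}"
  let ?S = "{Ini, Fin, Halt} \<union> App ` {..e} \<union> App1 ` {..e} \<union> Rdy ` C
     \<union> (\<lambda>(n, A). Skp n A) ` ({..k} \<times> ?A) \<union> (\<lambda>(b, n, A). Skq b n A) ` (UNIV \<times> {..k} \<times> ?A)
     \<union> (\<lambda>(b, c, K). Ins b c K) ` (UNIV \<times> UNIV \<times> C) \<union> (\<lambda>(b, K). Ins1 b K) ` (UNIV \<times> C)
     \<union> (\<lambda>(b, K, f). PopA b K f) ` (UNIV \<times> C \<times> {f. \<forall>b. f b \<in> C})
     \<union> Del1 ` C \<union> Del2 ` C \<union> DelR ` C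
     \<union> (\<lambda>(x, y, K). DelL x y K) ` (UNIV \<times> UNIV \<times> C) \<union> (\<lambda>(x, K). DelM x K) ` (UNIV \<times> C)
     \<union> Bck ` C"
  have "{s. ok_state C e k s} \<subseteq> ?S"
  proof
    fix s assume "s \<in> {s. ok_state C e k s}"
    then have s: "ok_state C e k s" by simp
    show "s \<in> ?S"
    proof (cases s)
      case (Skp n A)
      then have "s \<in> (\<lambda>(n, A). Skp n A) ` ({..k} \<times> ?A)" using s by (intro image_eqI[of _ _ "(n, A)"]) auto
      then show ?thesis by blast
    next
      case (Skq b n A)
      then have "s \<in> (\<lambda>(b, n, A). Skq b n A) ` (UNIV \<times> {..k} \<times> ?A)" using s by (intro image_eqI[of _ _ "(b, n, A)"]) auto
      then show ?thesis by blast
    next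
      case (Ins b c K)
      then have "s \<in> (\<lambda>(b, c, K). Ins b c K) ` (UNIV \<times> UNIV \<times> C)" using s by (intro image_eqI[of _ _ "(b, c, K)"]) auto
      then show ?thesis by blast
    next
      case (Ins1 b K)
      then have "s \<in> (\<lambda>(b, K). Ins1 b K) ` (UNIV \<times> C)" using s by (intro image_eqI[of _ _ "(b, K)"]) auto
      then show ?thesis by blast
    next
      case (PopA b K f)
      then have "s \<in> (\<lambda>(b, K, f). PopA b K f) ` (UNIV \<times> C \<times> {f. \<forall>b. f b \<in> C})" using s by (intro image_eqI[of _ _ "(b, K, f)"]) auto
      then show ?thesis by blast
    next
      case (DelL x y K)
      then have "s \<in> (\<lambda>(x, y, K). DelL x y K) ` (UNIV \<times> UNIV \<times> C)" using s by (intro image_eqI[of _ _ "(x, y, K)"]) auto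
      then show ?thesis by blast
    next
      case (DelM x K)
      then have "s \<in> (\<lambda>(x, K). DelM x K) ` (UNIV \<times> C)" using s by (intro image_eqI[of _ _ "(x, K)"]) auto
      then show ?thesis by blast
    qed (use s in \<open>hypsubst, simp only: ok_state.simps, blast\<close>)+
  qed
  moreover have "finite ?S"
    using C finite_acts[OF C] finite_bool_fun[OF C]
    by (intro finite_UnI finite_imageI finite_cartesian_product) (assumption | rule finite_atMost finite | simp)+
  ultimately show ?thesis by (rule finite_subset)
qed

text \<open>The register number of the next command becomes the counter of \<open>Skp\<close>, so
  bounding it keeps the set of states finite.\<close>

lemma conts_regs: "L \<in> conts c K \<Longrightarrow> regs_below k c \<Longrightarrow> list_all (regs_below k) K \<Longrightarrow> list_all (regs_below k) L"
proof (induction c arbitrary: K)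
  case (Case r c f)
  from Case.prems consider "L = Case r c f # K" | "L \<in> conts c K" | b where "L \<in> conts (f b) K" by auto
  then show ?case
  proof cases
    case 1 then show ?thesis using Case.prems by simp
  next
    case 2 then show ?thesis using Case.IH(1) Case.prems by simp
  next
    case (3 b) then show ?thesis using Case.IH(2)[of "f b" K] Case.prems by simp
  qed
next
  case (Loop r f)
  from Loop.prems consider "L = Loop r f # K" | b where "L \<in> conts (f b) (Loop r f # K)" by auto
  then show ?case
  proof cases
    case 1 then show ?thesis using Loop.prems by simp
  next
    case (2 b) then show ?thesis using Loop.IH[of "f b" "Loop r f # K"] Loop.prems by simp
  qed
qed auto

lemma states_closed:
  assumes s: "ok_state C e k s" and C: "C = insert [] (conts p [])" and p: "regs_below k p" and k: "2 \<le> k"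
  shows "ok_state C e k (fst (delta q p e s a)) \<and> snd (snd (delta q p e s a)) \<in> {-1, 0, 1}"
proof -
  have pC: "[p] \<in> C" using conts_self C by auto
  have cl: "succs L \<subseteq> C" if "L \<in> C" for L using that conts_closed[of L p "[]"] C by auto
  have rg: "list_all (regs_below k) L" if "L \<in> C" for L using that conts_regs[of L p "[]" k] p C by auto
  show ?thesis
  proof (cases s)
    case (App n)
    then show ?thesis using s pC by (cases n) auto
  next
    case (Rdy K)
    then have K: "K \<in> C" using s by auto
    show ?thesis
    proof (cases K)
      case Nil
      then show ?thesis using Rdy k by auto
    next
      case (Cons c L)
      have "succs (c # L) \<subseteq> C" using cl[OF K] Cons by simp
      moreover have "regs_below k c" using rg[OF K] Cons by simp
      ultimately show ?thesis using Rdy Cons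
        by (cases c) auto
    qed
  next
    case (Skp n A)
    then show ?thesis using s by (cases n; cases A) auto
  next
    case (Ins b c K)
    then show ?thesis using s by (cases a) auto
  next
    case (DelL b c K)
    then show ?thesis using s by (cases a) auto
  qed (use s pC in auto)
qed

text \<open>\<open>tm\<close> fixes 0 as start state and 1 as halting state, so these two are
  numbered by hand and the others are shifted by 2.\<close>

lemma numbering_exists:
  assumes "finite Q" "a \<in> Q" "b \<in> Q" "a \<noteq> b"
  shows "\<exists>f :: 'a \<Rightarrow> nat. inj_on f Q \<and> f ` Q \<subseteq> {..<card Q} \<and> f a = 0 \<and> f b = 1"
proof -
  obtain g where g: "bij_betw g (Q - {a, b}) {0..<card (Q - {a, b})}"
    using ex_bij_betw_finite_nat[OF finite_Diff[OF assms(1)]] by blast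
  have 1: "Suc (card (Q - {a})) = card Q" by (rule card_Suc_Diff1[OF assms(1,2)])
  have 2: "Suc (card (Q - {a} - {b})) = card (Q - {a})" by (rule card_Suc_Diff1) (use assms in auto)
  have 3: "Q - {a} - {b} = Q - {a, b}" by auto
  have c: "card (Q - {a, b}) + 2 = card Q" using 1 2 unfolding 3 by linarith
  let ?f = "\<lambda>x. if x = a then 0 else if x = b then 1 else g x + 2"
  have gl: "g x < card (Q - {a, b})" if "x \<in> Q" "x \<noteq> a" "x \<noteq> b" for x
    using bij_betwE[OF g, rule_format, of x] that by simp
  have "inj_on ?f Q"
  proof (rule inj_onI)
    fix x y assume xy: "x \<in> Q" "y \<in> Q" "?f x = ?f y"
    show "x = y"
    proof (cases "x \<in> {a, b} \<or> y \<in> {a, b}")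
      case True
      then show ?thesis using xy(3) assms(4) by (auto split: if_splits)
    next
      case False
      then have "g x = g y" using xy(3) by simp
      then show ?thesis using inj_onD[OF bij_betw_imp_inj_on[OF g], of x y] xy False by blast
    qed
  qed
  moreover have "?f ` Q \<subseteq> {..<card Q}"
  proof (rule image_subsetI)
    fix x assume "x \<in> Q"
    then show "?f x \<in> {..<card Q}" using gl[of x] c by (cases "x = a"; cases "x = b") simp_all
  qed
  moreover have "?f a = 0" "?f b = 1" using assms(4) by simp_all
  ultimately show ?thesis by blast
qed

lemma tm_of_states:
  assumes Q: "finite Q" "s0 \<in> Q" "sh \<in> Q" "s0 \<noteq> sh"
    and cl: "\<And>s a. s \<in> Q \<Longrightarrow> fst (D s a) \<in> Q \<and> snd (snd (D s a)) \<in> {-1, 0, 1}"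
    and hlt: "\<And>a. D sh a = (sh, a, 0)"
  shows "\<exists>M. tm_wf M \<and> (\<forall>x t tp h. (astep D ^^ t) (s0, snd (tm_init x)) = (sh, tp, h)
     \<longrightarrow> tm_run M x t = (1, tp, h))"
proof -
  obtain f :: "'a \<Rightarrow> nat" where f: "inj_on f Q" "f ` Q \<subseteq> {..<card Q}" "f s0 = 0" "f sh = 1"
    using numbering_exists[OF Q] by auto
  \<comment> \<open>The default \<open>sh\<close> keeps \<open>g n\<close> in \<open>Q\<close> for
    every number without an appeal to surjectivity of \<open>f\<close>.\<close>
  define g where "g n = (if n \<in> f ` Q then the_inv_into Q f n else sh)" for n
  have gf: "g (f s) = s" if "s \<in> Q" for s using that f(1) by (simp add: g_def the_inv_into_f_f)
  have gQ: "g n \<in> Q" for n using f(1) Q(3) by (auto simp: g_def the_inv_into_into)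
  define M :: tm where "M = (card Q, \<lambda>n a. case D (g n) a of (s, b, d) \<Rightarrow> (f s, b, d))"
  have "2 \<le> card Q" using card_mono[OF Q(1), of "{s0, sh}"] Q by auto
  moreover have "case snd M n a of (s', b, d) \<Rightarrow> s' < fst M \<and> d \<in> {-1, 0, 1}" for n a
    using cl[OF gQ[of n], of a] f(2) by (auto simp: M_def split: prod.splits)
  ultimately have wf: "tm_wf M" unfolding tm_wf_def by (auto simp: M_def)
  have "fst ((astep D ^^ t) (s0, snd (tm_init x))) \<in> Q \<and>
     tm_run M x t = (f (fst ((astep D ^^ t) (s0, snd (tm_init x)))), snd ((astep D ^^ t) (s0, snd (tm_init x))))" for x t
  proof (induction t)
    case 0
    then show ?case using Q f by (simp add: tm_run_def tm_init_def)
  next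
    case (Suc t)
    obtain s tp h where c: "(astep D ^^ t) (s0, snd (tm_init x)) = (s, tp, h)" by (metis prod_cases3)
    obtain s' b d where D: "D s (tp h) = (s', b, d)" by (metis prod_cases3)
    have s: "s \<in> Q" and r: "tm_run M x t = (f s, tp, h)" using Suc c by auto
    have s': "s' \<in> Q" using cl[OF s, of "tp h"] D by simp
    have "tm_run M x (Suc t) = tm_step M (f s, tp, h)" using r by (simp add: tm_run_def)
    also have "tm_step M (f s, tp, h) = (f s', tp(h := b), h + d)"
    proof (cases "s = sh")
      case True
      then show ?thesis using D hlt[of "tp h"] f(4) by (auto simp: tm_step_def)
    next
      case False
      then have "f s \<noteq> 1" using f(1,4) s Q(3) by (metis inj_onD)
      then show ?thesis using D gf[OF s] by (simp add: tm_step_def M_def)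
    qed
    finally have "tm_run M x (Suc t) = (f s', tp(h := b), h + d)" .
    moreover have "astep D (s, tp, h) = (s', tp(h := b), h + d)" using D by (simp add: astep_def)
    ultimately show ?case using c s' by simp
  qed
  then have "\<forall>x t tp h. (astep D ^^ t) (s0, snd (tm_init x)) = (sh, tp, h) \<longrightarrow> tm_run M x t = (1, tp, h)"
    using f(4) by simp
  with wf show ?thesis by blast
qed

section \<open>Start-up, output and the compilation theorem\<close>

lemma rch_Ini:
  assumes "length ds < t"
  shows "rch (delta q p e) t (zip_conf Ini xs (map Some ds)) (zip_conf (App e) (xs @ map Some ds) [])" (is "rch ?D _ _ _")
  using assms
proof (induction ds arbitrary: xs t)
  case Nil
  have "astep ?D (zip_conf Ini xs []) = zip_conf (App e) xs []"
    using zip_step_stay[of "?D" Ini None _ _ xs "[]"] by (simp add: zip_conf_None)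
  from rch_step[OF this rch_refl[of _ 0]] show ?case using Nil by simp
next
  case (Cons d ds)
  have s: "astep ?D (zip_conf Ini xs (map Some (d # ds))) = zip_conf Ini (xs @ [Some d]) (map Some ds)"
    using zip_step_right[of "?D" Ini "Some d"] by simp
  from rch_step[OF s Cons.IH[of "Suc (length ds)"]] show ?case using Cons.prems by simp
qed

lemma rch_App:
  assumes "2 * j \<le> t"
  shows "rch (delta q p e) t (zip_conf (App j) (map Some xs) [])
     (zip_conf (App 0) (map Some (xs @ enc_tuple (replicate j []))) [])" (is "rch ?D _ _ _")
  using assms
proof (induction j arbitrary: xs t)
  case 0
  then show ?case by (simp add: rch_refl)
next
  case (Suc j)
  have 1: "astep ?D (zip_conf (App (Suc j)) (map Some xs) [])
      = zip_conf (App1 j) (map Some xs @ [Some True]) []"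
    by (subst zip_conf_None[symmetric], rule zip_step_right) simp
  have 2: "astep ?D (zip_conf (App1 j) (map Some xs @ [Some True]) [])
      = zip_conf (App j) (map Some (xs @ [True, False])) []"
    using zip_step_right[of "?D" "App1 j" None "App j" "Some False" "map Some xs @ [Some True]" "[]"]
    by (simp add: zip_conf_None)
  have 3: "rch ?D (2 * j) (zip_conf (App j) (map Some (xs @ [True, False])) [])
     (zip_conf (App 0) (map Some (xs @ enc_tuple (replicate (Suc j) []))) [])"
    using Suc.IH[OF le_refl, of "xs @ [True, False]"] by (simp add: enc_tuple_Cons)
  show ?case using Suc.prems by (intro rch_step[OF 1 rch_step[OF 2 3 lessI]]) auto
qed

definition init_store :: "bool list list \<Rightarrow> store" where
  "init_store ws = (\<lambda>i. if i < length ws then ws ! i else [])"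

lemma enc_store_init: "enc_store (length ws + e) (init_store ws) = enc_tuple (ws @ replicate e [])"
  unfolding enc_store_def init_store_def
  by (intro arg_cong[of _ _ enc_tuple] nth_equalityI) (auto simp: nth_append)

lemma rch_start:
  assumes "2 * length (enc_tuple ws) + 4 * e + 10 \<le> t"
  shows "rch (delta q p e) t (Ini, snd (tm_init (enc_tuple ws))) (rdy_conf (length ws + e) [p] (init_store ws))" (is "rch ?D _ _ _")
proof -
  let ?w = "enc_tuple ws" and ?v = "enc_tuple (ws @ replicate e [])"
  have v: "?v = ?w @ enc_tuple (replicate e [])" by (simp add: enc_tuple_append)
  have "length (enc_tuple (replicate e [])) = 2 * e" by (induction e) (auto simp: enc_tuple_Cons)
  then have lv: "length ?v = length ?w + 2 * e" unfolding v by simp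
  have 0: "(Ini, snd (tm_init ?w)) = zip_conf Ini [] (map Some ?w)"
    by (auto simp: tm_init_def zip_conf_def otp_def fun_eq_iff)
  have 1: "rch ?D (length ?w + 1) (zip_conf Ini [] (map Some ?w)) (zip_conf (App e) (map Some ?w) [])"
    using rch_Ini[of ?w "length ?w + 1" q p e "[]"] by simp
  have 2: "rch ?D (2 * e) (zip_conf (App e) (map Some ?w) []) (zip_conf (App 0) (map Some ?v) [])"
    unfolding v by (rule rch_App) simp
  have s: "astep ?D (zip_conf (App 0) (map Some ?v) []) = (Bck [p], otp (map Some (?v @ [])), int (length ?v) - 1)"
    using zip_step[of "?D" "App 0" None "Bck [p]" None "-1" "map Some ?v" "[]"] by (simp add: zip_conf_None otp_None)
  have 3: "rch ?D (length ?v + 3) (zip_conf (App 0) (map Some ?v) []) (rdy_conf (length ws + e) [p] (init_store ws))"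
    using rch_step[OF s rch_Bck_zip[OF le_refl, where xs="?v" and ys="[]"], of "length ?v + 3"] unfolding rdy_conf_def enc_store_init by simp
  show ?thesis unfolding 0 using assms lv by (intro rch_trans[OF rch_trans[OF 1 2 le_refl] 3]) auto
qed

lemma tm_output_otp: "tm_output (s, otp (map Some xs @ None # ys), h) = xs"
proof -
  let ?tp = "otp (map Some xs @ None # ys)"
  have "(LEAST n. ?tp (int n) = None) = length xs"
  proof (rule Least_equality)
    show "?tp (int (length xs)) = None" using otp_at[of "map Some xs" None ys] by simp
    fix n assume "?tp (int n) = None"
    then show "length xs \<le> n" by (rule contrapos_pp) (auto simp: otp_def nth_append)
  qed
  moreover have "map (\<lambda>i. the (?tp (int i))) [0..<length xs] = xs"
    by (rule nth_equalityI) (auto simp: otp_def nth_append)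
  ultimately show ?thesis by (simp add: tm_output_def)
qed

text \<open>The doubled first bit occupies cells 0 and 1. Blanking cell 1 leaves a one-letter
  output, since the output ends at the first blank.\<close>

lemma rch_fin_bit:
  assumes "S 0 = b # bs" "0 < k"
  shows "\<exists>tp h. rch (delta False p e) 2 (rdy_conf k [] S) (Halt, tp, h) \<and> (\<forall>s. tm_output (s, tp, h) = [b])"
proof -
  obtain ys where E: "enc_store k S = b # b # ys" using enc_store_split[OF assms(2), of S] assms(1) by simp
  have 1: "astep (delta False p e) (rdy_conf k [] S) = zip_conf Fin [Some b] (Some b # map Some ys)"
    using zip_step_right[of "delta False p e" "Rdy []" "Some b" Fin "Some b" "[]"] unfolding rdy_conf_def E by simp
  have 2: "astep (delta False p e) (zip_conf Fin [Some b] (Some b # map Some ys)) = zip_conf Halt (map Some [b]) (None # map Some ys)"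
    using zip_step_stay[of "delta False p e" Fin "Some b" Halt None "[Some b]"] by simp
  have 3: "rch (delta False p e) 2 (rdy_conf k [] S) (zip_conf Halt (map Some [b]) (None # map Some ys))"
    using rch_step[OF 1 rch_step[OF 2 rch_refl[of _ 0], of 1], of 2] by simp
  have "tm_output (s, otp (map Some [b] @ None # map Some ys), int (length (map Some [b]))) = [b]" for s
    by (rule tm_output_otp)
  with 3 show ?thesis unfolding zip_conf_def by blast
qed

text \<open>Registers 0 and 1 at the start of the tape already form the wanted encoding. The cell
  blanked behind them belongs to register 2, hence at least three registers.\<close>

lemma rch_fin_pair:
  assumes "3 \<le> k"
  shows "\<exists>tp h. rch (delta True p e) (length (enc_store k S) + 2) (rdy_conf k [] S) (Halt, tp, h)
     \<and> (\<forall>s. tm_output (s, tp, h) = enc_tuple [S 0, S 1])"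
proof -
  let ?x = "enc_tuple [S 0, S 1]"
  have "enc_store k S = enc_tuple (map S [0..<2]) @ enc_tuple (map S [2..<k])"
  proof -
    have "[0..<2 + (k - 2)] = [0..<2] @ [2..<2 + (k - 2)]" by (rule upt_add_eq_append) simp
    moreover have "2 + (k - 2) = k" using assms by simp
    ultimately have "[0..<k] = [0..<2] @ [2..<k]" by metis
    then show ?thesis by (simp only: enc_store_def enc_tuple_append map_append)
  qed
  moreover have "map S [0..<2] = [S 0, S 1]" by (simp add: upt_rec numeral_2_eq_2)
  moreover have "[2..<k] = 2 # [3..<k]" using assms upt_conv_Cons[of 2 k] by (simp add: numeral_3_eq_3 numeral_2_eq_2)
  moreover have "\<exists>y ys. enc_tuple (S 2 # map S [3..<k]) = y # ys" by (cases "S 2") (auto simp: enc_tuple_Cons)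
  ultimately obtain y ys where E: "enc_store k S = ?x @ y # ys" by auto
  have 1: "rch (delta True p e) (length ?x) (zip_conf (Skp 2 AFin) [] (map Some (enc_store k S)))
      (zip_conf (Skp 0 AFin) (map Some ?x) (map Some (y # ys)))"
    using rch_Skp[OF le_refl, of True p e "[S 0, S 1]" AFin "[]" "map Some (y # ys)"] unfolding E by (simp add: numeral_2_eq_2)
  have 2: "rch (delta True p e) (length ?x + 1) (rdy_conf k [] S) (zip_conf (Skp 0 AFin) (map Some ?x) (map Some (y # ys)))"
    unfolding rdy_conf_def by (rule rch_stay[OF _ 1]) auto
  have 3: "rch (delta True p e) 1 (zip_conf (Skp 0 AFin) (map Some ?x) (map Some (y # ys))) (zip_conf Halt (map Some ?x) (None # map Some ys))"
    by (rule rch_step[OF _ rch_refl[of _ 0]]) (auto intro!: zip_step_stay)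
  have 4: "rch (delta True p e) (length (enc_store k S) + 2) (rdy_conf k [] S) (zip_conf Halt (map Some ?x) (None # map Some ys))"
    by (rule rch_trans[OF 2 3]) (simp add: E)
  have "tm_output (s, otp (map Some ?x @ None # map Some ys), int (length (map Some ?x))) = ?x" for s
    by (rule tm_output_otp)
  with 4 show ?thesis unfolding zip_conf_def by blast
qed

text \<open>During a program run of time t on an input of size N the tape stays within O(N + t)
  cells, and each program step costs a sweep. So time c * N ^ d becomes O(N ^ (2 * d + 1)).\<close>

theorem compile_poly:
  assumes regs: "regs_below (k0 + e) p" "3 \<le> k0 + e"
    and len: "\<And>ws. ws \<in> W \<Longrightarrow> length ws = k0"
    and exc: "\<And>ws. ws \<in> W \<Longrightarrow> \<exists>S. exec p (init_store ws) (c * (length (enc_tuple ws) + 1) ^ d) S \<and>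
        (if q then f (enc_tuple ws) = enc_tuple [S 0, S 1] else \<exists>b bs. S 0 = b # bs \<and> f (enc_tuple ws) = [b])"
  shows "\<exists>M. poly_computes_on M (enc_tuple ` W) f"
proof -
  let ?C = "insert [] (conts p [])"
  let ?k = "k0 + e"
  have "\<exists>M. tm_wf M \<and> (\<forall>x t tp h. (astep (delta q p e) ^^ t) (Ini, snd (tm_init x)) = (Halt, tp, h)
     \<longrightarrow> tm_run M x t = (1, tp, h))"
  proof (rule tm_of_states[of "{s. ok_state ?C e ?k s}"])
    show "finite {s. ok_state ?C e ?k s}" by (rule finite_states) (simp add: finite_conts)
    show "fst (delta q p e s a) \<in> {s. ok_state ?C e ?k s} \<and> snd (snd (delta q p e s a)) \<in> {-1, 0, 1}"
      if "s \<in> {s. ok_state ?C e ?k s}" for s a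
      using states_closed[of ?C e ?k s p q a] that regs by simp
  qed auto
  then obtain M where M: "tm_wf M" "\<And>x t tp h. (astep (delta q p e) ^^ t) (Ini, snd (tm_init x)) = (Halt, tp, h)
     \<Longrightarrow> tm_run M x t = (1, tp, h)" by blast
  \<comment> \<open>\<open>A\<close> bounds the tape length in units of N ^ (d + 1), which dominates
    both N and N ^ d. The three summands of \<open>B\<close> pay for start-up, output and
    simulation.\<close>
  define A where "A = 1 + 2 * e + 2 * c"
  define B where "B = (12 + 4 * e) + (A + 5) + c * (4 * A + 20)"
  have main: "\<exists>t. t \<le> B * (length w + 1) ^ (2 * d + 1) \<and> tm_halted (tm_run M w t) \<and> tm_output (tm_run M w t) = f w"
    if "w \<in> enc_tuple ` W" for w
  proof -
    from that obtain ws where ws: "ws \<in> W" "w = enc_tuple ws" by auto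
    let ?N = "length w + 1"
    let ?t = "c * ?N ^ d"
    obtain S where S: "exec p (init_store ws) ?t S"
      "if q then f w = enc_tuple [S 0, S 1] else \<exists>b bs. S 0 = b # bs \<and> f w = [b]"
      using exc[OF ws(1)] ws(2) by auto
    let ?L = "length (enc_store ?k (init_store ws))"
    have "length (enc_tuple (replicate e [])) = 2 * e" by (induction e) (auto simp: enc_tuple_Cons)
    then have L: "?L = length w + 2 * e"
      using enc_store_init[of ws e] len[OF ws(1)] ws(2) by (simp add: enc_tuple_append)
    define MM where "MM = ?L + 2 * ?t"
    have 1: "rch (delta q p e) (2 * length w + 4 * e + 10) (Ini, snd (tm_init w)) (rdy_conf ?k [p] (init_store ws))"
      using rch_start[of ws e] len[OF ws(1)] ws(2) by simp
    have 2: "rch (delta q p e) (?t * (4 * MM + 20)) (rdy_conf ?k [p] (init_store ws)) (rdy_conf ?k [] S)"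
      by (rule exec_rch[OF S(1) regs(1)]) (simp add: MM_def)
    have lS: "length (enc_store ?k S) \<le> MM" using exec_length[OF S(1) regs(1)] by (simp add: MM_def)
    have "\<exists>tp h. rch (delta q p e) (MM + 2) (rdy_conf ?k [] S) (Halt, tp, h) \<and> (\<forall>s. tm_output (s, tp, h) = f w)"
    proof (cases q)
      case True
      obtain tp h where r: "rch (delta True p e) (length (enc_store ?k S) + 2) (rdy_conf ?k [] S) (Halt, tp, h)"
        and o: "\<forall>s. tm_output (s, tp, h) = enc_tuple [S 0, S 1]" using rch_fin_pair[OF regs(2), of p e S] by blast
      have "rch (delta True p e) (MM + 2) (rdy_conf ?k [] S) (Halt, tp, h)"
        by (rule rch_mono[OF r]) (use lS in simp)
      moreover have "f w = enc_tuple [S 0, S 1]" using S(2) True by simp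
      ultimately show ?thesis using o True by metis
    next
      case False
      then obtain b bs where b: "S 0 = b # bs" "f w = [b]" using S(2) by auto
      have "0 < ?k" using regs(2) by linarith
      with rch_fin_bit[of S b bs ?k p e] b(1) obtain tp h where
        r: "rch (delta False p e) 2 (rdy_conf ?k [] S) (Halt, tp, h)" and o: "\<forall>s. tm_output (s, tp, h) = [b]" by blast
      have "rch (delta False p e) (MM + 2) (rdy_conf ?k [] S) (Halt, tp, h)" by (rule rch_mono[OF r]) simp
      then show ?thesis using o b(2) False by metis
    qed
    then obtain tp h where 3: "rch (delta q p e) (MM + 2) (rdy_conf ?k [] S) (Halt, tp, h)" and o: "\<And>s. tm_output (s, tp, h) = f w"
      by blast
    from rch_trans[OF rch_trans[OF 1 2 le_refl] 3 le_refl] obtain t where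
      t: "t \<le> 2 * length w + 4 * e + 10 + ?t * (4 * MM + 20) + (MM + 2)"
        "(astep (delta q p e) ^^ t) (Ini, snd (tm_init w)) = (Halt, tp, h)"
      unfolding rch_def by blast
    have N1: "1 \<le> ?N ^ j" for j by simp
    have MMb: "MM \<le> A * ?N ^ (d + 1)"
    proof -
      have a: "?N ^ d \<le> ?N ^ (d + 1)" by (rule power_increasing) auto
      have b: "?N \<le> ?N ^ (d + 1)" using power_increasing[of 1 "d + 1" ?N] by simp
      have "MM \<le> ?N + 2 * e + 2 * (c * ?N ^ d)" unfolding MM_def L by simp
      also have "\<dots> \<le> ?N ^ (d + 1) + 2 * e * ?N ^ (d + 1) + 2 * c * ?N ^ (d + 1)"
        using a b N1[of "d + 1"] by (intro add_mono) (auto simp: mult.assoc)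
      finally show ?thesis by (simp add: A_def algebra_simps)
    qed
    let ?P = "?N ^ (2 * d + 1)"
    have e1: "2 * length w + 4 * e + 10 \<le> (12 + 4 * e) * ?P"
    proof -
      have "?N \<le> ?P" using power_increasing[of 1 "2 * d + 1" ?N] by simp
      moreover have "(10 + 4 * e) * 1 \<le> (10 + 4 * e) * ?P" using N1[of "2 * d + 1"] by (rule mult_le_mono2)
      ultimately show ?thesis unfolding add_mult_distrib by linarith
    qed
    have e2: "MM + 2 \<le> (A + 5) * ?P"
    proof -
      have "?N ^ (d + 1) \<le> ?P" by (rule power_increasing) auto
      then have "A * ?N ^ (d + 1) \<le> A * ?P" by simp
      then show ?thesis using MMb N1[of "2 * d + 1"] unfolding add_mult_distrib by linarith
    qed
    have e3: "?t * (4 * MM + 20) \<le> c * (4 * A + 20) * ?P"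
    proof -
      have "4 * MM + 20 \<le> (4 * A + 20) * ?N ^ (d + 1)"
        using MMb N1[of "d + 1"] unfolding add_mult_distrib by linarith
      then have "?t * (4 * MM + 20) \<le> ?t * ((4 * A + 20) * ?N ^ (d + 1))" by (rule mult_le_mono2)
      also have "\<dots> = c * (4 * A + 20) * (?N ^ d * ?N ^ (d + 1))" by (simp only: ac_simps)
      also have "?N ^ d * ?N ^ (d + 1) = ?P" by (simp only: power_add[symmetric] mult_2 add.assoc)
      finally show ?thesis .
    qed
    have "t \<le> B * ?P" using t(1) e1 e2 e3 unfolding B_def add_mult_distrib by linarith
    moreover have "tm_run M w t = (1, tp, h)" using M(2) t(2) by simp
    ultimately show ?thesis using o by (intro exI[of _ t]) (simp add: tm_halted_def)
  qed
  have "poly_computes_on M (enc_tuple ` W) f"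
    unfolding poly_computes_on_def using M(1) main by blast
  then show ?thesis ..
qed

text \<open>The input already is the output, so a machine that halts in its first step
  suffices.\<close>

lemma id_in_poly: "(\<lambda>n. n) \<in> poly"
proof -
  let ?M = "(2, \<lambda>s a. (1, a, 0)) :: tm"
  have "\<exists>t. t \<le> 1 * (length w + 1) ^ 0 \<and> tm_halted (tm_run ?M w t) \<and> tm_output (tm_run ?M w t) = replicate (length w) True"
    if "w \<in> range (\<lambda>n. replicate n True)" for w
  proof -
    have "tm_run ?M w 1 = (1, otp (map Some w @ [None]), 0)"
      by (auto simp: tm_run_def tm_step_def tm_init_def otp_def nth_append fun_eq_iff)
    then show ?thesis using that tm_output_otp[of 1 w "[]" 0]
      by (intro exI[of _ 1]) (auto simp: tm_halted_def)
  qed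
  moreover have "tm_wf ?M" by (simp add: tm_wf_def)
  ultimately have "poly_computes_on ?M (range (\<lambda>n. replicate n True)) (\<lambda>w. replicate (length w) True)"
    unfolding poly_computes_on_def by blast
  then show ?thesis unfolding poly_def by blast
qed

section \<open>Subroutines\<close>

definition hdb :: "bool list \<Rightarrow> bool" where
  "hdb xs = (xs \<noteq> [] \<and> hd xs)"

lemma hdb_simps [simp]: "hdb [] = False" "hdb (x # xs) = x"
  by (simp_all add: hdb_def)

text \<open>A parser for \<open>enc_tuple\<close>: any unequal pair counts as a separator.
  \<open>tok\<close> and \<open>rest\<close> are total, so that the program has a meaning on
  malformed random strings as well.\<close>

fun tok :: "bool list \<Rightarrow> bool list" where
  "tok (x # y # xs) = (if x = y then x # tok xs else [])"
| "tok _ = []"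

fun rest :: "bool list \<Rightarrow> bool list" where
  "rest (x # y # xs) = (if x = y then rest xs else xs)"
| "rest _ = []"

fun evens :: "'a list \<Rightarrow> 'a list" where
  "evens (x # y # xs) = x # evens xs"
| "evens xs = xs"

text \<open>\<open>halve L bs\<close> brings the element of L whose index has the binary digits bs (least significant first) to
  the front: each digit decides whether the elements at even or at odd positions survive.\<close>

fun halve :: "bool list \<Rightarrow> bool list \<Rightarrow> bool list" where
  "halve L [] = L"
| "halve L (b # bs) = halve (evens (if b then tl L else L)) bs"

definition lookup :: "bool list \<Rightarrow> bool list \<Rightarrow> bool" where
  "lookup L bs = hdb (halve L bs)"

fun cmp_low :: "bool list \<Rightarrow> bool list \<Rightarrow> bool list \<Rightarrow> bool list" where
  "cmp_low [] ys F = F"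
| "cmp_low (x # xs) ys F = cmp_low xs (tl ys) (if x = hdb ys then F else [hdb ys])"

fun cmp_high :: "bool list \<Rightarrow> bool list \<Rightarrow> bool list" where
  "cmp_high [] F = F"
| "cmp_high (y # ys) F = cmp_high ys (if y then [True] else F)"

text \<open>Least significant bit first; the result is \<open>[]\<close> if the two numbers agree, and
  the one-element list holding the truth value of \<open>xs < ys\<close> otherwise.\<close>

definition cmp :: "bool list \<Rightarrow> bool list \<Rightarrow> bool list" where
  "cmp xs ys = cmp_high (drop (length xs) ys) (cmp_low xs ys [])"

text \<open>Kind codes with the least significant bit first and missing bits read as 0: the third
  bit marks NOT, the second AND and OR, and the first tells OR from AND or is the value of a
  constant.\<close>

definition gv :: "bool list \<Rightarrow> bool \<Rightarrow> bool \<Rightarrow> bool" where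
  "gv c u v = (if hdb (tl (tl c)) then \<not> u else if hdb (tl c) then (if hdb c then u \<or> v else u \<and> v) else hdb c)"

definition gatestep :: "bool list \<times> bool list \<Rightarrow> bool list \<times> bool list" where
  "gatestep p = (case p of (w, xs) \<Rightarrow>
     (w @ [gv (tok xs) (lookup w (tok (rest xs))) (lookup w (tok (rest (rest xs))))], rest (rest (rest xs))))"

fun outv :: "bool list \<Rightarrow> nat \<Rightarrow> bool list \<Rightarrow> bool list" where
  "outv w 0 xs = []"
| "outv w (Suc n) xs = lookup w (tok xs) # outv w n (rest xs)"

section \<open>Size and time bounds of the subroutines\<close>

lemma length_tok_rest: "length (tok xs) \<le> length xs" "length (rest xs) \<le> length xs"
  by (induction xs rule: tok.induct) auto

lemma length_evens: "length (evens xs) \<le> length xs"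
  by (induction xs rule: evens.induct) auto

text \<open>A common time unit for all subroutines. Most are linear, but \<open>LOOKUP\<close>
  rescans the list for each bit of the index and is quadratic; the factor 100 is generous.\<close>

definition tau :: "nat \<Rightarrow> nat" where "tau n = 100 * (n + 1)\<^sup>2"

lemma tau_linear: "c \<le> 100 \<Longrightarrow> d \<le> 100 \<Longrightarrow> m \<le> n \<Longrightarrow> c * m + d \<le> tau n"
proof -
  assume "c \<le> 100" "d \<le> 100" "m \<le> n"
  then have "c * m + d \<le> 100 * n + 100" by (intro add_mono mult_mono) auto
  then show ?thesis by (simp add: tau_def power2_eq_square algebra_simps)
qed

text \<open>Popping from an empty register yields False, in agreement with \<open>hdb\<close> and
  \<open>tl\<close>.\<close>

definition getbit :: "nat \<Rightarrow> (bool \<Rightarrow> com) \<Rightarrow> com" where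
  "getbit r f = Case r (f False) f"

lemma exec_getbit:
  assumes "exec (f (hdb (R r))) (R(r := tl (R r))) t S" "t < u"
  shows "exec (getbit r f) R u S"
proof (cases "R r")
  case Nil
  then have "R(r := tl (R r)) = R" by auto
  then show ?thesis using assms Nil exec_Case_Nil[of R r "f False" t S u f] by (simp add: getbit_def)
next
  case (Cons b bs)
  then show ?thesis using assms exec_Case_Cons[of R r b bs f t S u "f False"] by (simp add: getbit_def)
qed

lemma regs_below_getbit [simp]: "regs_below k (getbit r f) = (r < k \<and> (\<forall>b. regs_below k (f b)))"
  by (auto simp: getbit_def)

lemma exec_mono: "exec c R t S \<Longrightarrow> t \<le> u \<Longrightarrow> exec c R u S"
  by (erule exec.cases) (auto intro: exec.intros)

text \<open>Registers 9, 10 and 11 are scratch space of the subroutines and empty between calls.\<close>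

definition MOVE :: "nat \<Rightarrow> nat \<Rightarrow> com" where "MOVE a b = Loop a (Push b)"

lemma exec_MOVE_aux:
  assumes "a \<noteq> b" "R a = xs" "S = R(a := [], b := rev xs @ R b)"
  shows "exec (MOVE a b) R (2 * length xs + 1) S"
  using assms(2,3)
proof (induction xs arbitrary: R)
  case Nil
  then have "S = R" using assms(1) by (auto simp: fun_eq_iff)
  then show ?case using Nil exec_Loop_Nil[of R a 1 "Push b"] by (simp add: MOVE_def)
next
  case (Cons x xs)
  let ?R = "R(a := xs, b := x # R b)"
  have 1: "exec (Push b x) (R(a := xs)) 1 ?R"
    using exec_Push[of 1 b x "R(a := xs)"] assms(1) by simp
  have 2: "exec (MOVE a b) ?R (2 * length xs + 1) S"
    by (rule Cons.IH) (use assms(1) Cons.prems in \<open>auto simp: fun_eq_iff\<close>)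
  show ?case using exec_Loop_Cons[OF Cons.prems(1) 1 2[unfolded MOVE_def]] by (simp add: MOVE_def)
qed

lemma exec_MOVE:
  assumes "a \<noteq> b" "length (R a) \<le> n"
  shows "exec (MOVE a b) R (tau n) (R(a := [], b := rev (R a) @ R b))"
  by (rule exec_mono[OF exec_MOVE_aux[OF assms(1) refl refl] tau_linear]) (use assms in auto)

definition CLEAR :: "nat \<Rightarrow> com" where "CLEAR a = Loop a (\<lambda>_. Skip)"

lemma exec_CLEAR_aux: "R a = xs \<Longrightarrow> S = R(a := []) \<Longrightarrow> exec (CLEAR a) R (2 * length xs + 1) S"
proof (induction xs arbitrary: R)
  case Nil
  then have "S = R" by (auto simp: fun_eq_iff)
  then show ?case using Nil exec_Loop_Nil[of R a 1] by (simp add: CLEAR_def)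
next
  case (Cons x xs)
  have 1: "exec Skip (R(a := xs)) 1 (R(a := xs))" by (simp add: exec_Skip)
  have 2: "exec (CLEAR a) (R(a := xs)) (2 * length xs + 1) S"
    by (rule Cons.IH) (use Cons.prems in \<open>auto simp: fun_eq_iff\<close>)
  show ?case using exec_Loop_Cons[where f = "\<lambda>_. Skip", OF Cons.prems(1) 1 2[unfolded CLEAR_def]] by (simp add: CLEAR_def)
qed

lemma exec_CLEAR:
  assumes "length (R a) \<le> n"
  shows "exec (CLEAR a) R (tau n) (R(a := []))"
  by (rule exec_mono[OF exec_CLEAR_aux[OF refl refl] tau_linear]) (use assms in auto)

text \<open>Moving reverses the order, so the detour through register 10 restores the source and
  builds the copy in the same order.\<close>

definition COPY :: "nat \<Rightarrow> nat \<Rightarrow> com" where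
  "COPY a b = Seq (MOVE a 10) (Loop 10 (\<lambda>x. Seq (Push a x) (Push b x)))"

lemma exec_COPY_aux:
  assumes "a \<noteq> b" "a \<noteq> 10" "b \<noteq> 10" "R 10 = xs" "S = R(10 := [], a := rev xs @ R a, b := rev xs @ R b)"
  shows "exec (Loop 10 (\<lambda>x. Seq (Push a x) (Push b x))) R (4 * length xs + 1) S"
  using assms(4,5)
proof (induction xs arbitrary: R)
  case Nil
  then have "S = R" using assms(1-3) by (auto simp: fun_eq_iff)
  then show ?case using Nil exec_Loop_Nil[of R 10 1] by simp
next
  case (Cons x xs)
  let ?R = "R(10 := xs, a := x # R a, b := x # R b)"
  have "exec (Push a x) (R(10 := xs)) 1 (R(10 := xs, a := x # R a))"
    using exec_Push[of 1 a x "R(10 := xs)"] assms(1-3) by simp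
  moreover have "exec (Push b x) (R(10 := xs, a := x # R a)) 1 ?R"
    using exec_Push[of 1 b x "R(10 := xs, a := x # R a)"] assms(1-3) by simp
  ultimately have 1: "exec (Seq (Push a x) (Push b x)) (R(10 := xs)) 3 ?R"
    by (rule exec_Seq) simp
  have 2: "exec (Loop 10 (\<lambda>x. Seq (Push a x) (Push b x))) ?R (4 * length xs + 1) S"
    by (rule Cons.IH) (use assms(1-3) Cons.prems in \<open>auto simp: fun_eq_iff\<close>)
  show ?case using exec_Loop_Cons[where f = "\<lambda>x. Seq (Push a x) (Push b x)", OF Cons.prems(1) 1 2] by simp
qed

lemma exec_COPY:
  assumes "a \<noteq> b" "a \<noteq> 10" "b \<noteq> 10" "R 10 = []" "length (R a) \<le> n"
  shows "exec (COPY a b) R (tau n) (R(b := R a @ R b))"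
proof -
  let ?R = "R(a := [], 10 := rev (R a))"
  have 1: "exec (MOVE a 10) R (2 * length (R a) + 1) ?R"
    using exec_MOVE_aux[of a 10 R "R a" ?R] assms by simp
  have 2: "exec (Loop 10 (\<lambda>x. Seq (Push a x) (Push b x))) ?R (4 * length (rev (R a)) + 1) (R(b := R a @ R b))"
    by (rule exec_COPY_aux) (use assms in \<open>auto simp: fun_eq_iff\<close>)
  have "exec (COPY a b) R (6 * length (R a) + 3) (R(b := R a @ R b))"
    unfolding COPY_def by (rule exec_Seq[OF 1 2]) simp
  then show ?thesis by (rule exec_mono) (rule tau_linear, use assms in auto)
qed

primrec SEQ :: "com list \<Rightarrow> com" where
  "SEQ [] = Skip"
| "SEQ (c # cs) = Seq c (SEQ cs)"

lemma exec_SEQ_Nil: "exec (SEQ []) R (length [] * (t + 2) + 1) R"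
  by (simp add: exec_Skip)

lemma regs_below_SEQ [simp]: "regs_below k (SEQ cs) = list_all (regs_below k) cs"
  by (induction cs) auto

text \<open>A \<open>Loop\<close> ends only when its register is empty, so register 11 serves as a
  flag: the body pushes \<open>True\<close> to ask for another round and leaves it empty to
  stop.\<close>

definition GETTOK :: "nat \<Rightarrow> nat \<Rightarrow> com" where
  "GETTOK a b = Seq (Push 11 True) (Seq (Loop 11 (\<lambda>_. Case a Skip (\<lambda>x. Case a Skip
     (\<lambda>y. if x = y then Seq (Push 10 x) (Push 11 True) else Skip)))) (MOVE 10 b))"

lemma exec_GETTOK_aux:
  assumes "a \<noteq> 10" "a \<noteq> 11" "R a = xs" "R 11 = [True]" "S = R(11 := [], a := rest xs, 10 := rev (tok xs) @ R 10)"
  shows "exec (Loop 11 (\<lambda>_. Case a Skip (\<lambda>x. Case a Skip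
     (\<lambda>y. if x = y then Seq (Push 10 x) (Push 11 True) else Skip)))) R (10 * length xs + 10) S"
     (is "exec (Loop 11 ?f) R _ _")
  using assms(3-5)
proof (induction xs arbitrary: R rule: tok.induct)
  case (1 x y xs)
  let ?g = "\<lambda>y. if x = y then Seq (Push 10 x) (Push 11 True) else Skip"
  let ?T = "R(11 := [], a := xs)"
  have c: "exec (?f True) (R(11 := [])) 5 U" if "exec (?g y) ?T 3 U" for U
  proof -
    have "exec (Case a Skip ?g) (R(11 := [], a := y # xs)) 4 U"
      by (rule exec_Case_Cons[of _ _ y xs _ 3]) (use that in simp_all)
    then show ?thesis
      using exec_Case_Cons[where f = "\<lambda>x. Case a Skip (\<lambda>y. if x = y then Seq (Push 10 x) (Push 11 True) else Skip)" and b = x and R = "R(11 := [])"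
        and r = a and bs = "y # xs" and t = 5 and ?t1.0 = 4 and S = U and c = Skip] 1(2) assms(2) by simp
  qed
  show ?case
  proof (cases "x = y")
    case True
    let ?U = "R(a := xs, 10 := x # R 10)"
    have "exec (Push 10 x) ?T 1 (?T(10 := x # ?T 10))" by (rule exec_Push) simp
    moreover have "exec (Push 11 True) (?T(10 := x # ?T 10)) 1 ?U"
    proof -
      have eq: "(?T(10 := x # ?T 10))(11 := True # (?T(10 := x # ?T 10)) 11) = ?U"
        using 1(3) assms(1,2) by (auto simp: fun_eq_iff)
      show ?thesis using exec_Push[of 1 11 True "?T(10 := x # ?T 10)"] unfolding eq by simp
    qed
    ultimately have "exec (Seq (Push 10 x) (Push 11 True)) ?T 3 ?U" by (rule exec_Seq) simp
    then have b1: "exec (?f True) (R(11 := [])) 5 ?U" using True by (intro c) simp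
    have b2: "exec (Loop 11 ?f) ?U (10 * length xs + 10) S"
      by (rule 1(1)[OF True]) (use 1(3,4) True assms(1,2) in \<open>auto simp: fun_eq_iff\<close>)
    show ?thesis by (rule exec_Loop_Cons[where f = ?f, OF 1(3) b1 b2]) simp
  next
    case False
    have b1: "exec (?f True) (R(11 := [])) 5 ?T" using False by (intro c) (simp add: exec_Skip)
    have b2: "exec (Loop 11 ?f) ?T 1 ?T" using assms(1,2) by (intro exec_Loop_Nil) auto
    have S: "S = ?T" using False 1(4) assms(1,2) by (auto simp: fun_eq_iff)
    show ?thesis unfolding S by (rule exec_Loop_Cons[where f = ?f, OF 1(3) b1 b2]) simp
  qed
next
  case "2_1"
  let ?T = "R(11 := [])"
  have b1: "exec (?f True) ?T 5 ?T" using "2_1" assms(1,2) by (intro exec_Case_Nil[of _ _ _ 1] exec_Skip) auto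
  have b2: "exec (Loop 11 ?f) ?T 1 ?T" by (intro exec_Loop_Nil) auto
  have S: "S = ?T" using assms(1,2) "2_1" by (auto simp: fun_eq_iff)
  show ?case unfolding S by (rule exec_Loop_Cons[where f = ?f, OF "2_1"(2) b1 b2]) simp
next
  case ("2_2" x)
  let ?T = "R(11 := [], a := [])"
  have "exec (Case a Skip (\<lambda>y. if x = y then Seq (Push 10 x) (Push 11 True) else Skip)) ?T 4 ?T"
    by (intro exec_Case_Nil[of _ _ _ 1] exec_Skip) auto
  then have b1: "exec (?f True) (R(11 := [])) 5 ?T"
    using exec_Case_Cons[where f = "\<lambda>x. Case a Skip (\<lambda>y. if x = y then Seq (Push 10 x) (Push 11 True) else Skip)" and b = x and R = "R(11 := [])"
      and r = a and bs = "[]" and t = 5 and ?t1.0 = 4 and S = ?T and c = Skip] "2_2"(1) assms(2) by simp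
  have b2: "exec (Loop 11 ?f) ?T 1 ?T" using assms(1,2) by (intro exec_Loop_Nil) auto
  have S: "S = ?T" using assms(1,2) "2_2" by (auto simp: fun_eq_iff)
  show ?case unfolding S by (rule exec_Loop_Cons[where f = ?f, OF "2_2"(2) b1 b2]) simp
qed

lemma exec_GETTOK:
  assumes "a \<notin> {10, 11}" "b \<notin> {10, 11}" "a \<noteq> b" "R 10 = []" "R 11 = []" "length (R a) \<le> n"
  shows "exec (GETTOK a b) R (tau n) (R(a := rest (R a), b := tok (R a) @ R b))"
proof -
  let ?l = "length (R a)"
  have 1: "exec (Push 11 True) R 1 (R(11 := [True]))" using exec_Push[of 1 11 True R] assms by simp
  let ?S = "R(11 := [], a := rest (R a), 10 := rev (tok (R a)))"
  have 2: "exec (Loop 11 (\<lambda>_. Case a Skip (\<lambda>x. Case a Skip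
     (\<lambda>y. if x = y then Seq (Push 10 x) (Push 11 True) else Skip)))) (R(11 := [True])) (10 * ?l + 10) ?S"
    by (rule exec_GETTOK_aux) (use assms in \<open>auto simp: fun_eq_iff\<close>)
  have "exec (MOVE 10 b) ?S (2 * length (rev (tok (R a))) + 1) (R(a := rest (R a), b := tok (R a) @ R b))"
    by (rule exec_MOVE_aux) (use assms in \<open>auto simp: fun_eq_iff\<close>)
  then have 3: "exec (MOVE 10 b) ?S (2 * ?l + 1) (R(a := rest (R a), b := tok (R a) @ R b))"
    by (rule exec_mono) (use length_tok_rest[of "R a"] in simp)
  have "exec (GETTOK a b) R (12 * ?l + 14) (R(a := rest (R a), b := tok (R a) @ R b))"
    unfolding GETTOK_def by (rule exec_Seq[OF 1 exec_Seq[OF 2 3 lessI]]) simp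
  then show ?thesis by (rule exec_mono) (rule tau_linear, use assms in auto)
qed

text \<open>Register 11 holds the parity of the number of elements read, empty meaning that the next
  one is kept.\<close>

definition EVENS :: com where
  "EVENS = Seq (Loop 9 (\<lambda>x. Case 11 (Seq (Push 10 x) (Push 11 True)) (\<lambda>_. Skip)))
     (Seq (CLEAR 11) (MOVE 10 9))"

lemma exec_EVENS_aux:
  assumes "R 9 = xs" "R 11 = []"
    "S = R(9 := [], 11 := (if even (length xs) then [] else [True]), 10 := rev (evens xs) @ R 10)"
  shows "exec (Loop 9 (\<lambda>x. Case 11 (Seq (Push 10 x) (Push 11 True)) (\<lambda>_. Skip))) R (6 * length xs + 1) S"
    (is "exec (Loop 9 ?f) R _ _")
  using assms
proof (induction xs arbitrary: R rule: evens.induct)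
  case (1 x y xs)
  let ?S = "R(9 := y # xs, 10 := x # R 10, 11 := [True])" let ?T = "R(9 := xs, 10 := x # R 10)"
  have "exec (Push 10 x) (R(9 := y # xs)) 1 (R(9 := y # xs, 10 := x # R 10))"
    using exec_Push[of 1 10 x "R(9 := y # xs)"] by simp
  moreover have "exec (Push 11 True) (R(9 := y # xs, 10 := x # R 10)) 1 ?S"
    using exec_Push[of 1 11 True "R(9 := y # xs, 10 := x # R 10)"] 1(3) by simp
  ultimately have "exec (Seq (Push 10 x) (Push 11 True)) (R(9 := y # xs)) 3 ?S" by (rule exec_Seq) simp
  then have b1: "exec (?f x) (R(9 := y # xs)) 4 ?S" using 1(3) by (intro exec_Case_Nil) auto
  have b2: "exec (?f y) (?S(9 := xs)) 2 ?T"
  proof (rule exec_Case_Cons[of _ _ True "[]" _ 1])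
    have "(?S(9 := xs))(11 := []) = ?T" using 1(3) by (auto simp: fun_eq_iff)
    then show "exec Skip ((?S(9 := xs))(11 := [])) 1 ?T" by (simp add: exec_Skip)
  qed auto
  have b3: "exec (Loop 9 ?f) ?T (6 * length xs + 1) S"
    by (rule 1(1)) (use 1(3,4) in \<open>auto simp: fun_eq_iff\<close>)
  have "exec (Loop 9 ?f) ?S (6 * length xs + 4) S"
    by (rule exec_Loop_Cons[where f = ?f, OF _ b2 b3]) auto
  then show ?case by (rule exec_Loop_Cons[where f = ?f, OF 1(2) b1]) auto
next
  case "2_1"
  then have "S = R" by (auto simp: fun_eq_iff)
  then show ?case using "2_1" exec_Loop_Nil[of R 9 1 ?f] by auto
next
  case ("2_2" x)
  let ?S = "R(9 := [], 10 := x # R 10, 11 := [True])"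
  have "exec (Push 10 x) (R(9 := [])) 1 (R(9 := [], 10 := x # R 10))"
    using exec_Push[of 1 10 x "R(9 := [])"] by simp
  moreover have "exec (Push 11 True) (R(9 := [], 10 := x # R 10)) 1 ?S"
    using exec_Push[of 1 11 True "R(9 := [], 10 := x # R 10)"] "2_2" by simp
  ultimately have "exec (Seq (Push 10 x) (Push 11 True)) (R(9 := [])) 3 ?S" by (rule exec_Seq) simp
  then have b1: "exec (?f x) (R(9 := [])) 4 ?S" using "2_2" by (intro exec_Case_Nil) auto
  have b2: "exec (Loop 9 ?f) ?S 1 ?S" by (intro exec_Loop_Nil) auto
  have "exec (Loop 9 ?f) R 7 ?S"
    by (rule exec_Loop_Cons[where f = ?f, OF "2_2"(1) b1 b2]) auto
  moreover have "S = ?S" using "2_2"(3) by (auto simp: fun_eq_iff)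
  ultimately have "exec (Loop 9 ?f) R 7 S" by (simp only:)
  then show ?case by simp
qed

lemma exec_EVENS:
  assumes "R 10 = []" "R 11 = []"
  shows "exec EVENS R (8 * length (R 9) + 10) (R(9 := evens (R 9)))"
proof -
  let ?l = "length (R 9)"
  let ?F = "if even ?l then [] else [True]"
  let ?S = "R(9 := [], 11 := ?F, 10 := rev (evens (R 9)))"
  have 1: "exec (Loop 9 (\<lambda>x. Case 11 (Seq (Push 10 x) (Push 11 True)) (\<lambda>_. Skip))) R (6 * ?l + 1) ?S"
    by (rule exec_EVENS_aux) (use assms in \<open>auto simp: fun_eq_iff\<close>)
  have "exec (CLEAR 11) ?S (2 * length ?F + 1) (?S(11 := []))"
    by (rule exec_CLEAR_aux) auto
  then have 2: "exec (CLEAR 11) ?S 3 (?S(11 := []))" by (rule exec_mono) simp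
  have "exec (MOVE 10 9) (?S(11 := [])) (2 * length (rev (evens (R 9))) + 1) (R(9 := evens (R 9)))"
    by (rule exec_MOVE_aux) (use assms in \<open>auto simp: fun_eq_iff\<close>)
  then have 3: "exec (MOVE 10 9) (?S(11 := [])) (2 * ?l + 1) (R(9 := evens (R 9)))"
    by (rule exec_mono) (use length_evens[of "R 9"] in simp)
  show ?thesis unfolding EVENS_def
    by (rule exec_Seq[OF 1 exec_Seq[OF 2 3 lessI]]) simp
qed

definition LOOKUP :: "nat \<Rightarrow> nat \<Rightarrow> nat \<Rightarrow> com" where
  "LOOKUP w a v = Seq (COPY w 9) (Seq (Loop a (\<lambda>b. if b then getbit 9 (\<lambda>_. EVENS) else EVENS))
     (getbit 9 (\<lambda>x. Seq (CLEAR 9) (Push v x))))"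

lemma exec_LOOKUP_aux:
  assumes "a \<notin> {9, 10, 11}" "R 10 = []" "R 11 = []" "length (R 9) \<le> n" "R a = bs"
    "S = R(a := [], 9 := halve (R 9) bs)"
  shows "exec (Loop a (\<lambda>b. if b then getbit 9 (\<lambda>_. EVENS) else EVENS)) R (length bs * (8 * n + 12) + 1) S"
    (is "exec (Loop a ?f) _ _ _")
  using assms(2-6)
proof (induction bs arbitrary: R)
  case Nil
  then have "S = R" by (auto simp: fun_eq_iff)
  then show ?case using Nil exec_Loop_Nil[of R a 1 ?f] by simp
next
  case (Cons b bs)
  let ?M = "if b then tl (R 9) else R 9"
  have lM: "length ?M \<le> n" using Cons.prems(3) by auto
  let ?T = "R(a := bs, 9 := evens ?M)"
  have "exec EVENS (R(a := bs, 9 := ?M)) (8 * length ?M + 10) ?T"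
    using exec_EVENS[of "R(a := bs, 9 := ?M)"] Cons.prems assms(1) by simp
  then have E: "exec EVENS (R(a := bs, 9 := ?M)) (8 * n + 10) ?T"
    by (rule exec_mono) (use lM in simp)
  have b1: "exec (?f b) (R(a := bs)) (8 * n + 11) ?T"
  proof (cases b)
    case True
    then have "exec (getbit 9 (\<lambda>_. EVENS)) (R(a := bs)) (8 * n + 11) ?T"
      using E assms(1) by (intro exec_getbit[where t = "8 * n + 10"]) auto
    then show ?thesis using True by simp
  next
    case False
    have "R(a := bs, 9 := R 9) = R(a := bs)" using assms(1) by auto
    then show ?thesis using E False exec_mono[of EVENS "R(a := bs)" "8 * n + 10" _ "8 * n + 11"] by simp
  qed
  have b2: "exec (Loop a ?f) ?T (length bs * (8 * n + 12) + 1) S"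
    by (rule Cons.IH)
      (use Cons.prems assms(1) lM length_evens[of ?M] in \<open>auto simp: fun_eq_iff simp del: if_split\<close>)
  show ?case
    by (rule exec_Loop_Cons[where f = ?f, OF Cons.prems(4) b1 b2]) simp
qed

lemma length_halve: "length (halve L bs) \<le> length L"
proof (induction bs arbitrary: L)
  case (Cons b bs)
  have "length (evens (if b then tl L else L)) \<le> length L"
    using length_evens[of "if b then tl L else L"] by (auto split: if_splits)
  then show ?case using Cons[of "evens (if b then tl L else L)"] by simp
qed simp

lemma exec_LOOKUP:
  assumes "w \<notin> {9, 10, 11}" "a \<notin> {9, 10, 11}" "v \<notin> {9, 10, 11}" "a \<noteq> w" "a \<noteq> v"
    "R 9 = []" "R 10 = []" "R 11 = []" "length (R w) \<le> n" "length (R a) \<le> n"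
  shows "exec (LOOKUP w a v) R (10 * tau n) (R(a := [], v := lookup (R w) (R a) # R v))"
proof -
  have 1: "exec (COPY w 9) R (tau n) (R(9 := R w))"
    using exec_COPY[of w 9 R n] assms by simp
  let ?L = "halve (R w) (R a)"
  let ?S = "R(a := [], 9 := ?L)"
  let ?b = "lookup (R w) (R a)"
  have le: "length (R a) * (8 * n + 12) + 1 \<le> tau n"
  proof -
    have "length (R a) * (8 * n + 12) \<le> n * (8 * n + 12)" using assms by (intro mult_right_mono) auto
    then show ?thesis by (simp add: tau_def power2_eq_square algebra_simps)
  qed
  have "exec (Loop a (\<lambda>b. if b then getbit 9 (\<lambda>_. EVENS) else EVENS)) (R(9 := R w)) (length (R a) * (8 * n + 12) + 1) ?S"
    by (rule exec_LOOKUP_aux) (use assms in \<open>auto simp: fun_eq_iff\<close>)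
  then have 2: "exec (Loop a (\<lambda>b. if b then getbit 9 (\<lambda>_. EVENS) else EVENS)) (R(9 := R w)) (tau n) ?S"
    using le by (rule exec_mono)
  have "exec (CLEAR 9) (?S(9 := tl ?L)) (tau n) (R(a := []))"
  proof -
    have "(?S(9 := tl ?L))(9 := []) = R(a := [])" using assms by (auto simp: fun_eq_iff)
    moreover have "length ((?S(9 := tl ?L)) 9) \<le> n" using length_halve[of "R w" "R a"] assms by simp
    ultimately show ?thesis using exec_CLEAR[of "?S(9 := tl ?L)" 9 n] by (simp only:)
  qed
  moreover have "exec (Push v ?b) (R(a := [])) 1 (R(a := [], v := ?b # R v))"
    using exec_Push[of 1 v ?b "R(a := [])"] assms by simp
  ultimately have "exec (Seq (CLEAR 9) (Push v ?b)) (?S(9 := tl ?L)) (tau n + 2) (R(a := [], v := ?b # R v))"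
    by (rule exec_Seq) simp
  then have 3: "exec (getbit 9 (\<lambda>x. Seq (CLEAR 9) (Push v x))) ?S (tau n + 3) (R(a := [], v := ?b # R v))"
    by (intro exec_getbit[where t = "tau n + 2"]) (simp_all add: lookup_def)
  have t: "100 \<le> tau n" by (simp add: tau_def)
  show ?thesis unfolding LOOKUP_def
    by (rule exec_Seq[OF 1 exec_Seq[OF 2 3 lessI]]) (use t in simp)
qed

definition CMP :: "nat \<Rightarrow> nat \<Rightarrow> com" where
  "CMP a b = Seq (Loop a (\<lambda>x. getbit b (\<lambda>y. if x = y then Skip else getbit 11 (\<lambda>_. Push 11 y))))
     (Loop b (\<lambda>y. if y then getbit 11 (\<lambda>_. Push 11 True) else Skip))"

lemma exec_set_flag:
  assumes "length (R 11) \<le> 1"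
  shows "exec (getbit 11 (\<lambda>_. Push 11 y)) R 2 (R(11 := [y]))"
proof (rule exec_getbit)
  have "tl (R 11) = []" using assms by (cases "R 11") auto
  then show "exec (Push 11 y) (R(11 := tl (R 11))) 1 (R(11 := [y]))"
    using exec_Push[of 1 11 y "R(11 := [])"] by simp
qed simp

lemma exec_CMP_high:
  assumes "b \<noteq> 11" "R b = ys" "length (R 11) \<le> 1" "S = R(b := [], 11 := cmp_high ys (R 11))"
  shows "exec (Loop b (\<lambda>y. if y then getbit 11 (\<lambda>_. Push 11 True) else Skip)) R (3 * length ys + 1) S"
    (is "exec (Loop b ?f) _ _ _")
  using assms(2-4)
proof (induction ys arbitrary: R)
  case Nil
  then have "S = R" by (auto simp: fun_eq_iff)
  then show ?case using Nil exec_Loop_Nil[of R b 1 ?f] by simp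
next
  case (Cons y ys)
  let ?S = "R(b := ys, 11 := if y then [True] else R 11)"
  have 1: "exec (?f y) (R(b := ys)) 2 ?S"
  proof (cases y)
    case True
    then show ?thesis using exec_set_flag[of "R(b := ys)" True] Cons.prems assms(1) by simp
  next
    case False
    have "R(b := ys, 11 := R 11) = R(b := ys)" using assms(1) by auto
    then show ?thesis using False exec_Skip[of 2 "R(b := ys)"] by simp
  qed
  have 2: "exec (Loop b ?f) ?S (3 * length ys + 1) S"
    by (rule Cons.IH) (use assms(1) Cons.prems in \<open>auto simp: fun_eq_iff\<close>)
  show ?case by (rule exec_Loop_Cons[where f = ?f, OF Cons.prems(1) 1 2]) simp
qed

lemma exec_CMP_low:
  assumes "a \<noteq> 11" "b \<noteq> 11" "a \<noteq> b" "R a = xs" "length (R 11) \<le> 1"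
    "S = R(a := [], b := drop (length xs) (R b), 11 := cmp_low xs (R b) (R 11))"
  shows "exec (Loop a (\<lambda>x. getbit b (\<lambda>y. if x = y then Skip else getbit 11 (\<lambda>_. Push 11 y)))) R (5 * length xs + 1) S"
    (is "exec (Loop a ?f) _ _ _")
  using assms(4-6)
proof (induction xs arbitrary: R)
  case Nil
  then have "S = R" by (auto simp: fun_eq_iff)
  then show ?case using Nil exec_Loop_Nil[of R a 1 ?f] by simp
next
  case (Cons x xs)
  let ?y = "hdb (R b)"
  let ?T = "R(a := xs, b := tl (R b))"
  let ?S = "?T(11 := if x = ?y then R 11 else [?y])"
  have "exec (if x = ?y then Skip else getbit 11 (\<lambda>_. Push 11 ?y)) ?T 2 ?S"
  proof (cases "x = ?y")
    case True
    have "?T(11 := R 11) = ?T" using assms(1,2) by auto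
    then show ?thesis using True exec_Skip[of 2 ?T] by simp
  next
    case False
    then show ?thesis using exec_set_flag[of ?T ?y] Cons.prems assms(1-3) by simp
  qed
  moreover have "(R(a := xs)) b = R b" using assms(3) by simp
  ultimately have 1: "exec (?f x) (R(a := xs)) 3 ?S"
    by (intro exec_getbit[where t = 2]) (simp_all only: numeral_less_iff semiring_norm)
  have 2: "exec (Loop a ?f) ?S (5 * length xs + 1) S"
    by (rule Cons.IH) (use assms(1-3) Cons.prems in \<open>auto simp: fun_eq_iff drop_Suc\<close>)
  show ?case by (rule exec_Loop_Cons[where f = ?f, OF Cons.prems(1) 1 2]) simp
qed

lemma exec_CMP:
  assumes "a \<notin> {10, 11}" "b \<notin> {10, 11}" "a \<noteq> b" "R 11 = []" "length (R a) \<le> n" "length (R b) \<le> n"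
  shows "exec (CMP a b) R (tau n) (R(a := [], b := [], 11 := cmp (R a) (R b)))"
proof -
  let ?xs = "R a" and ?ys = "R b"
  have F: "length (cmp_low xs ys F) \<le> 1" if "length F \<le> 1" for xs ys F
    using that by (induction xs ys F rule: cmp_low.induct) auto
  let ?S = "R(a := [], b := drop (length ?xs) ?ys, 11 := cmp_low ?xs ?ys [])"
  have 1: "exec (Loop a (\<lambda>x. getbit b (\<lambda>y. if x = y then Skip else getbit 11 (\<lambda>_. Push 11 y)))) R (5 * length ?xs + 1) ?S"
    by (rule exec_CMP_low) (use assms in auto)
  have 2: "exec (Loop b (\<lambda>y. if y then getbit 11 (\<lambda>_. Push 11 True) else Skip)) ?S
     (3 * length (drop (length ?xs) ?ys) + 1) (R(a := [], b := [], 11 := cmp ?xs ?ys))"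
    by (rule exec_CMP_high) (use assms F in \<open>auto simp: fun_eq_iff cmp_def\<close>)
  have "exec (CMP a b) R (8 * n + 3) (R(a := [], b := [], 11 := cmp ?xs ?ys))"
    unfolding CMP_def by (rule exec_Seq[OF 1 2]) (use assms in auto)
  then show ?thesis by (rule exec_mono) (rule tau_linear, auto)
qed

section \<open>The verifier\<close>

text \<open>Registers: 0 input, 1 random string, 2 and 3 the answers, 4 and 5 the questions, 6 a string whose length
  should be the number of gates of D, 7 the wire values of D, 13 and 14 the numbers N and k, 16 to 18 the outputs
  of D, 22 the outcomes of the tests; 8, 19 to 21 and 23 are temporary.\<close>

lemma exec_step:
  assumes "exec c R t S" "t \<le> u" "exec (SEQ cs) S (length cs * (u + 2) + 1) T"
  shows "exec (SEQ (c # cs)) R (length (c # cs) * (u + 2) + 1) T"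
  using exec_Seq[OF exec_mono[OF assms(1,2)] assms(3)] by simp

lemma tau_ge: "100 \<le> tau n"
  by (simp add: tau_def)

text \<open>Stacks grow at the front, whereas a new wire value belongs at the end. The list is
  therefore reversed into register 10, extended there and reversed back.\<close>

definition GATESTEP :: com where
  "GATESTEP = SEQ [GETTOK 0 16, GETTOK 0 8, LOOKUP 7 8 19, GETTOK 0 8, LOOKUP 7 8 20, MOVE 7 10,
     getbit 16 (\<lambda>b0. getbit 16 (\<lambda>b1. getbit 16 (\<lambda>b2. getbit 19 (\<lambda>u. getbit 20
       (\<lambda>v. Push 10 (gv [b0, b1, b2] u v)))))), CLEAR 16, MOVE 10 7]"

lemma gv_bits: "gv [hdb c, hdb (tl c), hdb (tl (tl c))] u v = gv c u v"
  by (simp add: gv_def)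

lemma exec_GATESTEP:
  assumes R: "R 8 = []" "R 9 = []" "R 10 = []" "R 11 = []" "R 16 = []" "R 19 = []" "R 20 = []"
    and n: "length (R 0) \<le> n" "length (R 7) \<le> n"
  shows "exec GATESTEP R (100 * tau n) (R(7 := fst (gatestep (R 7, R 0)), 0 := snd (gatestep (R 7, R 0))))"
proof -
  define w where "w = R 7"
  define c where "c = tok (R 0)"
  define x1 where "x1 = rest (R 0)"
  define a where "a = tok x1"
  define x2 where "x2 = rest x1"
  define b where "b = tok x2"
  define x3 where "x3 = rest x2"
  define u where "u = lookup w a"
  define v where "v = lookup w b"
  define g where "g = gv c u v"
  have len: "length w \<le> n" "length x1 \<le> n" "length a \<le> n" "length x2 \<le> n" "length b \<le> n" "length c \<le> n"
    unfolding w_def c_def x1_def a_def x2_def b_def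
    using n length_tok_rest by (meson le_trans)+
  define R1 where "R1 = R(0 := x1, 16 := c)"
  define R2 where "R2 = R1(0 := x2, 8 := a)"
  define R3 where "R3 = R2(8 := [], 19 := [u])"
  define R4 where "R4 = R3(0 := x3, 8 := b)"
  define R5 where "R5 = R4(8 := [], 20 := [v])"
  define R6 where "R6 = R5(7 := [], 10 := rev w)"
  define R7 where "R7 = R6(16 := tl (tl (tl c)), 19 := [], 20 := [], 10 := g # rev w)"
  define R8 where "R8 = R7(16 := [])"
  define R9 where "R9 = R8(10 := [], 7 := w @ [g])"
  note defs = R1_def R2_def R3_def R4_def R5_def R6_def R7_def R8_def
  have 1: "exec (GETTOK 0 16) R (tau n) R1"
    using exec_GETTOK[of 0 16 R n] R n unfolding R1_def c_def x1_def by simp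
  have 2: "exec (GETTOK 0 8) R1 (tau n) R2"
    using exec_GETTOK[of 0 8 R1 n] R len unfolding R2_def a_def x2_def by (simp add: defs)
  have 3: "exec (LOOKUP 7 8 19) R2 (10 * tau n) R3"
    using exec_LOOKUP[of 7 8 19 R2 n] R len unfolding R3_def u_def by (simp add: defs w_def)
  have 4: "exec (GETTOK 0 8) R3 (tau n) R4"
    using exec_GETTOK[of 0 8 R3 n] R len unfolding R4_def b_def x3_def by (simp add: defs)
  have 5: "exec (LOOKUP 7 8 20) R4 (10 * tau n) R5"
    using exec_LOOKUP[of 7 8 20 R4 n] R len unfolding R5_def v_def by (simp add: defs w_def)
  have 6: "exec (MOVE 7 10) R5 (tau n) R6"
    using exec_MOVE[of 7 10 R5 n] R len unfolding R6_def by (simp add: defs w_def)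
  have val: "R6 16 = c" "R6 19 = [u]" "R6 20 = [v]" "R6 10 = rev w" by (simp_all add: defs)
  have 7: "exec (getbit 16 (\<lambda>b0. getbit 16 (\<lambda>b1. getbit 16 (\<lambda>b2. getbit 19 (\<lambda>u. getbit 20
       (\<lambda>v. Push 10 (gv [b0, b1, b2] u v))))))) R6 (tau n) R7"
  proof -
    have p: "exec (Push 10 g) (R6(16 := tl (tl (tl c)), 19 := [], 20 := [])) 1 R7"
      using exec_Push[of 1 10 g "R6(16 := tl (tl (tl c)), 19 := [], 20 := [])"] val unfolding R7_def by simp
    have "exec (getbit 16 (\<lambda>b0. getbit 16 (\<lambda>b1. getbit 16 (\<lambda>b2. getbit 19 (\<lambda>u. getbit 20
       (\<lambda>v. Push 10 (gv [b0, b1, b2] u v))))))) R6 6 R7"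
      by (rule exec_getbit[where t = 5], rule exec_getbit[where t = 4], rule exec_getbit[where t = 3],
      rule exec_getbit[where t = 2], rule exec_getbit[where t = 1])
        (use p in \<open>simp_all add: val gv_bits flip: g_def\<close>)
    then show ?thesis by (rule exec_mono) (use tau_ge[of n] in simp)
  qed
  have 8: "exec (CLEAR 16) R7 (tau n) R8"
    using exec_CLEAR[of R7 16 n] len unfolding R8_def by (simp add: R7_def)
  have "exec (MOVE 10 7) R8 (2 * length (g # rev w) + 1) R9"
    by (rule exec_MOVE_aux) (auto simp: R9_def defs)
  then have 9: "exec (MOVE 10 7) R8 (tau n) R9"
    by (rule exec_mono) (use tau_linear[of 2 3 "length w" n] len in simp)
  have eq: "R9 = R(7 := fst (gatestep (R 7, R 0)), 0 := snd (gatestep (R 7, R 0)))"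
    using R by (auto simp: R9_def defs fun_eq_iff gatestep_def w_def c_def x1_def a_def x2_def b_def x3_def u_def v_def g_def)
  show ?thesis unfolding GATESTEP_def eq[symmetric]
    by (rule exec_mono[OF exec_step[where u = "10 * tau n", OF 1 _ exec_step[OF 2 _ exec_step[OF 3 _
      exec_step[OF 4 _ exec_step[OF 5 _ exec_step[OF 6 _ exec_step[OF 7 _ exec_step[OF 8 _
      exec_step[OF 9 _ exec_SEQ_Nil]]]]]]]]]])
      (use tau_ge[of n] in simp_all)
qed

text \<open>Each round appends one wire and consumes one element of \<open>us\<close>, so the bound
  on the sum of the two lengths is invariant and all rounds share the same \<open>n\<close>.\<close>

lemma exec_GATES:
  assumes "R 8 = []" "R 9 = []" "R 10 = []" "R 11 = []" "R 16 = []" "R 19 = []" "R 20 = []"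
    "R 6 = us" "length (R 0) \<le> n" "length (R 7) + length us \<le> n"
    "S = R(6 := [], 7 := fst ((gatestep ^^ length us) (R 7, R 0)), 0 := snd ((gatestep ^^ length us) (R 7, R 0)))"
  shows "exec (Loop 6 (\<lambda>_. GATESTEP)) R (length us * (100 * tau n + 1) + 1) S"
  using assms
proof (induction us arbitrary: R)
  case Nil
  then have "S = R" by (auto simp: fun_eq_iff)
  then show ?case using Nil exec_Loop_Nil[of R 6 1] by simp
next
  case (Cons u us)
  let ?g = "gatestep (R 7, R 0)"
  let ?T = "R(6 := us, 7 := fst ?g, 0 := snd ?g)"
  have len: "length (fst ?g) = Suc (length (R 7))" "length (snd ?g) \<le> length (R 0)"
    unfolding gatestep_def using length_tok_rest(2)[of "R 0"] length_tok_rest(2)[of "rest (R 0)"]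
      length_tok_rest(2)[of "rest (rest (R 0))"] by auto
  have 1: "exec GATESTEP (R(6 := us)) (100 * tau n) ?T"
    using exec_GATESTEP[of "R(6 := us)" n] Cons.prems by simp
  have g: "(gatestep ^^ length (u # us)) (R 7, R 0) = (gatestep ^^ length us) (fst ?g, snd ?g)"
    by (simp add: funpow_Suc_right del: funpow.simps)
  have 2: "exec (Loop 6 (\<lambda>_. GATESTEP)) ?T (length us * (100 * tau n + 1) + 1) S"
    by (rule Cons.IH) (use Cons.prems(1-10) len Cons.prems(11)[unfolded g] in \<open>auto simp: fun_eq_iff\<close>)
  show ?case
    by (rule exec_Loop_Cons[where f = "\<lambda>_. GATESTEP", OF Cons.prems(8) 1 2]) simp
qed

definition OUT :: com where "OUT = SEQ [GETTOK 0 8, LOOKUP 7 8 19]"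

lemma exec_OUT:
  assumes "R 8 = []" "R 9 = []" "R 10 = []" "R 11 = []" "length (R 0) \<le> n" "length (R 7) \<le> n"
  shows "exec OUT R (30 * tau n) (R(0 := rest (R 0), 19 := lookup (R 7) (tok (R 0)) # R 19))"
proof -
  have len: "length (tok (R 0)) \<le> n" using length_tok_rest(1)[of "R 0"] assms by simp
  let ?R1 = "R(0 := rest (R 0), 8 := tok (R 0))"
  let ?R2 = "R(0 := rest (R 0), 19 := lookup (R 7) (tok (R 0)) # R 19)"
  have 1: "exec (GETTOK 0 8) R (tau n) ?R1" using exec_GETTOK[of 0 8 R n] assms by simp
  have eq: "?R1(8 := [], 19 := lookup (R 7) (tok (R 0)) # R 19) = ?R2" using assms by (auto simp: fun_eq_iff)
  have 2: "exec (LOOKUP 7 8 19) ?R1 (10 * tau n) ?R2"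
    using exec_LOOKUP[of 7 8 19 ?R1 n] assms len unfolding eq[symmetric] by simp
  show ?thesis unfolding OUT_def
    by (rule exec_mono[OF exec_step[where u = "10 * tau n", OF 1 _ exec_step[OF 2 _ exec_SEQ_Nil]]])
      (use tau_ge[of n] in simp_all)
qed

lemma exec_OUTS:
  assumes "R 8 = []" "R 9 = []" "R 10 = []" "R 11 = []" "R 21 = us" "length (R 0) \<le> n" "length (R 7) \<le> n"
    "S = R(21 := [], 0 := (rest ^^ length us) (R 0), 19 := rev (outv (R 7) (length us) (R 0)) @ R 19)"
  shows "exec (Loop 21 (\<lambda>_. OUT)) R (length us * (30 * tau n + 1) + 1) S"
  using assms
proof (induction us arbitrary: R)
  case Nil
  then have "S = R" by (auto simp: fun_eq_iff)
  then show ?case using Nil exec_Loop_Nil[of R 21 1] by simp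
next
  case (Cons u us)
  let ?T = "R(21 := us, 0 := rest (R 0), 19 := lookup (R 7) (tok (R 0)) # R 19)"
  have 1: "exec OUT (R(21 := us)) (30 * tau n) ?T"
    using exec_OUT[of "R(21 := us)" n] Cons.prems by simp
  have r: "(rest ^^ length (u # us)) (R 0) = (rest ^^ length us) (rest (R 0))"
    by (simp add: funpow_Suc_right del: funpow.simps)
  have "length (rest (R 0)) \<le> n" using length_tok_rest(2)[of "R 0"] Cons.prems by simp
  then have 2: "exec (Loop 21 (\<lambda>_. OUT)) ?T (length us * (30 * tau n + 1) + 1) S"
    by (intro Cons.IH) (use Cons.prems(1-7) Cons.prems(8)[unfolded r] in \<open>auto simp: fun_eq_iff\<close>)
  show ?case
    by (rule exec_Loop_Cons[where f = "\<lambda>_. OUT", OF Cons.prems(5) 1 2]) simp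
qed

text \<open>A cubic budget: it covers a loop of at most n rounds whose body costs up to 100 times
  \<open>tau n\<close>.\<close>

definition sigma :: "nat \<Rightarrow> nat" where "sigma n = (n + 1) * (200 * tau n)"

lemma sigma_ge: "k \<le> 200 \<Longrightarrow> k * tau n \<le> sigma n"
  by (simp add: sigma_def) (meson le_add1 le_trans mult_le_mono1)

lemma sigma_loop: "k \<le> n \<Longrightarrow> j \<le> 100 \<Longrightarrow> k * (j * tau n + 1) + 1 \<le> sigma n"
proof -
  assume "k \<le> n" "j \<le> 100"
  then have "k * (j * tau n + 1) \<le> n * (100 * tau n + 1)" by (intro mult_mono add_mono) auto
  moreover have "n * (100 * tau n + 1) + 1 \<le> (n + 1) * (100 * tau n + 1)" by simp
  moreover have "(n + 1) * (100 * tau n + 1) \<le> sigma n"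
    unfolding sigma_def using tau_ge[of n] by (intro mult_left_mono) auto
  ultimately show ?thesis by linarith
qed

text \<open>Alice's question in register 4 has as many bits as an index, so a copy of it counts the
  rounds of the loop.\<close>

definition OUTBITS :: "nat \<Rightarrow> com" where
  "OUTBITS d = SEQ [COPY 4 21, Loop 21 (\<lambda>_. OUT), MOVE 19 d]"

lemma length_outv [simp]: "length (outv w k xs) = k"
  by (induction k arbitrary: xs) auto

lemma exec_OUTBITS:
  assumes "R 8 = []" "R 9 = []" "R 10 = []" "R 11 = []" "R 19 = []" "R 21 = []" "R d = []"
    "d \<notin> {0, 4, 7, 8, 9, 10, 11, 19, 21}" "length (R 0) \<le> n" "length (R 7) \<le> n" "length (R 4) \<le> n"
  shows "exec (OUTBITS d) R (5 * sigma n) (R(0 := (rest ^^ length (R 4)) (R 0), d := outv (R 7) (length (R 4)) (R 0)))"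
proof -
  let ?k = "length (R 4)"
  let ?o = "outv (R 7) ?k (R 0)"
  let ?R1 = "R(21 := R 4)"
  let ?R2 = "R(0 := (rest ^^ ?k) (R 0), 19 := rev ?o)"
  let ?R3 = "R(0 := (rest ^^ ?k) (R 0), d := ?o)"
  have 1: "exec (COPY 4 21) R (tau n) ?R1" using exec_COPY[of 4 21 R n] assms by simp
  have "exec (Loop 21 (\<lambda>_. OUT)) ?R1 (?k * (30 * tau n + 1) + 1) ?R2"
    by (rule exec_OUTS) (use assms in \<open>auto simp: fun_eq_iff\<close>)
  then have 2: "exec (Loop 21 (\<lambda>_. OUT)) ?R1 (sigma n) ?R2"
    by (rule exec_mono) (use sigma_loop assms in simp)
  have "exec (MOVE 19 d) ?R2 (2 * length (rev ?o) + 1) ?R3"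
    by (rule exec_MOVE_aux) (use assms in \<open>auto simp: fun_eq_iff\<close>)
  then have 3: "exec (MOVE 19 d) ?R2 (tau n) ?R3"
    by (rule exec_mono) (use tau_linear[of 2 1 ?k n] assms in simp)
  show ?thesis unfolding OUTBITS_def
    by (rule exec_mono[OF exec_step[where u = "sigma n", OF 1 _ exec_step[OF 2 _ exec_step[OF 3 _ exec_SEQ_Nil]]]])
      (use tau_ge[of n] sigma_ge[of 1 n] in simp_all)
qed

definition OUT3 :: com where "OUT3 = SEQ [OUT, OUT, OUT, MOVE 19 16]"

lemma exec_OUT3:
  assumes "R 8 = []" "R 9 = []" "R 10 = []" "R 11 = []" "R 19 = []" "R 16 = []"
    "length (R 0) \<le> n" "length (R 7) \<le> n"
  shows "exec OUT3 R (5 * sigma n) (R(0 := (rest ^^ 3) (R 0), 16 := outv (R 7) 3 (R 0)))"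
proof -
  let ?x0 = "R 0" let ?x1 = "rest ?x0" let ?x2 = "rest ?x1" let ?x3 = "rest ?x2"
  let ?a = "lookup (R 7) (tok ?x0)" let ?b = "lookup (R 7) (tok ?x1)" let ?c = "lookup (R 7) (tok ?x2)"
  have len: "length ?x1 \<le> n" "length ?x2 \<le> n" using assms length_tok_rest(2) by (meson le_trans)+
  let ?R1 = "R(0 := ?x1, 19 := [?a])" let ?R2 = "R(0 := ?x2, 19 := [?b, ?a])" let ?R3 = "R(0 := ?x3, 19 := [?c, ?b, ?a])"
  let ?R4 = "R(0 := ?x3, 16 := [?a, ?b, ?c])"
  have 1: "exec OUT R (30 * tau n) ?R1" using exec_OUT[of R n] assms by simp
  have 2: "exec OUT ?R1 (30 * tau n) ?R2" using exec_OUT[of ?R1 n] assms len by simp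
  have 3: "exec OUT ?R2 (30 * tau n) ?R3" using exec_OUT[of ?R2 n] assms len by simp
  have "exec (MOVE 19 16) ?R3 (2 * length [?c, ?b, ?a] + 1) ?R4"
    by (rule exec_MOVE_aux) (use assms in \<open>auto simp: fun_eq_iff\<close>)
  then have 4: "exec (MOVE 19 16) ?R3 (30 * tau n) ?R4" by (rule exec_mono) (use tau_ge[of n] in simp)
  have eq: "?R4 = R(0 := (rest ^^ 3) (R 0), 16 := outv (R 7) 3 (R 0))"
    by (simp add: numeral_3_eq_3)
  show ?thesis unfolding OUT3_def eq[symmetric]
    by (rule exec_mono[OF exec_step[where u = "30 * tau n", OF 1 _ exec_step[OF 2 _ exec_step[OF 3 _ exec_step[OF 4 _ exec_SEQ_Nil]]]]])
      (use tau_ge[of n] sigma_ge[of 200 n] in simp_all)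
qed

definition LENCHK :: "nat \<Rightarrow> com" where
  "LENCHK a = SEQ [COPY a 21, Push 23 True, Loop 21 (\<lambda>_. Push 23 False), GETTOK 0 8, LOOKUP 23 8 22, CLEAR 23]"

text \<open>Compares a length with a binary number by a lookup in a one-hot list.\<close>

definition is_length :: "nat \<Rightarrow> bool list \<Rightarrow> bool" where
  "is_length k bs = lookup (replicate k False @ [True]) bs"

lemma exec_onehot:
  assumes "R 21 = us" "S = R(21 := [], 23 := replicate (length us) False @ R 23)"
  shows "exec (Loop 21 (\<lambda>_. Push 23 False)) R (2 * length us + 1) S"
  using assms
proof (induction us arbitrary: R)
  case Nil
  then have "S = R" by (auto simp: fun_eq_iff)
  then show ?case using Nil exec_Loop_Nil[of R 21 1] by simp
next
  case (Cons u us)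
  let ?T = "R(21 := us, 23 := False # R 23)"
  have 1: "exec (Push 23 False) (R(21 := us)) 1 ?T"
    using exec_Push[of 1 23 False "R(21 := us)"] by simp
  have 2: "exec (Loop 21 (\<lambda>_. Push 23 False)) ?T (2 * length us + 1) S"
    by (rule Cons.IH) (use Cons.prems in \<open>auto simp: fun_eq_iff replicate_app_Cons_same\<close>)
  show ?case
    by (rule exec_Loop_Cons[where f = "\<lambda>_. Push 23 False", OF Cons.prems(1) 1 2]) simp
qed

lemma exec_LENCHK:
  assumes "R 8 = []" "R 9 = []" "R 10 = []" "R 11 = []" "R 21 = []" "R 23 = []"
    "a \<notin> {0, 8, 9, 10, 11, 21, 22, 23}" "length (R 0) \<le> n" "length (R a) < n"
  shows "exec (LENCHK a) R (5 * sigma n) (R(0 := rest (R 0), 22 := is_length (length (R a)) (tok (R 0)) # R 22))"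
proof -
  let ?h = "replicate (length (R a)) False @ [True]"
  have len: "length (tok (R 0)) \<le> n" using length_tok_rest(1)[of "R 0"] assms by simp
  let ?b = "is_length (length (R a)) (tok (R 0))"
  let ?R1 = "R(21 := R a)" let ?R2 = "?R1(23 := [True])" let ?R3 = "R(23 := ?h)"
  let ?R4 = "R(23 := ?h, 0 := rest (R 0), 8 := tok (R 0))"
  let ?R5 = "R(23 := ?h, 0 := rest (R 0), 22 := ?b # R 22)"
  let ?R6 = "R(0 := rest (R 0), 22 := ?b # R 22)"
  have 1: "exec (COPY a 21) R (tau n) ?R1" using exec_COPY[of a 21 R n] assms by simp
  have 2: "exec (Push 23 True) ?R1 1 ?R2" using exec_Push[of 1 23 True ?R1] assms by simp
  have "exec (Loop 21 (\<lambda>_. Push 23 False)) ?R2 (2 * length (R a) + 1) ?R3"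
    by (rule exec_onehot) (use assms in \<open>auto simp: fun_eq_iff\<close>)
  then have 3: "exec (Loop 21 (\<lambda>_. Push 23 False)) ?R2 (tau n) ?R3"
    by (rule exec_mono) (use tau_linear[of 2 1 "length (R a)" n] assms in simp)
  have 4: "exec (GETTOK 0 8) ?R3 (tau n) ?R4" using exec_GETTOK[of 0 8 ?R3 n] assms by simp
  have eq: "?R4(8 := [], 22 := lookup ?h (tok (R 0)) # R 22) = ?R5" using assms by (auto simp: fun_eq_iff is_length_def)
  have 5: "exec (LOOKUP 23 8 22) ?R4 (10 * tau n) ?R5"
    using exec_LOOKUP[of 23 8 22 ?R4 n] assms len unfolding eq[symmetric] by simp
  have eq6: "?R5(23 := []) = ?R6" using assms by (auto simp: fun_eq_iff)
  have 6: "exec (CLEAR 23) ?R5 (tau n) ?R6"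
    using exec_CLEAR[of ?R5 23 n] assms unfolding eq6[symmetric] by simp
  show ?thesis unfolding LENCHK_def
    by (rule exec_mono[OF exec_step[where u = "10 * tau n", OF 1 _ exec_step[OF 2 _ exec_step[OF 3 _
      exec_step[OF 4 _ exec_step[OF 5 _ exec_step[OF 6 _ exec_SEQ_Nil]]]]]]])
      (use tau_ge[of n] sigma_ge[of 200 n] in simp_all)
qed

definition CMPNUM :: "nat \<Rightarrow> nat \<Rightarrow> (bool list \<Rightarrow> bool) \<Rightarrow> com" where
  "CMPNUM a b h = SEQ [COPY a 21, CMP 21 b, Case 11 (Push 22 (h [])) (\<lambda>x. Push 22 (h [x]))]"

lemma length_cmp: "length (cmp xs ys) \<le> 1"
proof -
  have "length F \<le> 1 \<Longrightarrow> length (cmp_low xs ys F) \<le> 1" for F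
    by (induction xs ys F rule: cmp_low.induct) auto
  moreover have "length F \<le> 1 \<Longrightarrow> length (cmp_high ys F) \<le> 1" for F ys
    by (induction ys F rule: cmp_high.induct) auto
  ultimately show ?thesis by (simp add: cmp_def)
qed

lemma exec_CMPNUM:
  assumes "R 10 = []" "R 11 = []" "R 21 = []" "a \<notin> {10, 11, 21, 22}" "b \<notin> {10, 11, 21, 22}" "a \<noteq> b"
    "length (R a) \<le> n" "length (R b) \<le> n"
  shows "exec (CMPNUM a b h) R (5 * sigma n) (R(b := [], 22 := h (cmp (R a) (R b)) # R 22))"
proof -
  let ?c = "cmp (R a) (R b)"
  let ?R1 = "R(21 := R a)" let ?R2 = "R(b := [], 11 := ?c)" let ?R3 = "R(b := [], 22 := h ?c # R 22)"
  have 1: "exec (COPY a 21) R (tau n) ?R1" using exec_COPY[of a 21 R n] assms by simp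
  have eq: "?R1(21 := [], b := [], 11 := ?c) = ?R2" using assms by (auto simp: fun_eq_iff)
  have 2: "exec (CMP 21 b) ?R1 (tau n) ?R2"
    using exec_CMP[of 21 b ?R1 n] assms unfolding eq[symmetric] by simp
  have 3: "exec (Case 11 (Push 22 (h [])) (\<lambda>x. Push 22 (h [x]))) ?R2 (tau n) ?R3"
  proof (cases ?c)
    case Nil
    have e: "?R2(22 := h [] # ?R2 22) = ?R3" using assms Nil by (auto simp: fun_eq_iff)
    have "exec (Push 22 (h [])) ?R2 1 ?R3" using exec_Push[of 1 22 "h []" ?R2] unfolding e by simp
    then show ?thesis by (rule exec_Case_Nil[rotated]) (use Nil tau_ge[of n] in simp_all)
  next
    case (Cons x xs)
    then have x: "?c = [x]" using length_cmp[of "R a" "R b"] by simp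
    have e: "(?R2(11 := []))(22 := h [x] # (?R2(11 := [])) 22) = ?R3" using assms x by (auto simp: fun_eq_iff)
    have "exec (Push 22 (h [x])) (?R2(11 := [])) 1 ?R3" using exec_Push[of 1 22 "h [x]" "?R2(11 := [])"] unfolding e by simp
    then show ?thesis
      by (intro exec_Case_Cons[where f = "\<lambda>x. Push 22 (h [x])" and b = x and bs = "[]" and ?t1.0 = 1])
        (use x tau_ge[of n] in simp_all)
  qed
  show ?thesis unfolding CMPNUM_def
    by (rule exec_mono[OF exec_step[where u = "tau n", OF 1 _ exec_step[OF 2 _ exec_step[OF 3 _ exec_SEQ_Nil]]]])
      (use tau_ge[of n] sigma_ge[of 200 n] in simp_all)
qed

section \<open>The question program and the decision program\<close>

definition QUES :: com where
  "QUES = SEQ [GETTOK 1 4, GETTOK 1 5, CLEAR 0, CLEAR 1, COPY 4 0, COPY 5 1]"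

lemma exec_QUES:
  assumes "length x \<le> n" "length r \<le> n"
  shows "\<exists>S. exec QUES (init_store [x, r]) (10 * tau n) S \<and> S 0 = tok r \<and> S 1 = tok (rest r)"
proof -
  have len: "length (tok r) \<le> n" "length (rest r) \<le> n" "length (tok (rest r)) \<le> n" "length (rest (rest r)) \<le> n"
    using assms length_tok_rest by (meson le_trans)+
  let ?R0 = "init_store [x, r]"
  have R0: "?R0 0 = x" "?R0 1 = r" "2 \<le> i \<Longrightarrow> ?R0 i = []" for i by (auto simp: init_store_def)
  define R1 where "R1 = ?R0(1 := rest r, 4 := tok r)"
  define R2 where "R2 = R1(1 := rest (rest r), 5 := tok (rest r))"
  define R3 where "R3 = R2(0 := [])"
  define R4 where "R4 = R3(1 := [])"
  define R5 where "R5 = R4(0 := tok r)"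
  define R6 where "R6 = R5(1 := tok (rest r))"
  note d = R0 R1_def R2_def R3_def R4_def R5_def
  have 1: "exec (GETTOK 1 4) ?R0 (tau n) R1"
    using exec_GETTOK[of 1 4 ?R0 n] assms unfolding R1_def by (simp add: R0 R0[unfolded One_nat_def])
  have 2: "exec (GETTOK 1 5) R1 (tau n) R2"
    using exec_GETTOK[of 1 5 R1 n] len unfolding R2_def by (simp add: d)
  have 3: "exec (CLEAR 0) R2 (tau n) R3"
    using exec_CLEAR[of R2 0 n] assms unfolding R3_def by (simp add: d)
  have 4: "exec (CLEAR 1) R3 (tau n) R4"
    using exec_CLEAR[of R3 1 n] len unfolding R4_def by (simp add: d)
  have 5: "exec (COPY 4 0) R4 (tau n) R5"
    using exec_COPY[of 4 0 R4 n] len unfolding R5_def by (simp add: d)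
  have 6: "exec (COPY 5 1) R5 (tau n) R6"
    using exec_COPY[of 5 1 R5 n] len unfolding R6_def by (simp add: d)
  have "exec QUES ?R0 (10 * tau n) R6" unfolding QUES_def
    by (rule exec_mono[OF exec_step[where u = "tau n", OF 1 _ exec_step[OF 2 _ exec_step[OF 3 _ exec_step[OF 4 _
      exec_step[OF 5 _ exec_step[OF 6 _ exec_SEQ_Nil]]]]]]])
      (use tau_ge[of n] in simp_all)
  moreover have "R6 0 = tok r" "R6 1 = tok (rest r)" by (simp_all add: R6_def R5_def)
  ultimately show ?thesis by blast
qed

definition refutes :: "bool list \<Rightarrow> bool list \<Rightarrow> bool list \<Rightarrow> bool list \<Rightarrow> bool list \<Rightarrow> bool list \<Rightarrow> bool list
    \<Rightarrow> bool list \<Rightarrow> bool list \<Rightarrow> bool" where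
  "refutes nn k i j c a b y z = (cmp j k = [] \<and> \<not> hdb z \<or> cmp i nn = [True] \<and>
     (cmp j i = [] \<and> hdb z \<noteq> gv c (hdb y) (hdb (tl y)) \<or> cmp j a = [] \<and> hdb z \<noteq> hdb y \<or> cmp j b = [] \<and> hdb z \<noteq> hdb (tl y)))"

text \<open>The random string supplies the questions and, as the third component, the number of gates in unary;
  malformed random strings are accepted.\<close>

definition dec :: "bool list \<Rightarrow> bool list \<Rightarrow> bool list \<Rightarrow> bool list \<Rightarrow> bool" where
  "dec x r y z = (let i = tok r; j = tok (rest r); u = tok (rest (rest r));
     x1 = rest x; x2 = rest x1; x3 = rest x2;
     p = (gatestep ^^ length u) (i, rest x3); w = fst p; o1 = snd p;
     o2 = (rest ^^ 3) o1; o3 = (rest ^^ length i) o2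
   in \<not> (is_length (length i) (tok x2) \<and> is_length (length u) (tok x3) \<and>
     refutes (tok x) (tok x1) i j (outv w 3 o1) (outv w (length i) o2) (outv w (length i) o3) y z))"

text \<open>Branching on every bit stores them all in the control, so that an arbitrary Boolean
  function \<open>h\<close> of them costs a single push. The test outcomes come off register 22 in
  the reverse order of the tests.\<close>

definition FINAL :: "(bool \<Rightarrow> bool \<Rightarrow> bool \<Rightarrow> bool \<Rightarrow> bool \<Rightarrow> bool \<Rightarrow> bool \<Rightarrow> bool \<Rightarrow> bool \<Rightarrow> bool \<Rightarrow> bool \<Rightarrow> bool \<Rightarrow> bool \<Rightarrow> bool) \<Rightarrow> com" where
  "FINAL h = getbit 22 (\<lambda>eb. getbit 22 (\<lambda>ea. getbit 22 (\<lambda>ei. getbit 22 (\<lambda>lt. getbit 22 (\<lambda>ek.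
     getbit 22 (\<lambda>okg. getbit 22 (\<lambda>okm. getbit 16 (\<lambda>b0. getbit 16 (\<lambda>b1. getbit 16 (\<lambda>b2.
     getbit 2 (\<lambda>y1. getbit 2 (\<lambda>y2. getbit 3 (\<lambda>z1.
       Push 0 (h eb ea ei lt ek okg okm b0 b1 b2 y1 y2 z1))))))))))))))"

lemma exec_FINAL:
  assumes "R 22 = [eb, ea, ei, lt, ek, okg, okm]" "R 0 = []"
  shows "\<exists>S. exec (FINAL h) R 14 S \<and> S 0 = [h eb ea ei lt ek okg okm (hdb (R 16)) (hdb (tl (R 16)))
     (hdb (tl (tl (R 16)))) (hdb (R 2)) (hdb (tl (R 2))) (hdb (R 3))]"
proof -
  let ?b = "h eb ea ei lt ek okg okm (hdb (R 16)) (hdb (tl (R 16)))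
     (hdb (tl (tl (R 16)))) (hdb (R 2)) (hdb (tl (R 2))) (hdb (R 3))"
  let ?T = "R(22 := [], 16 := tl (tl (tl (R 16))), 2 := tl (tl (R 2)), 3 := tl (R 3))"
  have p: "exec (Push 0 ?b) ?T 1 (?T(0 := ?b # ?T 0))" by (rule exec_Push) simp
  have "exec (FINAL h) R 14 (?T(0 := ?b # ?T 0))" unfolding FINAL_def
    by (rule exec_getbit[where t = 13], rule exec_getbit[where t = 12], rule exec_getbit[where t = 11],
      rule exec_getbit[where t = 10], rule exec_getbit[where t = 9], rule exec_getbit[where t = 8],
      rule exec_getbit[where t = 7], rule exec_getbit[where t = 6], rule exec_getbit[where t = 5],
      rule exec_getbit[where t = 4], rule exec_getbit[where t = 3], rule exec_getbit[where t = 2],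
      rule exec_getbit[where t = 1])
      (use p in \<open>simp_all add: assms\<close>)
  moreover have "(?T(0 := ?b # ?T 0)) 0 = [?b]" using assms by simp
  ultimately show ?thesis by blast
qed

definition verdict :: "bool \<Rightarrow> bool \<Rightarrow> bool \<Rightarrow> bool \<Rightarrow> bool \<Rightarrow> bool \<Rightarrow> bool \<Rightarrow> bool \<Rightarrow> bool \<Rightarrow> bool \<Rightarrow> bool \<Rightarrow> bool \<Rightarrow> bool \<Rightarrow> bool" where
  "verdict eb ea ei lt ek okg okm b0 b1 b2 y1 y2 z1 = (\<not> (okm \<and> okg \<and> (ek \<and> \<not> z1 \<or> lt \<and>
     (ei \<and> z1 \<noteq> gv [b0, b1, b2] y1 y2 \<or> ea \<and> z1 \<noteq> y1 \<or> eb \<and> z1 \<noteq> y2))))"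

definition DEC :: com where
  "DEC = SEQ [GETTOK 1 4, GETTOK 1 5, GETTOK 1 6, GETTOK 0 13, GETTOK 0 14, LENCHK 4, LENCHK 6,
     COPY 4 7, Loop 6 (\<lambda>_. GATESTEP), OUT3, OUTBITS 17, OUTBITS 18,
     CMPNUM 5 14 (\<lambda>F. F = []), CMPNUM 4 13 (\<lambda>F. F = [True]), CMPNUM 5 4 (\<lambda>F. F = []),
     CMPNUM 5 17 (\<lambda>F. F = []), CMPNUM 5 18 (\<lambda>F. F = []), CLEAR 0, FINAL verdict]"

lemma length_gatestep: "length (fst (gatestep p)) = Suc (length (fst p))" "length (snd (gatestep p)) \<le> length (snd p)"
  using length_tok_rest(2)[of "snd p"] length_tok_rest(2)[of "rest (snd p)"] length_tok_rest(2)[of "rest (rest (snd p))"]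
  by (auto simp: gatestep_def split: prod.split)

lemma length_gates: "length (fst ((gatestep ^^ k) p)) = length (fst p) + k"
  "length (snd ((gatestep ^^ k) p)) \<le> length (snd p)"
  by (induction k) (auto simp: length_gatestep intro: le_trans[OF length_gatestep(2)])

lemma length_rest_pow: "length ((rest ^^ k) xs) \<le> length xs"
  by (induction k) (auto intro: le_trans[OF length_tok_rest(2)])

text \<open>\<open>tok\<close> and \<open>rest\<close> read disjoint parts. In
  \<open>exec_DEC\<close> this bounds the length of the question plus the number of gates by the
  length of the random string, and hence the wire list.\<close>

lemma length_tok_plus_rest: "length (tok xs) + length (rest xs) \<le> length xs"
  by (induction xs rule: tok.induct) auto

lemma exec_DEC:
  assumes n: "length x < n" "length r < n"
  shows "\<exists>S. exec DEC (init_store [x, r, y, z]) (150 * sigma n) S \<and> S 0 = [dec x r y z]"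
proof -
  define i where "i = tok r"
  define r1 where "r1 = rest r"
  define j where "j = tok r1"
  define r2 where "r2 = rest r1"
  define u where "u = tok r2"
  define x1 where "x1 = rest x"
  define x2 where "x2 = rest x1"
  define x3 where "x3 = rest x2"
  define x4 where "x4 = rest x3"
  define p where "p = (gatestep ^^ length u) (i, x4)"
  define w where "w = fst p"
  define o1 where "o1 = snd p"
  define o2 where "o2 = (rest ^^ 3) o1"
  define o3 where "o3 = (rest ^^ length i) o2"
  define o4 where "o4 = (rest ^^ length i) o3"
  define c where "c = outv w 3 o1"
  define a where "a = outv w (length i) o2"
  define b where "b = outv w (length i) o3"
  define okm where "okm = is_length (length i) (tok x2)"
  define okg where "okg = is_length (length u) (tok x3)"
  have iu: "length i + length u < n"
    using length_tok_plus_rest[of r] length_tok_plus_rest[of r1] length_tok_plus_rest[of r2] n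
    unfolding i_def r1_def r2_def u_def by linarith
  have lr: "length r1 < n" "length r2 < n" "length j < n"
    using length_tok_rest[of r] length_tok_rest[of r1] n unfolding r1_def r2_def j_def by linarith+
  have lx: "length x1 < n" "length x2 < n" "length x3 < n" "length x4 < n" "length (tok x) < n" "length (tok x1) < n"
    using length_tok_rest[of x] length_tok_rest[of x1] length_tok_rest[of x2] length_tok_rest[of x3] n
    unfolding x1_def x2_def x3_def x4_def by linarith+
  have lw: "length w < n" "length o1 < n"
    using length_gates[of "length u" "(i, x4)"] iu lx unfolding w_def o1_def p_def by auto
  have lo: "length o2 < n" "length o3 < n" "length o4 < n"
    using length_rest_pow[of 3 o1] length_rest_pow[of "length i" o2] length_rest_pow[of "length i" o3] lw
    unfolding o2_def o3_def o4_def by linarith+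
  have lab: "length a = length i" "length b = length i" by (simp_all add: a_def b_def)
  let ?R0 = "init_store [x, r, y, z]"
  have R0: "?R0 0 = x" "?R0 (Suc 0) = r" "?R0 2 = y" "?R0 3 = z" "4 \<le> q \<Longrightarrow> ?R0 q = []" for q
    by (auto simp: init_store_def)
  define R1 where "R1 = ?R0(1 := r1, 4 := i)"
  define R2 where "R2 = R1(1 := r2, 5 := j)"
  define R3 where "R3 = R2(1 := rest r2, 6 := u)"
  define R4 where "R4 = R3(0 := x1, 13 := tok x)"
  define R5 where "R5 = R4(0 := x2, 14 := tok x1)"
  define R6 where "R6 = R5(0 := x3, 22 := [okm])"
  define R7 where "R7 = R6(0 := x4, 22 := [okg, okm])"
  define R8 where "R8 = R7(7 := i)"
  define R9 where "R9 = R8(6 := [], 7 := w, 0 := o1)"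
  define R10 where "R10 = R9(0 := o2, 16 := c)"
  define R11 where "R11 = R10(0 := o3, 17 := a)"
  define R12 where "R12 = R11(0 := o4, 18 := b)"
  define R13 where "R13 = R12(14 := [], 22 := [cmp j (tok x1) = [], okg, okm])"
  define R14 where "R14 = R13(13 := [], 22 := [cmp i (tok x) = [True], cmp j (tok x1) = [], okg, okm])"
  define R15 where "R15 = R14(4 := [], 22 := [cmp j i = [], cmp i (tok x) = [True], cmp j (tok x1) = [], okg, okm])"
  define R16 where "R16 = R15(17 := [], 22 := [cmp j a = [], cmp j i = [], cmp i (tok x) = [True], cmp j (tok x1) = [], okg, okm])"
  define R17 where "R17 = R16(18 := [], 22 := [cmp j b = [], cmp j a = [], cmp j i = [], cmp i (tok x) = [True], cmp j (tok x1) = [], okg, okm])"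
  define R18 where "R18 = R17(0 := [])"
  note d1 = R0 R1_def R2_def R3_def R4_def R5_def R6_def R7_def R8_def
  note d2 = d1 R9_def R10_def R11_def R12_def R13_def R14_def R15_def R16_def R17_def
  note len = iu lr lx lw lo lab
  have 1: "exec (GETTOK 1 4) ?R0 (tau n) R1"
    using exec_GETTOK[of 1 4 ?R0 n] n unfolding R1_def i_def r1_def by (simp add: R0)
  have 2: "exec (GETTOK 1 5) R1 (tau n) R2"
    using exec_GETTOK[of 1 5 R1 n] len unfolding R2_def j_def r2_def by (simp add: d1)
  have 3: "exec (GETTOK 1 6) R2 (tau n) R3"
    using exec_GETTOK[of 1 6 R2 n] len unfolding R3_def u_def by (simp add: d1)
  have 4: "exec (GETTOK 0 13) R3 (tau n) R4"
    using exec_GETTOK[of 0 13 R3 n] n unfolding R4_def x1_def by (simp add: d1)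
  have 5: "exec (GETTOK 0 14) R4 (tau n) R5"
    using exec_GETTOK[of 0 14 R4 n] len unfolding R5_def x2_def by (simp add: d1)
  have 6: "exec (LENCHK 4) R5 (5 * sigma n) R6"
    using exec_LENCHK[of R5 4 n] len unfolding R6_def x3_def okm_def by (simp add: d1)
  have 7: "exec (LENCHK 6) R6 (5 * sigma n) R7"
    using exec_LENCHK[of R6 6 n] len unfolding R7_def x4_def okg_def by (simp add: d1)
  have 8: "exec (COPY 4 7) R7 (tau n) R8"
    using exec_COPY[of 4 7 R7 n] len unfolding R8_def by (simp add: d1)
  have "exec (Loop 6 (\<lambda>_. GATESTEP)) R8 (length u * (100 * tau n + 1) + 1) R9"
    by (rule exec_GATES) (use len in \<open>simp_all add: d1 R9_def w_def o1_def p_def\<close>)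
  then have 9: "exec (Loop 6 (\<lambda>_. GATESTEP)) R8 (sigma n) R9"
    by (rule exec_mono) (use sigma_loop[of "length u" n 100] iu in simp)
  have 10: "exec OUT3 R9 (5 * sigma n) R10"
    using exec_OUT3[of R9 n] len unfolding R10_def o2_def c_def by (simp add: d2)
  have 11: "exec (OUTBITS 17) R10 (5 * sigma n) R11"
    using exec_OUTBITS[of R10 17 n] len unfolding R11_def o3_def a_def by (simp add: d2)
  have 12: "exec (OUTBITS 18) R11 (5 * sigma n) R12"
    using exec_OUTBITS[of R11 18 n] len unfolding R12_def o4_def b_def by (simp add: d2)
  have 13: "exec (CMPNUM 5 14 (\<lambda>F. F = [])) R12 (5 * sigma n) R13"
    using exec_CMPNUM[of R12 5 14 n] len unfolding R13_def by (simp add: d2)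
  have 14: "exec (CMPNUM 4 13 (\<lambda>F. F = [True])) R13 (5 * sigma n) R14"
    using exec_CMPNUM[of R13 4 13 n] len unfolding R14_def by (simp add: d2)
  have 15: "exec (CMPNUM 5 4 (\<lambda>F. F = [])) R14 (5 * sigma n) R15"
    using exec_CMPNUM[of R14 5 4 n] len unfolding R15_def by (simp add: d2)
  have 16: "exec (CMPNUM 5 17 (\<lambda>F. F = [])) R15 (5 * sigma n) R16"
    using exec_CMPNUM[of R15 5 17 n] len unfolding R16_def by (simp add: d2)
  have 17: "exec (CMPNUM 5 18 (\<lambda>F. F = [])) R16 (5 * sigma n) R17"
    using exec_CMPNUM[of R16 5 18 n] len unfolding R17_def by (simp add: d2)
  have 18: "exec (CLEAR 0) R17 (tau n) R18"
    using exec_CLEAR[of R17 0 n] len unfolding R18_def by (simp add: d2)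
  have v: "R18 22 = [cmp j b = [], cmp j a = [], cmp j i = [], cmp i (tok x) = [True], cmp j (tok x1) = [], okg, okm]"
    "R18 0 = []" "R18 2 = y" "R18 3 = z" "R18 16 = c"
    by (simp_all add: R18_def d2)
  obtain S where S: "exec (FINAL verdict) R18 14 S" "S 0 = [\<not> (okm \<and> okg \<and> refutes (tok x) (tok x1) i j c a b y z)]"
    using exec_FINAL[OF v(1,2), of verdict] unfolding v verdict_def refutes_def gv_bits by blast
  have "exec DEC ?R0 (150 * sigma n) S" unfolding DEC_def
    by (rule exec_mono[OF exec_step[where u = "5 * sigma n", OF 1 _ exec_step[OF 2 _ exec_step[OF 3 _
      exec_step[OF 4 _ exec_step[OF 5 _ exec_step[OF 6 _ exec_step[OF 7 _ exec_step[OF 8 _ exec_step[OF 9 _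
      exec_step[OF 10 _ exec_step[OF 11 _ exec_step[OF 12 _ exec_step[OF 13 _ exec_step[OF 14 _ exec_step[OF 15 _
      exec_step[OF 16 _ exec_step[OF 17 _ exec_step[OF 18 _ exec_step[OF S(1) _ exec_SEQ_Nil]]]]]]]]]]]]]]]]]]]])
      (use tau_ge[of n] sigma_ge[of 1 n] in simp_all)
  moreover have "dec x r y z = (\<not> (okm \<and> okg \<and> refutes (tok x) (tok x1) i j c a b y z))"
    unfolding dec_def Let_def okm_def okg_def a_def b_def c_def o3_def o2_def o1_def w_def p_def x4_def x3_def x2_def x1_def
      u_def j_def r2_def r1_def i_def by simp
  ultimately show ?thesis using S(2) by auto
qed

section \<open>The verifier and its polynomial running time\<close>

lemma tok_enc: "tok (enc_tuple (v # ws)) = v" and rest_enc: "rest (enc_tuple (v # ws)) = enc_tuple ws"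
  by (induction v) (simp_all add: enc_tuple_Cons)

lemma enc_tuple_inject: "length vs = length ws \<Longrightarrow> enc_tuple vs = enc_tuple ws \<Longrightarrow> vs = ws"
proof (induction vs ws rule: list_induct2)
  case (Cons v vs w ws)
  then show ?case by (metis tok_enc rest_enc)
qed simp

definition ver :: verifier where
  "ver = (\<lambda>n. n, \<lambda>n. n, \<lambda>x r. (tok r, tok (rest r)), dec)"

lemma ver_simps [simp]: "v_rand ver n = n" "v_alen ver n = n" "v_ques ver x r = (tok r, tok (rest r))" "v_dec ver = dec"
  by (simp_all add: ver_def v_rand_def v_alen_def v_ques_def v_dec_def)

lemma regs_below_macros [simp]:
  "regs_below k (MOVE a b) = (a < k \<and> b < k)"
  "regs_below k (CLEAR a) = (a < k)"
  "regs_below k (COPY a b) = (a < k \<and> b < k \<and> 10 < k)"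
  "regs_below k (GETTOK a b) = (a < k \<and> b < k \<and> 11 < k)"
  by (auto simp: MOVE_def CLEAR_def COPY_def GETTOK_def)

lemma regs_below_progs: "regs_below 24 QUES" "regs_below 24 DEC"
  by (simp_all add: QUES_def DEC_def LENCHK_def GATESTEP_def OUT3_def OUTBITS_def OUT_def CMPNUM_def CMP_def LOOKUP_def
      EVENS_def FINAL_def)

lemma poly_verifier_ver: "poly_verifier ver"
proof -
  let ?W2 = "{[x, r] | x r :: bool list. length r = length x}"
  let ?W4 = "{[x, r, y, z] | x r y z :: bool list. length r = length x \<and> length y = length x \<and> length z = length x}"
  let ?f2 = "\<lambda>w. SOME out. \<exists>x r. w = enc_tuple [x, r] \<and> length r = v_rand ver (length x) \<and>
            out = enc_tuple [fst (v_ques ver x r), snd (v_ques ver x r)]"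
  let ?f4 = "\<lambda>w. SOME out. \<exists>x r y z. w = enc_tuple [x, r, y, z] \<and> length r = v_rand ver (length x) \<and>
            length y = v_alen ver (length x) \<and> length z = v_alen ver (length x) \<and>
            out = [v_dec ver x r y z]"
  \<comment> \<open>The specification picks the output by choice; injectivity of
    \<open>enc_tuple\<close> on tuples of equal length makes it unique.\<close>
  have f2: "?f2 (enc_tuple [x, r]) = enc_tuple [tok r, tok (rest r)]" if "length r = length x" for x r
    by (rule some_equality) (use that in \<open>auto dest!: enc_tuple_inject[rotated]\<close>)
  have f4: "?f4 (enc_tuple [x, r, y, z]) = [dec x r y z]"
    if "length r = length x" "length y = length x" "length z = length x" for x r y z
    by (rule some_equality) (use that in \<open>auto dest!: enc_tuple_inject[rotated]\<close>)
  have "\<exists>M. poly_computes_on M (enc_tuple ` ?W2) ?f2"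
  \<comment> \<open>Two input registers and 22 added ones make the 24 of
    \<open>regs_below_progs\<close>; 1000 is 10 times the constant of \<open>tau\<close>.\<close>
  proof (rule compile_poly[where p = QUES and e = 22 and ?k0.0 = 2 and c = 1000 and d = 2 and q = True])
    fix ws assume "ws \<in> ?W2"
    then obtain x r where ws: "ws = [x, r]" "length r = length x" by auto
    let ?n = "length (enc_tuple ws)"
    have "length x \<le> ?n" "length r \<le> ?n" by (simp_all add: ws enc_tuple_Cons)
    from exec_QUES[OF this] obtain S where "exec QUES (init_store ws) (10 * tau ?n) S" "S 0 = tok r" "S 1 = tok (rest r)"
      unfolding ws by blast
    moreover have "10 * tau ?n = 1000 * (?n + 1)\<^sup>2" by (simp add: tau_def)
    ultimately show "\<exists>S. exec QUES (init_store ws) (1000 * (?n + 1)\<^sup>2) S \<and>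
        (if True then ?f2 (enc_tuple ws) = enc_tuple [S 0, S 1] else \<exists>b bs. S 0 = b # bs \<and> ?f2 (enc_tuple ws) = [b])"
      unfolding ws f2[OF ws(2)] by auto
  qed (use regs_below_progs in auto)
  moreover have "\<exists>M. poly_computes_on M (enc_tuple ` ?W4) ?f4"
  \<comment> \<open>Again 24 registers; 3000000 = 150 * 200 * 100 multiplies the constants of
    \<open>exec_DEC\<close>, \<open>sigma\<close> and \<open>tau\<close>.\<close>
  proof (rule compile_poly[where p = DEC and e = 20 and ?k0.0 = 4 and c = 3000000 and d = 3 and q = False])
    fix ws assume "ws \<in> ?W4"
    then obtain x r y z where ws: "ws = [x, r, y, z]" "length r = length x" "length y = length x" "length z = length x" by auto
    let ?n = "length (enc_tuple ws)"
    have "length x < ?n" "length r < ?n" by (simp_all add: ws enc_tuple_Cons)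
    from exec_DEC[OF this] obtain S where "exec DEC (init_store ws) (150 * sigma ?n) S" "S 0 = [dec x r y z]"
      unfolding ws by blast
    moreover have "150 * sigma ?n = 3000000 * (?n + 1) ^ 3"
      by (simp add: sigma_def tau_def power2_eq_square power3_eq_cube algebra_simps)
    ultimately show "\<exists>S. exec DEC (init_store ws) (3000000 * (?n + 1) ^ 3) S \<and>
        (if False then ?f4 (enc_tuple ws) = enc_tuple [S 0, S 1] else \<exists>b bs. S 0 = b # bs \<and> ?f4 (enc_tuple ws) = [b])"
      unfolding ws f4[OF ws(2-4)] by auto
  qed (use regs_below_progs in auto)
  moreover have "enc_tuple ` ?W2 = {enc_tuple [x, r] | x r. length r = v_rand ver (length x)}" by auto
  moreover have "enc_tuple ` ?W4 = {enc_tuple [x, r, y, z] | x r y z. length r = v_rand ver (length x) \<and>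
            length y = v_alen ver (length x) \<and> length z = v_alen ver (length x)}" by auto
  moreover have "v_rand ver \<in> poly" "v_alen ver \<in> poly"
    using id_in_poly by (simp_all add: ver_def v_rand_def v_alen_def)
  ultimately show ?thesis unfolding poly_verifier_def by simp
qed

section \<open>Completeness and soundness\<close>

declare nat_bits.simps [simp del]

lemma nat_bits_0 [simp]: "nat_bits 0 = []"
  by (simp add: nat_bits.simps)

lemma nat_bits_pos: "0 < n \<Longrightarrow> nat_bits n = odd n # nat_bits (n div 2)"
  by (subst nat_bits.simps) simp

lemma nth_evens: "length (evens xs) = (length xs + 1) div 2" "2 * i < length xs \<Longrightarrow> evens xs ! i = xs ! (2 * i)"
proof (induction xs arbitrary: i rule: evens.induct)
  case (1 x y xs)
  case 2
  then show ?case using 1 by (cases i) auto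
qed auto

text \<open>Dropping the first element for an odd digit and then keeping the even positions moves
  position a to a div 2. A list that has run out reads as False.\<close>

lemma lookup_nat_bits: "lookup L (nat_bits a) = (a < length L \<and> L ! a)"
proof -
  have ev: "(q < length (evens M) \<and> evens M ! q) = (2 * q < length M \<and> M ! (2 * q))" for q and M :: "bool list"
  proof -
    have iff: "q < length (evens M) \<longleftrightarrow> 2 * q < length M" using nth_evens(1)[of M] by arith
    show ?thesis
    proof (cases "2 * q < length M")
      case True
      show ?thesis using nth_evens(2)[OF True] True iff by blast
    next
      case False
      then show ?thesis using iff by blast
    qed
  qed
  show ?thesis
proof (induction a arbitrary: L rule: less_induct)
  case (less a)
  show ?case
  proof (cases "a = 0")
    case True
    then show ?thesis by (cases L) (auto simp: lookup_def)
  next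
    case False
    let ?M = "if odd a then tl L else L"
    have "lookup L (nat_bits a) = lookup (evens ?M) (nat_bits (a div 2))"
      using False by (simp add: lookup_def nat_bits_pos)
    also have "\<dots> = (a div 2 < length (evens ?M) \<and> evens ?M ! (a div 2))"
      using less[of "a div 2" "evens ?M"] False by simp
    also have "\<dots> = (2 * (a div 2) < length ?M \<and> ?M ! (2 * (a div 2)))"
      by (rule ev)
    also have "\<dots> = (a < length L \<and> L ! a)"
    proof (cases "odd a")
      case True
      then obtain q where q: "a = 2 * q + 1" by (rule oddE)
      show ?thesis unfolding q by (cases L) simp_all
    next
      case False
      then show ?thesis by simp
    qed
    finally show ?thesis .
  qed
qed
qed

lemma is_length_nat_bits: "is_length k (nat_bits a) = (a = k)"
  by (auto simp: is_length_def lookup_nat_bits nth_append)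

lemma bits_to_nat_Nil [simp]: "bits_to_nat [] = 0"
  by (simp add: bits_to_nat_def)

lemma bits_to_nat_Cons: "bits_to_nat (b # bs) = of_bool b + 2 * bits_to_nat bs"
  unfolding bits_to_nat_def length_Cons sum.lessThan_Suc_shift sum_distrib_left
  by (simp add: if_distrib[of "(*) 2"] cong: if_cong)

lemma bits_to_nat_hdb: "bits_to_nat ys = of_bool (hdb ys) + 2 * bits_to_nat (tl ys)"
  by (cases ys) (auto simp: bits_to_nat_Cons)

text \<open>\<open>F\<close> is the verdict of the less significant bits. It survives only if all
  later bits agree, since a later difference overwrites it; a shorter \<open>ys\<close> is padded
  with zeros by \<open>hdb\<close> and \<open>tl\<close>.\<close>

lemma cmp_gen: "cmp_high (drop (length xs) ys) (cmp_low xs ys F) =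
   (if bits_to_nat xs = bits_to_nat ys then F else [bits_to_nat xs < bits_to_nat ys])"
proof (induction xs arbitrary: ys F)
  case Nil
  have "cmp_high ys F = (if bits_to_nat ys = 0 then F else [True])"
    by (induction ys arbitrary: F) (auto simp: bits_to_nat_Cons)
  then show ?case by auto
next
  case (Cons x xs)
  have "drop (length (x # xs)) ys = drop (length xs) (tl ys)" by (simp add: drop_Suc)
  then show ?case using Cons[of "tl ys"] bits_to_nat_hdb[of ys] bits_to_nat_Cons[of x xs]
    by (cases x; cases "hdb ys") auto
qed

lemma cmp_eq: "cmp xs ys = [] \<longleftrightarrow> bits_to_nat xs = bits_to_nat ys"
  and cmp_less: "cmp xs ys = [True] \<longleftrightarrow> bits_to_nat xs < bits_to_nat ys"
  unfolding cmp_def cmp_gen by auto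

lemma bits_to_nat_nat_bits [simp]: "bits_to_nat (nat_bits a) = a"
proof (induction a rule: less_induct)
  case (less a)
  then show ?case by (cases "a = 0") (auto simp: nat_bits_pos bits_to_nat_Cons)
qed

lemma nat_to_bits_Suc: "nat_to_bits (Suc m) i = odd i # nat_to_bits m (i div 2)"
proof -
  have "[0..<Suc m] = 0 # map Suc [0..<m]" by (simp add: upt_conv_Cons map_Suc_upt)
  then show ?thesis by (simp add: nat_to_bits_def div_mult2_eq)
qed

lemma nat_to_bits_to_nat: "nat_to_bits (length bs) (bits_to_nat bs) = bs"
  by (induction bs) (auto simp: nat_to_bits_Suc bits_to_nat_Cons, simp add: nat_to_bits_def)

lemma bits_to_nat_to_bits: "i < 2 ^ m \<Longrightarrow> bits_to_nat (nat_to_bits m i) = i"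
proof (induction m arbitrary: i)
  case 0
  then show ?case by (simp add: nat_to_bits_def)
next
  case (Suc m)
  then have "i div 2 < 2 ^ m" by auto
  with Suc.IH show ?case by (auto simp: nat_to_bits_Suc bits_to_nat_Cons)
qed

lemma length_nat_to_bits [simp]: "length (nat_to_bits m i) = m"
  by (simp add: nat_to_bits_def)

lemma gv_nat_bits: "gv (nat_bits (code_of_kind g)) u v = gate_val g u v"
proof -
  have 1: "nat_bits (Suc 0) = [True]" using nat_bits_pos[of "Suc 0"] by simp
  have 2: "nat_bits 2 = [False, True]" using nat_bits_pos[of 2] 1 by simp
  have 3: "nat_bits 3 = [True, True]" using nat_bits_pos[of 3] 1 by simp
  have 4: "nat_bits 4 = [False, False, True]" using nat_bits_pos[of 4] 2 by simp
  show ?thesis by (cases g) (simp_all add: code_of_kind_def gate_val_def gv_def 1 2 3 4)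
qed

text \<open>\<open>gv\<close> is fed two encodings of a kind: \<open>nat_bits\<close> of the code in
  the description of D, treated before, and here the three output bits of D.\<close>

lemma gv_code:
  assumes "length c = 3" "bits_to_nat c \<le> 4"
  shows "gv c u v = gate_val (kind_of_code (bits_to_nat c)) u v"
proof -
  obtain p q r where "c = [p, q, r]" using assms(1) by (auto simp: numeral_3_eq_3 length_Suc_conv)
  then show ?thesis using assms(2)
    by (cases p; cases q; cases r) (auto simp: bits_to_nat_Cons gv_def kind_of_code_def gate_val_def)
qed

definition gate_toks :: "gkind \<times> nat \<times> nat \<Rightarrow> nat list" where
  "gate_toks = (\<lambda>(g, a, b). [code_of_kind g, a, b])"

definition eval_gate :: "bool list \<Rightarrow> gkind \<times> nat \<times> nat \<Rightarrow> bool list" where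
  "eval_gate = (\<lambda>vs (g, a, b). vs @ [gate_val g (vs ! a) (vs ! b)])"

definition gates_wf :: "nat \<Rightarrow> (gkind \<times> nat \<times> nat) list \<Rightarrow> bool" where
  "gates_wf m gs = (\<forall>j < length gs. case gs ! j of (g, a, b) \<Rightarrow> a < m + j \<and> b < m + j)"

lemma gates_wf_Cons: "gates_wf m ((g, a, b) # gs) = (a < m \<and> b < m \<and> gates_wf (Suc m) gs)"
  unfolding gates_wf_def length_Cons All_less_Suc2 by (simp add: case_prod_beta)

lemma gates_eval:
  assumes "gates_wf (length w) gs"
  shows "(gatestep ^^ length gs) (w, enc_tuple (map nat_bits (concat (map gate_toks gs) @ os)))
    = (foldl eval_gate w gs, enc_tuple (map nat_bits os))"
  using assms
proof (induction gs arbitrary: w)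
  case (Cons p gs)
  obtain g a b where p: "p = (g, a, b)" by (cases p)
  have ab: "a < length w" "b < length w" "gates_wf (Suc (length w)) gs"
    using Cons.prems by (auto simp: p gates_wf_Cons)
  have "gatestep (w, enc_tuple (map nat_bits (concat (map gate_toks (p # gs)) @ os)))
     = (eval_gate w p, enc_tuple (map nat_bits (concat (map gate_toks gs) @ os)))"
    using ab by (simp add: gatestep_def p gate_toks_def tok_enc rest_enc gv_nat_bits lookup_nat_bits eval_gate_def)
  then show ?case using Cons.IH[of "eval_gate w p"] ab
    by (simp add: funpow_Suc_right p eval_gate_def del: funpow.simps)
qed simp

lemma outv_eval:
  assumes "\<forall>q \<in> set os. q < length w"
  shows "outv w (length os) (enc_tuple (map nat_bits (os @ qs))) = map (\<lambda>q. w ! q) os"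
    "(rest ^^ length os) (enc_tuple (map nat_bits (os @ qs))) = enc_tuple (map nat_bits qs)"
  using assms
  by (induction os) (auto simp: tok_enc rest_enc lookup_nat_bits funpow_Suc_right simp del: funpow.simps)

lemma length_foldl_eval: "length (foldl eval_gate w gs) = length w + length gs"
  by (induction gs arbitrary: w) (auto simp: eval_gate_def)

text \<open>Both input tests apply whatever the kind of the gate, so the indices listed for a
  constant gate are tested too. The test of the output gate does not depend on Alice's
  question.\<close>

definition rej :: "scv_instance \<Rightarrow> nat \<Rightarrow> nat \<Rightarrow> bool list \<Rightarrow> bool list \<Rightarrow> bool" where
  "rej I i j y z = (case I of (N, D, k) \<Rightarrow> j = k \<and> \<not> hdb z \<or> i < N \<and>
     (j = i \<and> hdb z \<noteq> gate_val (kind_of_code (D_code D i)) (hdb y) (hdb (tl y))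
      \<or> j = D_in1 D i \<and> hdb z \<noteq> hdb y \<or> j = D_in2 D i \<and> hdb z \<noteq> hdb (tl y)))"

lemma dec_scv_enc:
  assumes wf: "scv_wf (N, (m, gs, outs), k)"
  shows "dec (scv_enc (N, (m, gs, outs), k)) r y z = (\<not> (length (tok r) = m \<and> length (tok (rest (rest r))) = length gs \<and>
     rej (N, (m, gs, outs), k) (bits_to_nat (tok r)) (bits_to_nat (tok (rest r))) y z))"
proof -
  let ?D = "(m, gs, outs)"
  let ?x = "scv_enc (N, ?D, k)"
  define s where "s = tok r"
  define t where "t = tok (rest r)"
  define u where "u = tok (rest (rest r))"
  have x: "?x = enc_tuple (map nat_bits (N # k # m # length gs # concat (map gate_toks gs) @ outs))"
    by (simp add: scv_enc_def gate_toks_def)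
  have px: "tok ?x = nat_bits N" "tok (rest ?x) = nat_bits k" "tok (rest (rest ?x)) = nat_bits m"
    "tok (rest (rest (rest ?x))) = nat_bits (length gs)"
    "rest (rest (rest (rest ?x))) = enc_tuple (map nat_bits (concat (map gate_toks gs) @ outs))"
    by (simp_all add: x tok_enc rest_enc)
  show ?thesis
  proof (cases "length s = m \<and> length u = length gs")
    case False
    then show ?thesis by (auto simp: dec_def Let_def px is_length_nat_bits s_def u_def)
  next
    case True
    let ?w = "foldl eval_gate s gs"
    let ?i = "bits_to_nat s"
    have cw: "gates_wf m gs" "\<forall>q \<in> set outs. q < m + length gs" "length outs = 3 + 2 * m"
      using wf by (auto simp: scv_wf_def circuit_wf_def gates_wf_def)
    have g: "(gatestep ^^ length u) (s, rest (rest (rest (rest ?x)))) = (?w, enc_tuple (map nat_bits outs))"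
      unfolding px using True gates_eval[of s gs outs] cw by simp
    have lw: "length ?w = m + length gs" using True by (simp add: length_foldl_eval)
    have D: "D_out ?D ?i = map (\<lambda>q. ?w ! q) outs"
      using True nat_to_bits_to_nat[of s] by (simp add: D_out_def circuit_eval_def eval_gate_def)
    let ?o1 = "take 3 outs" let ?o2 = "take m (drop 3 outs)" let ?o3 = "drop (3 + m) outs"
    have os: "outs = ?o1 @ ?o2 @ ?o3" by (metis append_take_drop_id drop_drop add.commute)
    have sub: "\<forall>q \<in> set ?o1. q < length ?w" "\<forall>q \<in> set ?o2. q < length ?w" "\<forall>q \<in> set ?o3. q < length ?w"
      using cw(2) lw by (auto dest!: in_set_takeD in_set_dropD)
    have ls: "length ?o1 = 3" "length ?o2 = length s" "length ?o3 = length s" using cw(3) True by auto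
    have v1: "outv ?w 3 (enc_tuple (map nat_bits outs)) = take 3 (D_out ?D ?i)"
      "(rest ^^ 3) (enc_tuple (map nat_bits outs)) = enc_tuple (map nat_bits (?o2 @ ?o3))"
      using outv_eval[OF sub(1), of "?o2 @ ?o3"] unfolding ls os[symmetric] D by (simp_all add: take_map)
    have v2: "outv ?w (length s) (enc_tuple (map nat_bits (?o2 @ ?o3))) = take m (drop 3 (D_out ?D ?i))"
      "(rest ^^ length s) (enc_tuple (map nat_bits (?o2 @ ?o3))) = enc_tuple (map nat_bits (?o3 @ []))"
      using outv_eval[OF sub(2), of "?o3"] unfolding ls D by (simp_all add: take_map drop_map)
    have v3: "outv ?w (length s) (enc_tuple (map nat_bits (?o3 @ []))) = drop (3 + m) (D_out ?D ?i)"
      using outv_eval(1)[OF sub(3), of "[]"] unfolding ls D by (simp add: drop_map)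
    have "dec ?x r y z = (\<not> refutes (nat_bits N) (nat_bits k) s t (take 3 (D_out ?D ?i)) (take m (drop 3 (D_out ?D ?i)))
        (drop (3 + m) (D_out ?D ?i)) y z)"
      unfolding dec_def Let_def s_def[symmetric] t_def[symmetric] u_def[symmetric] g fst_conv snd_conv v1 v2 v3 px(1-4)
      using True by (simp add: is_length_nat_bits)
    also have "\<dots> = (\<not> rej (N, ?D, k) ?i (bits_to_nat t) y z)"
    proof (cases "?i < N")
      case iN: True
      have "length (take 3 (D_out ?D ?i)) = 3" unfolding D using cw(3) by simp
      moreover have "bits_to_nat (take 3 (D_out ?D ?i)) \<le> 4"
        using wf iN by (auto simp: scv_wf_def D_code_def)
      ultimately show ?thesis using iN
        by (simp add: refutes_def rej_def cmp_eq cmp_less gv_code D_code_def D_in1_def D_in2_def)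
    next
      case False
      then show ?thesis by (simp add: refutes_def rej_def cmp_eq cmp_less)
    qed
    finally show ?thesis using True by (simp add: s_def t_def u_def)
  qed
qed

lemma length_enc_tuple_ge: "2 * length ws \<le> length (enc_tuple ws)"
  by (induction ws) (auto simp: enc_tuple_Cons)

text \<open>Each component costs at least its separator of two symbols, and there are 7 + 3 *
  \<open>length gs\<close> + 2 * m components.\<close>

lemma length_scv_enc:
  assumes "scv_wf (N, (m, gs, outs), k)"
  shows "14 + 6 * length gs + 4 * m \<le> length (scv_enc (N, (m, gs, outs), k))"
proof -
  have "length (concat (map gate_toks gs)) = 3 * length gs" by (induction gs) (auto simp: gate_toks_def)
  then show ?thesis using assms
      length_enc_tuple_ge[of "map nat_bits ([N, k, m, length gs] @ concat (map gate_toks gs) @ outs)"]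
    by (simp add: scv_enc_def gate_toks_def scv_wf_def)
qed

lemma tok_append: "tok (enc_tuple (v # ws) @ xs) = v" and rest_append: "rest (enc_tuple (v # ws) @ xs) = enc_tuple ws @ xs"
  by (induction v) (simp_all add: enc_tuple_Cons)

text \<open>Three doubled components with separators fit into n bits, and the parser ignores the
  padding behind them. By \<open>length_scv_enc\<close>, |x| bits are enough for any two m-bit
  questions and the unary gate count.\<close>

lemma randomness_exists:
  assumes "2 * length s + 2 * length t + 2 * g + 6 \<le> n"
  shows "\<exists>r. length r = n \<and> tok r = s \<and> tok (rest r) = t \<and> length (tok (rest (rest r))) = g"
proof -
  let ?e = "enc_tuple [s, t, replicate g False]"
  let ?r = "?e @ replicate (n - length ?e) False"
  have "length ?e \<le> n" using assms by (simp add: enc_tuple_Cons)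
  then have "length ?r = n" by simp
  moreover have "tok ?r = s" "tok (rest ?r) = t" "length (tok (rest (rest ?r))) = g"
    by (simp_all only: tok_append rest_append length_replicate)
  ultimately show ?thesis by blast
qed

definition gate_value :: "circuit \<Rightarrow> nat \<Rightarrow> bool" where
  "gate_value D j = scv_vals D (Suc j) ! j"

lemma length_scv_vals [simp]: "length (scv_vals D n) = n"
  by (induction n) (auto simp: Let_def)

lemma nth_scv_vals: "i < n \<Longrightarrow> scv_vals D n ! i = gate_value D i"
proof (induction n)
  case (Suc n)
  show ?case
  proof (cases "i = n")
    case True
    then show ?thesis by (simp add: gate_value_def)
  next
    case False
    then show ?thesis using Suc by (simp add: Let_def nth_append)
  qed
qed simp

text \<open>Inputs that the kind reads precede the gate by \<open>scv_wf\<close>, so their values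
  are already in the list; at other indices \<open>gate_val\<close> ignores the value.\<close>

lemma gate_value_rec:
  assumes "scv_wf (N, D, k)" "i < N"
  shows "gate_value D i = gate_val (kind_of_code (D_code D i)) (gate_value D (D_in1 D i)) (gate_value D (D_in2 D i))"
proof -
  let ?K = "kind_of_code (D_code D i)"
  have wf: "?K \<in> {AND, OR, NOT} \<longrightarrow> D_in1 D i < i" "?K \<in> {AND, OR} \<longrightarrow> D_in2 D i < i"
    using assms by (auto simp: scv_wf_def)
  have "gate_value D i = gate_val ?K (scv_vals D i ! D_in1 D i) (scv_vals D i ! D_in2 D i)"
    by (simp add: gate_value_def Let_def nth_append)
  then show ?thesis using wf by (cases ?K) (auto simp: nth_scv_vals gate_val_def)
qed

section \<open>Probabilities of answer events under no-signaling\<close>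

definition pr :: "nat \<Rightarrow> (bool list \<Rightarrow> bool list \<Rightarrow> bool list \<Rightarrow> bool list \<Rightarrow> real)
    \<Rightarrow> bool list \<Rightarrow> bool list \<Rightarrow> (bool list \<Rightarrow> bool list \<Rightarrow> bool) \<Rightarrow> real" where
  "pr n P s t E = (\<Sum>y | length y = n. \<Sum>z | length z = n. P s t y z * of_bool (E y z))"

lemma answers_ver: "answers ver x = {y. length y = length x}"
  by (simp add: answers_def)

lemma accept_prob_ver:
  "accept_prob ver x P = (\<Sum>r | length r = length x. pr (length x) P (tok r) (tok (rest r)) (dec x r)) / 2 ^ length x"
  by (simp add: accept_prob_def answers_ver pr_def of_bool_def)

lemma finite_length [simp]: "finite {r :: bool list. length r = n}"
  using finite_lists_length_eq[of "UNIV :: bool set" n] by simp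

lemma card_length: "card {r :: bool list. length r = n} = 2 ^ n"
  using card_lists_length_eq[of "UNIV :: bool set" n] by simp

context
  fixes x P assumes ns: "no_signaling ver x P"
begin

lemma P_nonneg: "length y = length x \<Longrightarrow> length z = length x \<Longrightarrow> 0 \<le> P s t y z"
  using ns by (auto simp: no_signaling_def strategy_def answers_ver)

lemma pr_True: "pr (length x) P s t (\<lambda>_ _. True) = 1"
  using ns by (simp add: pr_def no_signaling_def strategy_def answers_ver)

lemma pr_mono: "(\<And>y z. E y z \<Longrightarrow> F y z) \<Longrightarrow> pr (length x) P s t E \<le> pr (length x) P s t F"
  unfolding pr_def by (intro sum_mono mult_left_mono) (auto simp: P_nonneg)

lemma pr_nonneg: "0 \<le> pr (length x) P s t E"
  unfolding pr_def by (intro sum_nonneg mult_nonneg_nonneg) (auto simp: P_nonneg)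

lemma pr_union: "pr (length x) P s t (\<lambda>y z. E y z \<or> F y z) \<le> pr (length x) P s t E + pr (length x) P s t F"
  unfolding pr_def sum.distrib[symmetric] distrib_left[symmetric]
  by (intro sum_mono mult_left_mono) (auto simp: P_nonneg)

lemma pr_compl: "pr (length x) P s t (\<lambda>y z. \<not> E y z) = 1 - pr (length x) P s t E"
proof -
  have "pr (length x) P s t (\<lambda>y z. \<not> E y z) + pr (length x) P s t E = pr (length x) P s t (\<lambda>_ _. True)"
    unfolding pr_def sum.distrib[symmetric] distrib_left[symmetric] by (intro sum.cong refl) auto
  then show ?thesis using pr_True by simp
qed

lemma pr_alice: "pr (length x) P s t (\<lambda>y z. E y) = pr (length x) P s t' (\<lambda>y z. E y)"
proof -
  have "(\<Sum>z | length z = length x. P s t y z) = (\<Sum>z | length z = length x. P s t' y z)" if "length y = length x" for y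
    using ns that by (auto simp: no_signaling_def answers_ver)
  then show ?thesis unfolding pr_def sum_distrib_right[symmetric] by (intro sum.cong) auto
qed

lemma pr_bob: "pr (length x) P s t (\<lambda>y z. E z) = pr (length x) P s' t (\<lambda>y z. E z)"
proof -
  have m: "(\<Sum>y | length y = length x. P s t y z) = (\<Sum>y | length y = length x. P s' t y z)" if "length z = length x" for z
    using ns that by (auto simp: no_signaling_def answers_ver)
  have sw: "pr (length x) P s t (\<lambda>y z. E z) = (\<Sum>z | length z = length x. (\<Sum>y | length y = length x. P s t y z) * of_bool (E z))" for s
    unfolding pr_def sum_distrib_right by (rule sum.swap)
  show ?thesis unfolding sw using m by (intro sum.cong) auto
qed

text \<open>One random string has weight 2^-|x| in the average, so its own rejection probability is
  at most 2^|x| times the total one.\<close>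

lemma pr_reject:
  assumes "length r = length x"
  shows "pr (length x) P (tok r) (tok (rest r)) (\<lambda>y z. \<not> dec x r y z) \<le> 2 ^ length x * (1 - accept_prob ver x P)"
proof -
  let ?n = "length x"
  let ?q = "\<lambda>r. pr ?n P (tok r) (tok (rest r)) (\<lambda>y z. \<not> dec x r y z)"
  have "?q r \<le> (\<Sum>r | length r = ?n. ?q r)"
    using assms by (intro member_le_sum) (auto simp: pr_nonneg)
  also have "\<dots> = 2 ^ ?n - (\<Sum>r | length r = ?n. pr ?n P (tok r) (tok (rest r)) (dec x r))"
    unfolding pr_compl by (simp add: sum_subtractf card_length)
  also have "\<dots> = 2 ^ ?n * (1 - accept_prob ver x P)"
    by (simp add: accept_prob_ver field_simps)
  finally show ?thesis .
qed

end

theorem ver_sound: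
  assumes wf: "scv_wf (N, (m, gs, outs), k)" and val: "\<not> scv_value (N, (m, gs, outs), k)"
    and x: "x = scv_enc (N, (m, gs, outs), k)" and ns: "no_signaling ver x P"
  shows "accept_prob ver x P \<le> 1 - 1 / 2 ^ (2 ^ length x)"
proof -
  let ?D = "(m, gs, outs)"
  let ?n = "length x"
  define d where "d = 2 ^ ?n * (1 - accept_prob ver x P)"
  have n: "14 + 6 * length gs + 4 * m \<le> ?n" using length_scv_enc[OF wf] x by simp
  have N: "N \<le> 2 ^ m" "k < N" using wf by (auto simp: scv_wf_def)
  let ?b = "nat_to_bits m"
  let ?pr = "pr ?n P"
  \<comment> \<open>Indices written with exactly m bits pass the length check, and
    \<open>randomness_exists\<close> provides a random string asking any two of them.\<close>
  have rj: "?pr (?b i) (?b j) (rej (N, ?D, k) i j) \<le> d" if "i < 2 ^ m" "j < 2 ^ m" for i j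
  proof -
    have "2 * length (?b i) + 2 * length (?b j) + 2 * length gs + 6 \<le> ?n" using n by simp
    then obtain r where r: "length r = ?n" "tok r = ?b i" "tok (rest r) = ?b j" "length (tok (rest (rest r))) = length gs"
      using randomness_exists by blast
    have "(\<lambda>y z. \<not> dec x r y z) = rej (N, ?D, k) i j"
      unfolding x dec_scv_enc[OF wf] using that by (simp add: r bits_to_nat_to_bits fun_eq_iff)
    then show ?thesis using pr_reject[OF ns r(1)] unfolding d_def r by simp
  qed
  have "0 \<le> ?pr (?b 0) (?b 0) (rej (N, ?D, k) 0 0)" by (rule pr_nonneg[OF ns])
  then have d0: "0 \<le> d" using rj[of 0 0] by simp
  define v where "v = gate_value ?D"
  define e where "e j = ?pr (?b 0) (?b j) (\<lambda>y z. hdb z \<noteq> v j)" for j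
  have ebob: "?pr s (?b j) (\<lambda>y z. hdb z \<noteq> v j) = e j" for s j unfolding e_def by (rule pr_bob[OF ns])
  \<comment> \<open>With B = 3 * d * (2 ^ i - 1) for both inputs, the recurrence gives 2 * B + 3 *
    d, which is the bound for i. The three d come from the two consistency tests and the gate
    test.\<close>
  have e: "e i \<le> 3 * d * (2 ^ (i + 1) - 1)" if "i < N" for i
    using that
  proof (induction i rule: less_induct)
    case (less i)
    have im: "i < 2 ^ m" using less.prems N by simp
    let ?K = "kind_of_code (D_code ?D i)" and ?a = "D_in1 ?D i" and ?c = "D_in2 ?D i"
    have wfi: "?K \<in> {AND, OR, NOT} \<longrightarrow> ?a < i" "?K \<in> {AND, OR} \<longrightarrow> ?c < i"
      using wf less.prems by (auto simp: scv_wf_def)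
    define al where "al = ?pr (?b i) (?b i) (\<lambda>y z. ?K \<in> {AND, OR, NOT} \<and> hdb y \<noteq> v ?a)"
    define ar where "ar = ?pr (?b i) (?b i) (\<lambda>y z. ?K \<in> {AND, OR} \<and> hdb (tl y) \<noteq> v ?c)"
    have pow: "3 * d * (2 ^ (j + 1) - 1) \<le> 3 * d * (2 ^ i - 1)" if "j < i" for j
      using that d0 by (intro mult_left_mono diff_right_mono power_increasing) auto
    have B0: "0 \<le> 3 * d * (2 ^ i - 1)" using d0 by simp
    have al: "al \<le> 3 * d * (2 ^ i - 1) + d"
    proof (cases "?K \<in> {AND, OR, NOT}")
      case True
      then have ai: "?a < i" using wfi by blast
      \<comment> \<open>By no-signaling Alice's marginal is unchanged when Bob is asked for the
        input \<open>?a\<close> instead. There a wrong bit of Alice means that Bob errs too or that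
        the two disagree and are rejected.\<close>
      have "al = ?pr (?b i) (?b ?a) (\<lambda>y z. hdb y \<noteq> v ?a)" unfolding al_def using True pr_alice[OF ns] by simp
      also have "\<dots> \<le> ?pr (?b i) (?b ?a) (\<lambda>y z. hdb z \<noteq> v ?a \<or> rej (N, ?D, k) i ?a y z)"
        using less.prems by (intro pr_mono[OF ns]) (auto simp: rej_def)
      also have "\<dots> \<le> e ?a + d"
        using pr_union[OF ns, of "?b i" "?b ?a" "\<lambda>y z. hdb z \<noteq> v ?a" "rej (N, ?D, k) i ?a"] rj[of i ?a] im ai ebob by fastforce
      finally show ?thesis using less.IH[OF ai] less.prems ai pow[OF ai] by linarith
    next
      case False
      then show ?thesis using B0 d0 unfolding al_def pr_def by simp
    qed
    have ar: "ar \<le> 3 * d * (2 ^ i - 1) + d"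
    proof (cases "?K \<in> {AND, OR}")
      case True
      then have ci: "?c < i" using wfi by blast
      have "ar = ?pr (?b i) (?b ?c) (\<lambda>y z. hdb (tl y) \<noteq> v ?c)" unfolding ar_def using True pr_alice[OF ns] by simp
      also have "\<dots> \<le> ?pr (?b i) (?b ?c) (\<lambda>y z. hdb z \<noteq> v ?c \<or> rej (N, ?D, k) i ?c y z)"
        using less.prems by (intro pr_mono[OF ns]) (auto simp: rej_def)
      also have "\<dots> \<le> e ?c + d"
        using pr_union[OF ns, of "?b i" "?b ?c" "\<lambda>y z. hdb z \<noteq> v ?c" "rej (N, ?D, k) i ?c"] rj[of i ?c] im ci ebob by fastforce
      finally show ?thesis using less.IH[OF ci] less.prems ci pow[OF ci] by linarith
    next
      case False
      then show ?thesis using B0 d0 unfolding ar_def pr_def by simp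
    qed
    have vi: "v i = gate_val ?K (v ?a) (v ?c)" unfolding v_def by (rule gate_value_rec[OF wf less.prems])
    have "e i = ?pr (?b i) (?b i) (\<lambda>y z. hdb z \<noteq> v i)" using ebob by simp
    also have "\<dots> \<le> ?pr (?b i) (?b i) (\<lambda>y z. ((?K \<in> {AND, OR, NOT} \<and> hdb y \<noteq> v ?a) \<or> (?K \<in> {AND, OR} \<and> hdb (tl y) \<noteq> v ?c))
        \<or> rej (N, ?D, k) i i y z)"
    proof (rule pr_mono[OF ns])
      fix y z assume "hdb z \<noteq> v i"
      then show "((?K \<in> {AND, OR, NOT} \<and> hdb y \<noteq> v ?a) \<or> (?K \<in> {AND, OR} \<and> hdb (tl y) \<noteq> v ?c)) \<or> rej (N, ?D, k) i i y z"
        using less.prems unfolding vi by (cases ?K) (auto simp: gate_val_def rej_def)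
    qed
    also have "\<dots> \<le> (al + ar) + d"
      unfolding al_def ar_def
      by (intro order_trans[OF pr_union[OF ns]] add_mono pr_union[OF ns] rj im)
    also have "\<dots> \<le> 3 * d * (2 ^ (i + 1) - 1)" using al ar by (simp add: algebra_simps)
    finally show ?case .
  qed
  have km: "k < 2 ^ m" using N by simp
  have vk: "v k = False" using val by (simp add: scv_value_def v_def gate_value_def)
  have "1 = ?pr (?b 0) (?b k) (\<lambda>_ _. True)" by (simp add: pr_True[OF ns])
  also have "\<dots> \<le> ?pr (?b 0) (?b k) (\<lambda>y z. hdb z \<noteq> v k \<or> rej (N, ?D, k) 0 k y z)"
    by (intro pr_mono[OF ns]) (auto simp: vk rej_def)
  also have "\<dots> \<le> e k + d"
    using pr_union[OF ns, of "?b 0" "?b k" "\<lambda>y z. hdb z \<noteq> v k" "rej (N, ?D, k) 0 k"] rj[of 0 k] km ebob by fastforce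
  also have "\<dots> \<le> 3 * d * 2 ^ (k + 1)" using e[OF N(2)] d0 by (simp add: algebra_simps)
  \<comment> \<open>Rounding 3 up to 4 lets all factors merge into one power of two.\<close>
  also have "\<dots> \<le> 4 * d * 2 ^ N" using d0 N(2) by (intro mult_mono power_increasing) auto
  finally have 1: "1 \<le> 2 ^ (?n + N + 2) * (1 - accept_prob ver x P)"
    by (simp add: d_def power_add algebra_simps)
  \<comment> \<open>This makes the identity a sufficient p: N is at most 2 ^ m, and both 2 ^ m and
    \<open>?n\<close> + 2 are at most half of 2 ^ \<open>?n\<close>.\<close>
  have "?n + N + 2 \<le> 2 ^ ?n"
  proof -
    have "(2::nat) ^ m \<le> 2 ^ (?n - 1)" using n by (intro power_increasing) auto
    moreover have "q + 4 \<le> 2 ^ (q + 1)" if "2 \<le> q" for q :: nat using that by (induction q rule: dec_induct) auto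
    from this[of "?n - 2"] have "?n + 2 \<le> 2 ^ (?n - 1)" using n by (simp add: Suc_diff_Suc numeral_2_eq_2)
    moreover have "(2::nat) ^ ?n = 2 ^ (?n - 1) + 2 ^ (?n - 1)" using n by (cases ?n) auto
    ultimately show ?thesis using N(1) by linarith
  qed
  then have "(2::real) ^ (?n + N + 2) \<le> 2 ^ (2 ^ ?n)" by (intro power_increasing) auto
  moreover have "0 \<le> 1 - accept_prob ver x P" using d0 zero_less_power[of "2 :: real" ?n]
    unfolding d_def by (auto simp: zero_le_mult_iff simp del: zero_less_power)
  ultimately have "1 \<le> 2 ^ (2 ^ ?n) * (1 - accept_prob ver x P)"
    using 1 mult_right_mono by (meson order_trans)
  then show ?thesis by (simp add: field_simps)
qed

lemma pr_point:
  assumes "length a = n" "length b = n" "\<And>y z. P s t y z = (if y = a \<and> z = b then 1 else 0)"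
  shows "pr n P s t E = of_bool (E a b)"
proof -
  have "pr n P s t E = (\<Sum>y | length y = n. \<Sum>z | length z = n. if y = a then (if z = b then of_bool (E a b) else 0) else 0)"
    unfolding pr_def assms(3) by (intro sum.cong refl) auto
  also have "\<dots> = (\<Sum>y | length y = n. if y = a then of_bool (E a b) else 0)"
    using assms(2) by (intro sum.cong refl) (auto simp: sum.delta)
  also have "\<dots> = of_bool (E a b)" using assms(1) by (simp add: sum.delta)
  finally show ?thesis .
qed

text \<open>Both provers answer with the true gate values. Each answer is a function of the prover's
  own question, hence no-signaling, and by \<open>gate_value_rec\<close> no test fires.\<close>

theorem ver_complete:
  assumes wf: "scv_wf (N, (m, gs, outs), k)" and val: "scv_value (N, (m, gs, outs), k)"
    and x: "x = scv_enc (N, (m, gs, outs), k)"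
  shows "\<exists>P. no_signaling ver x P \<and> accept_prob ver x P = 1"
proof -
  let ?D = "(m, gs, outs)"
  let ?n = "length x"
  have n: "14 \<le> ?n" using length_scv_enc[OF wf] x by simp
  let ?v = "gate_value ?D"
  define f where "f s = ?v (D_in1 ?D (bits_to_nat s)) # ?v (D_in2 ?D (bits_to_nat s)) # replicate (?n - 2) False" for s
  define g where "g t = ?v (bits_to_nat t) # replicate (?n - 1) False" for t
  have len: "length (f s) = ?n" "length (g t) = ?n" for s t using n by (auto simp: f_def g_def)
  define P :: "bool list \<Rightarrow> bool list \<Rightarrow> bool list \<Rightarrow> bool list \<Rightarrow> real"
    where "P s t y z = (if y = f s \<and> z = g t then 1 else 0)" for s t y z
  have row: "(\<Sum>z | length z = ?n. P s t y z) = (if y = f s then 1 else 0)" for s t y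
    using len by (auto simp: P_def sum.delta)
  have col: "(\<Sum>y | length y = ?n. P s t y z) = (if z = g t then 1 else 0)" for s t z
    using len by (auto simp: P_def sum.delta)
  have "0 \<le> P s t y z" for s t y z by (simp add: P_def)
  then have "no_signaling ver x P"
    unfolding no_signaling_def strategy_def answers_ver by (auto simp: row col len sum.delta)
  moreover have "pr ?n P (tok r) (tok (rest r)) (dec x r) = 1" for r
  proof -
    have "?v k" using val by (simp add: scv_value_def gate_value_def)
    then have "dec x r (f (tok r)) (g (tok (rest r)))"
      unfolding x dec_scv_enc[OF wf] using gate_value_rec[OF wf, of "bits_to_nat (tok r)"]
      by (auto simp: rej_def f_def g_def)
    then show ?thesis using pr_point[of "f (tok r)" ?n "g (tok (rest r))" P "tok r" "tok (rest r)" "dec x r"] len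
      by (simp add: P_def)
  qed
  then have "accept_prob ver x P = 1" by (simp add: accept_prob_ver card_length)
  ultimately show ?thesis by blast
qed

section \<open>Instances with doubly exponentially small error\<close>

lemma sum_bool: "(\<Sum>b\<in>UNIV. f b) = f True + f False" for f :: "bool \<Rightarrow> real"
  by (simp add: UNIV_bool)

text \<open>Only a few leading bits of an answer matter and the rest is padding: sums over
  full-length strings collapse to sums over these bits.\<close>

lemma sum_padded:
  fixes f :: "'a :: finite \<Rightarrow> bool list" and G :: "'a \<Rightarrow> bool list \<Rightarrow> real"
  assumes "\<And>a. length (f a) = n"
  shows "(\<Sum>y | length y = n. \<Sum>a\<in>UNIV. of_bool (y = f a) * G a y) = (\<Sum>a\<in>UNIV. G a (f a))"
proof -
  have "(\<Sum>y | length y = n. \<Sum>a\<in>UNIV. of_bool (y = f a) * G a y)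
     = (\<Sum>a\<in>UNIV. \<Sum>y | length y = n. if y = f a then G a (f a) else 0)"
    by (subst sum.swap) (intro sum.cong refl, auto)
  also have "\<dots> = (\<Sum>a\<in>UNIV. G a (f a))" using assms by (simp add: sum.delta)
  finally show ?thesis .
qed

text \<open>Alice answers with two bits distributed according to \<open>A s\<close>, Bob with one bit of expectation \<open>beta t\<close>;
  the bits are independent unless the questions are linked, in which case Bob's bit is a function of Alice's.\<close>

definition joint :: "(bool list \<Rightarrow> bool \<Rightarrow> bool \<Rightarrow> real) \<Rightarrow> (bool list \<Rightarrow> real) \<Rightarrow>
    (bool list \<Rightarrow> bool list \<Rightarrow> (bool \<Rightarrow> bool \<Rightarrow> bool) option) \<Rightarrow>
    bool list \<Rightarrow> bool list \<Rightarrow> bool \<Rightarrow> bool \<Rightarrow> bool \<Rightarrow> real" where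
  "joint A beta link s t a b c = A s a b * (case link s t of Some f \<Rightarrow> of_bool (c = f a b)
     | None \<Rightarrow> if c then beta t else 1 - beta t)"

definition joint_pr :: "(bool list \<Rightarrow> bool \<Rightarrow> bool \<Rightarrow> real) \<Rightarrow> (bool list \<Rightarrow> real) \<Rightarrow>
    (bool list \<Rightarrow> bool list \<Rightarrow> (bool \<Rightarrow> bool \<Rightarrow> bool) option) \<Rightarrow>
    bool list \<Rightarrow> bool list \<Rightarrow> (bool \<Rightarrow> bool \<Rightarrow> bool \<Rightarrow> bool) \<Rightarrow> real" where
  "joint_pr A beta link s t E = (\<Sum>a\<in>UNIV. \<Sum>b\<in>UNIV. \<Sum>c\<in>UNIV. joint A beta link s t a b c * of_bool (E a b c))"

text \<open>Alice's marginal is \<open>A s\<close> by construction. Bob's is \<open>beta t\<close>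
  by independence on unlinked pairs and by the last hypothesis on linked ones, so neither depends on
  the other prover's question.\<close>

lemma linked_strategy_exists:
  assumes n: "2 \<le> length x"
    and A: "\<And>s a b. 0 \<le> A s a b" "\<And>s. A s True True + A s True False + A s False True + A s False False = 1"
    and beta: "\<And>t. 0 \<le> beta t" "\<And>t. beta t \<le> 1"
    and link: "\<And>s t f. link s t = Some f \<Longrightarrow> A s True True * of_bool (f True True) + A s True False * of_bool (f True False)
        + A s False True * of_bool (f False True) + A s False False * of_bool (f False False) = beta t"
  shows "\<exists>P. no_signaling ver x P \<and> (\<forall>s t E. pr (length x) P s t (\<lambda>y z. E (hdb y) (hdb (tl y)) (hdb z))
     = joint_pr A beta link s t E)"
proof -
  let ?n = "length x"
  let ?q = "joint A beta link"
  define fa where "fa = (\<lambda>(a, b). a # b # replicate (?n - 2) False)"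
  define fb where "fb c = c # replicate (?n - 1) False" for c
  have fa: "length (fa p) = ?n" for p using n by (auto simp: fa_def split: prod.split)
  have fb: "length (fb c) = ?n" for c using n by (auto simp: fb_def)
  define P where "P s t y z = (\<Sum>p\<in>UNIV. of_bool (y = fa p) * (\<Sum>c\<in>UNIV. of_bool (z = fb c) * ?q s t (fst p) (snd p) c))" for s t y z
  have qc: "?q s t a b True + ?q s t a b False = A s a b" for s t a b
    by (auto simp: joint_def algebra_simps split: option.split)
  have qab: "?q s t True True c + ?q s t True False c + ?q s t False True c + ?q s t False False c = (if c then beta t else 1 - beta t)" for s t c
  proof (cases "link s t")
    case None
    then show ?thesis using A(2)[of s] by (simp add: joint_def flip: distrib_right)
  next
    case (Some f)
    then show ?thesis using A(2)[of s] link[OF Some] by (cases c) (simp_all add: joint_def of_bool_def split: if_splits)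
  qed
  have q0: "0 \<le> ?q s t a b c" for s t a b c
    using A(1) beta by (auto simp: joint_def split: option.split)
  have up: "(\<Sum>p\<in>UNIV. h p) = h (True, True) + h (True, False) + h (False, True) + h (False, False)" for h :: "bool \<times> bool \<Rightarrow> real"
    by (simp add: UNIV_Times_UNIV[symmetric] UNIV_bool sum.cartesian_product[symmetric] del: UNIV_Times_UNIV)
  have row: "(\<Sum>z | length z = ?n. P s t y z) = (\<Sum>p\<in>UNIV. of_bool (y = fa p) * A s (fst p) (snd p))" for s t y
  proof -
    have "(\<Sum>z | length z = ?n. P s t y z)
       = (\<Sum>p\<in>UNIV. of_bool (y = fa p) * (\<Sum>z | length z = ?n. \<Sum>c\<in>UNIV. of_bool (z = fb c) * ?q s t (fst p) (snd p) c))"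
      unfolding P_def by (subst sum.swap) (simp add: sum_distrib_left)
    also have "\<dots> = (\<Sum>p\<in>UNIV. of_bool (y = fa p) * A s (fst p) (snd p))"
    proof -
      have "(\<Sum>z | length z = ?n. \<Sum>c\<in>UNIV. of_bool (z = fb c) * ?q s t a b c) = A s a b" for a b
        by (subst sum_padded[where f = fb, OF fb]) (simp add: sum_bool qc)
      then show ?thesis by (simp only:)
    qed
    finally show ?thesis .
  qed
  have col: "(\<Sum>y | length y = ?n. P s t y z) = (\<Sum>c\<in>UNIV. of_bool (z = fb c) * (if c then beta t else 1 - beta t))" for s t z
  proof -
    have "(\<Sum>y | length y = ?n. P s t y z) = (\<Sum>p\<in>UNIV. \<Sum>c\<in>UNIV. of_bool (z = fb c) * ?q s t (fst p) (snd p) c)"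
      unfolding P_def by (rule sum_padded[where f = fa, OF fa])
    also have "\<dots> = (\<Sum>c\<in>UNIV. of_bool (z = fb c) * (\<Sum>p\<in>UNIV. ?q s t (fst p) (snd p) c))"
      by (subst sum.swap) (simp add: sum_distrib_left)
    finally show ?thesis by (simp only: up fst_conv snd_conv qab)
  qed
  have "(\<Sum>y | length y = ?n. \<Sum>z | length z = ?n. P s t y z) = 1" for s t
    unfolding row using sum_padded[where f = fa, OF fa, where G = "\<lambda>p y. A s (fst p) (snd p)"] A(2)[of s] by (simp add: up)
  moreover have "0 \<le> P s t y z" for s t y z
    unfolding P_def by (intro sum_nonneg mult_nonneg_nonneg q0) auto
  ultimately have "no_signaling ver x P"
    unfolding no_signaling_def strategy_def answers_ver row col by auto
  moreover have "pr ?n P s t (\<lambda>y z. E (hdb y) (hdb (tl y)) (hdb z))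
     = (\<Sum>a\<in>UNIV. \<Sum>b\<in>UNIV. \<Sum>c\<in>UNIV. ?q s t a b c * of_bool (E a b c))" for s t E
  proof -
    have "pr ?n P s t (\<lambda>y z. E (hdb y) (hdb (tl y)) (hdb z)) = (\<Sum>y | length y = ?n. \<Sum>p\<in>UNIV. of_bool (y = fa p) *
        (\<Sum>z | length z = ?n. \<Sum>c\<in>UNIV. of_bool (z = fb c) * (?q s t (fst p) (snd p) c * of_bool (E (hdb y) (hdb (tl y)) (hdb z)))))"
      unfolding pr_def P_def sum_distrib_right sum_distrib_left
      by (intro sum.cong refl, subst sum.swap) (simp add: ac_simps)
    also have "\<dots> = (\<Sum>y | length y = ?n. \<Sum>p\<in>UNIV. of_bool (y = fa p) *
        (\<Sum>c\<in>UNIV. ?q s t (fst p) (snd p) c * of_bool (E (hdb y) (hdb (tl y)) c)))"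
      by (intro sum.cong refl, subst sum_padded[where f = fb, OF fb]) (simp add: fb_def)
    also have "\<dots> = (\<Sum>p\<in>UNIV. \<Sum>c\<in>UNIV. ?q s t (fst p) (snd p) c * of_bool (E (hdb (fa p)) (hdb (tl (fa p))) c))"
      by (rule sum_padded[where f = fa, OF fa])
    finally show ?thesis by (simp add: up sum_bool fa_def)
  qed
  ultimately show ?thesis unfolding joint_pr_def by blast
qed

text \<open>Decrementing a number: b is the disjunction of the bits below x, and the output bit is x xor not b.\<close>

fun dec_gates :: "nat \<Rightarrow> nat \<Rightarrow> nat \<Rightarrow> nat \<Rightarrow> (gkind \<times> nat \<times> nat) list" where
  "dec_gates 0 xw pw B = []"
| "dec_gates (Suc l) xw pw B = (OR, xw, pw) # (AND, xw, pw) # (NOT, B, 0) # (OR, B + 1, B + 2) # dec_gates l (Suc xw) B (B + 4)"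

fun dec_vals :: "bool \<Rightarrow> bool list \<Rightarrow> bool list" where
  "dec_vals b [] = []"
| "dec_vals b (x # xs) = (x \<or> b) # (x \<and> b) # (\<not> (x \<or> b)) # ((x \<and> b) \<or> \<not> (x \<or> b)) # dec_vals (x \<or> b) xs"

fun dec_outs :: "nat \<Rightarrow> nat \<Rightarrow> nat list" where
  "dec_outs 0 B = []"
| "dec_outs (Suc l) B = (B + 3) # dec_outs l (B + 4)"

text \<open>The wire of the final b. With b initially false it tells whether any bit is set, which
  separates level 0 from the others and so yields the gate kind.\<close>

fun dec_last :: "nat \<Rightarrow> nat \<Rightarrow> nat \<Rightarrow> nat" where
  "dec_last 0 pw B = pw"
| "dec_last (Suc l) pw B = dec_last l B (B + 4)"

fun dec_bits :: "bool \<Rightarrow> bool list \<Rightarrow> bool list" where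
  "dec_bits b [] = []"
| "dec_bits b (x # xs) = ((x \<and> b) \<or> \<not> (x \<or> b)) # dec_bits (x \<or> b) xs"

text \<open>A bit x takes four wires: x or b, x and b, the negation of the first, and the
  disjunction of the second and third. The first, at wire \<open>B\<close>, is the b of the next
  bit; the fourth is the output.\<close>

lemma dec_gates_eval:
  assumes "length w = B" "xw + length ls \<le> B" "\<And>q. q < length ls \<Longrightarrow> w ! (xw + q) = ls ! q" "pw < B" "w ! pw = b"
  shows "foldl eval_gate w (dec_gates (length ls) xw pw B) = w @ dec_vals b ls"
  using assms
proof (induction ls arbitrary: w xw pw B b)
  case (Cons x xs)
  let ?w = "w @ [x \<or> b, x \<and> b, \<not> (x \<or> b), (x \<and> b) \<or> \<not> (x \<or> b)]"
  have x: "w ! xw = x" using Cons.prems(3)[of 0] by simp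
  have "foldl eval_gate w (dec_gates (length (x # xs)) xw pw B) = foldl eval_gate ?w (dec_gates (length xs) (Suc xw) B (B + 4))"
    using Cons.prems x by (simp add: eval_gate_def gate_val_def nth_append)
  also have "\<dots> = ?w @ dec_vals (x \<or> b) xs"
  proof (rule Cons.IH)
    fix q assume "q < length xs"
    then show "?w ! (Suc xw + q) = xs ! q" using Cons.prems(1,2) Cons.prems(3)[of "Suc q"] by (simp add: nth_append)
  qed (use Cons.prems(1,2) in \<open>auto simp: nth_append\<close>)
  finally show ?case by simp
qed simp

lemma dec_gates_wf:
  assumes "xw + l \<le> B" "pw < B"
  shows "gates_wf B (dec_gates l xw pw B)"
  using assms
proof (induction l arbitrary: xw pw B)
  case (Suc l)
  have "gates_wf (B + 4) (dec_gates l (Suc xw) B (B + 4))" using Suc.prems by (intro Suc.IH) auto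
  then show ?case using Suc.prems by (auto simp: gates_wf_Cons numeral_eq_Suc)
qed (simp add: gates_wf_def)

lemma length_dec_gates [simp]: "length (dec_gates l xw pw B) = 4 * l"
  by (induction l xw pw B rule: dec_gates.induct) auto

lemma length_dec_outs [simp]: "length (dec_outs l B) = l"
  by (induction l B rule: dec_outs.induct) auto

lemma dec_outs_less: "q \<in> set (dec_outs l B) \<Longrightarrow> q < B + 4 * l"
  by (induction l B rule: dec_outs.induct) auto

lemma dec_last_less: "pw < B \<Longrightarrow> dec_last l pw B < B + 4 * l"
  by (induction l pw B rule: dec_last.induct) auto

lemma dec_outs_eval:
  assumes "length w = B"
  shows "map (\<lambda>q. (w @ dec_vals b ls) ! q) (dec_outs (length ls) B) = dec_bits b ls"
  using assms
proof (induction ls arbitrary: w B b)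
  case (Cons x xs)
  let ?w = "w @ [x \<or> b, x \<and> b, \<not> (x \<or> b), (x \<and> b) \<or> \<not> (x \<or> b)]"
  have "w @ dec_vals b (x # xs) = ?w @ dec_vals (x \<or> b) xs" by simp
  moreover have "(?w @ dec_vals (x \<or> b) xs) ! (B + 3) = ((x \<and> b) \<or> \<not> (x \<or> b))"
    using Cons.prems by (simp add: nth_append)
  ultimately show ?case using Cons.IH[of ?w "B + 4" "x \<or> b"] Cons.prems by simp
qed simp

lemma dec_last_eval:
  assumes "length w = B" "pw < B" "w ! pw = b"
  shows "(w @ dec_vals b ls) ! dec_last (length ls) pw B = (b \<or> True \<in> set ls)"
  using assms
proof (induction ls arbitrary: w pw B b)
  case (Cons x xs)
  let ?w = "w @ [x \<or> b, x \<and> b, \<not> (x \<or> b), (x \<and> b) \<or> \<not> (x \<or> b)]"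
  have "w @ dec_vals b (x # xs) = ?w @ dec_vals (x \<or> b) xs" by simp
  moreover have "(?w @ dec_vals (x \<or> b) xs) ! dec_last (length xs) B (B + 4) = ((x \<or> b) \<or> True \<in> set xs)"
    using Cons.prems by (intro Cons.IH) (auto simp: nth_append)
  ultimately show ?case by auto
qed (auto simp: nth_append)

lemma bits_to_nat_eq_0: "bits_to_nat ls = 0 \<longleftrightarrow> True \<notin> set ls"
  by (induction ls) (auto simp: bits_to_nat_Cons)

text \<open>While b is false the decrement still borrows; once a lower bit is set, the remaining
  bits are copied, which is the first equation. A borrow that never ends gives the
  wrap-around.\<close>

lemma dec_bits_value:
  "bits_to_nat (dec_bits True ls) = bits_to_nat ls"
  "bits_to_nat (dec_bits False ls) = (if bits_to_nat ls = 0 then 2 ^ length ls - 1 else bits_to_nat ls - 1)"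
proof -
  show 1: "bits_to_nat (dec_bits True ls) = bits_to_nat ls" for ls
    by (induction ls) (auto simp: bits_to_nat_Cons)
  show "bits_to_nat (dec_bits False ls) = (if bits_to_nat ls = 0 then 2 ^ length ls - 1 else bits_to_nat ls - 1)"
  proof (induction ls)
    case (Cons x xs)
    obtain p where "(2 :: nat) ^ length xs = Suc p" by (cases "(2 :: nat) ^ length xs") auto
    then show ?case using Cons 1[of xs] by (cases x) (auto simp: bits_to_nat_Cons)
  qed simp
qed

text \<open>Gate 2 l + c is copy c at level l: a ZERO gate for l = 0, and otherwise the OR of both copies at level
  l - 1. At level 0 the decrement wraps around, so the inputs of ZERO gates, which the
  verifier tests as well, are the gates of top level.\<close>

definition fam_circuit :: "nat \<Rightarrow> circuit" where
  "fam_circuit L = (Suc L, (ZERO, 0, 0) # (ONE, 0, 0) # dec_gates L 1 (Suc L) (L + 3),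
     [dec_last L (Suc L) (L + 3), dec_last L (Suc L) (L + 3), Suc L]
     @ (Suc L # dec_outs L (L + 3)) @ ((L + 2) # dec_outs L (L + 3)))"

definition fam :: "nat \<Rightarrow> scv_instance" where
  "fam L = (2 ^ Suc L, fam_circuit L, 2 ^ Suc L - 1)"

text \<open>The code bits are c, c, 0 with c telling whether the level is nonzero, hence 0 for ZERO
  or 3 for OR. The constants False and True in front of the decremented level select its copies 0
  and 1.\<close>

lemma fam_out:
  assumes "i < 2 ^ Suc L"
  shows "D_out (fam_circuit L) i = [i div 2 \<noteq> 0, i div 2 \<noteq> 0, False]
    @ (False # dec_bits False (nat_to_bits L (i div 2))) @ (True # dec_bits False (nat_to_bits L (i div 2)))"
proof -
  let ?ls = "nat_to_bits L (i div 2)"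
  let ?v = "nat_to_bits (Suc L) i"
  let ?w = "?v @ [False, True]"
  let ?W = "?w @ dec_vals False ?ls"
  have v: "?v = odd i # ?ls" by (rule nat_to_bits_Suc)
  have B: "length ?w = L + 3" "length ?ls = L" by simp_all
  have "foldl eval_gate ?v ((ZERO, 0, 0) # (ONE, 0, 0) # dec_gates L 1 (Suc L) (L + 3))
      = foldl eval_gate ?w (dec_gates (length ?ls) 1 (Suc L) (L + 3))"
    by (simp add: eval_gate_def gate_val_def)
  also have "\<dots> = ?W"
    by (rule dec_gates_eval) (auto simp: nth_append v)
  finally have ev: "foldl eval_gate ?v ((ZERO, 0, 0) # (ONE, 0, 0) # dec_gates L 1 (Suc L) (L + 3)) = ?W" .
  have "i div 2 < 2 ^ L" using assms by auto
  then have val: "bits_to_nat ?ls = i div 2" by (rule bits_to_nat_to_bits)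
  have last: "?W ! dec_last L (Suc L) (L + 3) = (i div 2 \<noteq> 0)"
    using dec_last_eval[of ?w "L + 3" "Suc L" False ?ls] bits_to_nat_eq_0[of ?ls] val by (simp add: nth_append)
  have outs: "map (\<lambda>q. ?W ! q) (dec_outs L (L + 3)) = dec_bits False ?ls"
    using dec_outs_eval[of ?w "L + 3" False ?ls] by simp
  have c: "?W ! Suc L = False" "?W ! (L + 2) = True" by (simp_all add: nth_append)
  have "D_out (fam_circuit L) i = map (\<lambda>q. ?W ! q) (snd (snd (fam_circuit L)))"
    unfolding D_out_def circuit_eval_def fam_circuit_def fst_conv snd_conv prod.case Let_def
    using ev unfolding eval_gate_def by simp
  then show ?thesis unfolding fam_circuit_def snd_conv map_append list.map outs last c .
qed

lemma fst_fam_circuit [simp]: "fst (fam_circuit L) = Suc L"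
  by (simp add: fam_circuit_def)

lemma length_dec_bits [simp]: "length (dec_bits b ls) = length ls"
  by (induction b ls rule: dec_bits.induct) auto

lemma fam_D:
  assumes "i < 2 ^ Suc L"
  shows "kind_of_code (D_code (fam_circuit L) i) = (if i div 2 = 0 then ZERO else OR)"
    "D_code (fam_circuit L) i \<le> 4"
    "D_in1 (fam_circuit L) i = 2 * (if i div 2 = 0 then 2 ^ L - 1 else i div 2 - 1)"
    "D_in2 (fam_circuit L) i = 2 * (if i div 2 = 0 then 2 ^ L - 1 else i div 2 - 1) + 1"
proof -
  have "i div 2 < 2 ^ L" using assms by auto
  then have val: "bits_to_nat (nat_to_bits L (i div 2)) = i div 2" by (rule bits_to_nat_to_bits)
  note o = fam_out[OF assms]
  have d: "take b (drop a (xs @ ys @ zs)) = ys" "drop (a + b) (xs @ ys @ zs) = zs"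
    if "length xs = a" "length ys = b" for a b and xs ys zs :: "bool list" using that by auto
  show "kind_of_code (D_code (fam_circuit L) i) = (if i div 2 = 0 then ZERO else OR)" "D_code (fam_circuit L) i \<le> 4"
    unfolding D_code_def o by (simp_all add: bits_to_nat_Cons kind_of_code_def)
  show "D_in1 (fam_circuit L) i = 2 * (if i div 2 = 0 then 2 ^ L - 1 else i div 2 - 1)"
    "D_in2 (fam_circuit L) i = 2 * (if i div 2 = 0 then 2 ^ L - 1 else i div 2 - 1) + 1"
    using d[of "[i div 2 \<noteq> 0, i div 2 \<noteq> 0, False]" 3 "False # dec_bits False (nat_to_bits L (i div 2))" "Suc L"]
    unfolding D_in1_def D_in2_def o fst_fam_circuit
    by (simp_all add: bits_to_nat_Cons dec_bits_value val del: take_Suc_Cons drop_Suc_Cons append_Cons)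
qed

lemma fam_wf: "1 \<le> L \<Longrightarrow> scv_wf (fam L)"
proof -
  assume L: "1 \<le> L"
  have "gates_wf (Suc L) ((ZERO, 0, 0) # (ONE, 0, 0) # dec_gates L 1 (Suc L) (L + 3))"
    using dec_gates_wf[of 1 L "L + 3" "Suc L"] by (simp add: gates_wf_Cons numeral_3_eq_3)
  moreover have "\<forall>q \<in> set (snd (snd (fam_circuit L))). q < L + 3 + 4 * L"
    using dec_outs_less[of _ L "L + 3"] dec_last_less[of "Suc L" "L + 3" L] by (auto simp: fam_circuit_def)
  ultimately have "circuit_wf (fam_circuit L)"
    by (auto simp: circuit_wf_def fam_circuit_def gates_wf_def)
  moreover have "length (snd (snd (fam_circuit L))) = 3 + 2 * Suc L" by (simp add: fam_circuit_def)
  moreover have "D_code (fam_circuit L) i \<le> 4 \<and>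
        (kind_of_code (D_code (fam_circuit L) i) \<in> {AND, OR, NOT} \<longrightarrow> D_in1 (fam_circuit L) i < i) \<and>
        (kind_of_code (D_code (fam_circuit L) i) \<in> {AND, OR} \<longrightarrow> D_in2 (fam_circuit L) i < i)" if "i < 2 ^ Suc L" for i
    using fam_D[OF that] by auto
  ultimately show ?thesis unfolding scv_wf_def fam_def by simp
qed

text \<open>Evaluation starts from ZERO gates and only takes disjunctions.\<close>

lemma fam_value:
  assumes "1 \<le> L" "i < 2 ^ Suc L"
  shows "\<not> gate_value (fam_circuit L) i"
  using assms(2)
proof (induction i rule: less_induct)
  case (less i)
  note r = gate_value_rec[OF fam_wf[OF assms(1), unfolded fam_def] less.prems]
  show ?case
  proof (cases "i div 2 = 0")
    case True
    then show ?thesis using r fam_D[OF less.prems] by (simp add: gate_val_def)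
  next
    case False
    then have "2 * (i div 2 - 1) < i" "2 * (i div 2 - 1) + 1 < i" by auto
    then show ?thesis using r fam_D[OF less.prems] False less.IH less.prems by (auto simp: gate_val_def)
  qed
qed

lemma length_nat_bits: "v < 2 ^ e \<Longrightarrow> length (nat_bits v) \<le> e"
proof (induction e arbitrary: v)
  case (Suc e)
  then have "v div 2 < 2 ^ e" by auto
  then show ?case using Suc.IH[of "v div 2"] by (cases "v = 0") (auto simp: nat_bits_pos)
qed simp

lemma length_enc_tuple_le: "(\<And>w. w \<in> set ws \<Longrightarrow> length w \<le> K) \<Longrightarrow> length (enc_tuple ws) \<le> length ws * (2 * K + 2)"
proof (induction ws)
  case (Cons w ws)
  then have "length w \<le> K" "length (enc_tuple ws) \<le> length ws * (2 * K + 2)" by auto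
  then show ?case by (simp add: enc_tuple_Cons)
qed simp

lemma gate_toks_less:
  assumes "gates_wf m gs" "v \<in> set (concat (map gate_toks gs))"
  shows "v < 5 + m + length gs"
proof -
  obtain j g a b where j: "j < length gs" "gs ! j = (g, a, b)" "v \<in> {code_of_kind g, a, b}"
    using assms(2) by (auto simp: gate_toks_def in_set_conv_nth)
  have "a < m + j" "b < m + j" using assms(1) j(1,2) by (auto simp: gates_wf_def)
  moreover have "code_of_kind g < 5" by (cases g) (auto simp: code_of_kind_def)
  ultimately show ?thesis using j(1,3) by auto
qed

text \<open>There are 14 * L + 15 components with O(L) bits each. The lower bound serves to obtain
  infinitely many different instances.\<close>

lemma fam_length:
  assumes "2 \<le> L"
  shows "length (scv_enc (fam L)) \<le> 200 * (Suc L)\<^sup>2" "Suc L \<le> length (scv_enc (fam L))"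
proof -
  obtain gs outs where D: "fam_circuit L = (Suc L, gs, outs)" by (simp add: fam_circuit_def)
  have G: "length gs = 4 * L + 2" using D by (auto simp: fam_circuit_def)
  have wf: "scv_wf (2 ^ Suc L, (Suc L, gs, outs), 2 ^ Suc L - 1)" using fam_wf[of L] assms unfolding fam_def D by simp
  then have w: "gates_wf (Suc L) gs" "\<forall>q \<in> set outs. q < Suc L + length gs" "length outs = 3 + 2 * Suc L"
    by (auto simp: scv_wf_def circuit_wf_def gates_wf_def)
  let ?vs = "[2 ^ Suc L, 2 ^ Suc L - 1, Suc L, length gs] @ concat (map gate_toks gs) @ outs"
  have e: "scv_enc (fam L) = enc_tuple (map nat_bits ?vs)"
    unfolding fam_def D scv_enc_def by (simp add: gate_toks_def)
  \<comment> \<open>A number v has at most v bits, which is enough for the numbers linear in L: gate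
    tokens stay below 5 + Suc L + (4 * L + 2) = 5 * Suc L + 3. Only N and k can be larger, and they
    have at most L + 2 bits.\<close>
  have "length (nat_bits v) \<le> 5 * Suc L + 3" if v: "v \<in> set ?vs" for v
  proof (cases "v \<le> 5 * Suc L + 3")
    case True
    then show ?thesis using length_nat_bits[of v v] by simp
  next
    case False
    have "v \<in> {2 ^ Suc L, 2 ^ Suc L - 1}"
      using v False G gate_toks_less[OF w(1), of v] w(2) by auto
    then have "v \<le> 2 ^ Suc L" by auto
    also have "(2 :: nat) ^ Suc L < 2 ^ (Suc L + 1)" by simp
    finally have "v < 2 ^ (Suc L + 1)" .
    then show ?thesis using length_nat_bits[of v "Suc L + 1"] by simp
  qed
  then have "length (scv_enc (fam L)) \<le> length (map nat_bits ?vs) * (2 * (5 * Suc L + 3) + 2)"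
    unfolding e by (intro length_enc_tuple_le) auto
  also have "length (map nat_bits ?vs) = 14 * L + 15"
  proof -
    have "length (concat (map gate_toks gs)) = 3 * length gs" by (induction gs) (auto simp: gate_toks_def)
    then show ?thesis using G w(3) by simp
  qed
  also have "(14 * L + 15) * (2 * (5 * Suc L + 3) + 2) \<le> 200 * (Suc L)\<^sup>2"
  proof -
    define q where "q = L - 2"
    have "L = q + 2" using assms by (simp add: q_def)
    then show ?thesis by (simp add: power2_eq_square algebra_simps)
  qed
  finally show "length (scv_enc (fam L)) \<le> 200 * (Suc L)\<^sup>2" .
  show "Suc L \<le> length (scv_enc (fam L))" using length_scv_enc[OF wf] unfolding fam_def D by simp
qed

section \<open>The cheating strategy on the family\<close>

lemma accept_prob_ge:
  assumes ns: "no_signaling ver x P"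
    and r: "\<And>r. pr (length x) P (tok r) (tok (rest r)) (\<lambda>y z. \<not> dec x r y z) \<le> h"
  shows "1 - h \<le> accept_prob ver x P"
proof -
  have "1 - h \<le> pr (length x) P (tok r) (tok (rest r)) (dec x r)" for r
    using r[of r] unfolding pr_compl[OF ns] by simp
  then have "(\<Sum>r :: bool list | length r = length x. 1 - h)
      \<le> (\<Sum>r | length r = length x. pr (length x) P (tok r) (tok (rest r)) (dec x r))"
    by (intro sum_mono)
  then show ?thesis by (simp add: accept_prob_ver card_length field_simps)
qed

lemma bits_to_nat_less: "bits_to_nat bs < 2 ^ length bs"
  by (induction bs) (auto simp: bits_to_nat_Cons)

theorem fam_cheat:
  assumes L: "1 \<le> L"
  shows "\<exists>P. no_signaling ver (scv_enc (fam L)) P \<and> 1 - (1 / 2) ^ (2 ^ L - 1) \<le> accept_prob ver (scv_enc (fam L)) P"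
proof -
  let ?x = "scv_enc (fam L)"
  let ?b = bits_to_nat
  define N :: nat where "N = 2 ^ Suc L"
  define M :: nat where "M = 2 ^ L - 1"
  have NM: "N = 2 * M + 2" "1 \<le> M"
  proof -
    have "(2 :: nat) ^ 1 \<le> 2 ^ L" using L by (intro power_increasing) auto
    then show "N = 2 * M + 2" "1 \<le> M" unfolding N_def M_def by auto
  qed
  obtain gs outs where D: "fam_circuit L = (Suc L, gs, outs)" by (simp add: fam_circuit_def)
  have wf: "scv_wf (N, (Suc L, gs, outs), N - 1)" using fam_wf[OF L] unfolding fam_def D N_def .
  have x: "?x = scv_enc (N, (Suc L, gs, outs), N - 1)" unfolding fam_def D N_def ..
  have n: "2 \<le> length ?x" using length_scv_enc[OF wf] unfolding x by simp
  define beta :: "bool list \<Rightarrow> real" where "beta t = (if ?b t < N then (1 / 2) ^ (M - ?b t div 2) else 0)" for t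
  define good where "good s = (?b s < N \<and> ?b s div 2 \<noteq> 0)" for s
  \<comment> \<open>Each of Alice's bits must have Bob's probability at the level below. As they are
    never 1 together, their OR has twice that probability, which is Bob's at the gate itself
    (\<open>p2\<close>).\<close>
  define p :: "bool list \<Rightarrow> real" where "p s = (1 / 2) ^ (M - (?b s div 2 - 1))" for s
  \<comment> \<open>Outside \<open>good\<close> both bits are 1, to agree with Bob's certain 1 at
    the top level, where the inputs listed for a ZERO gate lie.\<close>
  define A :: "bool list \<Rightarrow> bool \<Rightarrow> bool \<Rightarrow> real" where "A s a b = (if good s then
      (if a then (if b then 0 else p s) else (if b then p s else 1 - 2 * p s)) else of_bool (a \<and> b))" for s a b
  define link :: "bool list \<Rightarrow> bool list \<Rightarrow> (bool \<Rightarrow> bool \<Rightarrow> bool) option" where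
    "link s t = (if good s then (if ?b t = ?b s then Some (\<or>) else if ?b t = 2 * (?b s div 2 - 1) then Some (\<lambda>a b. a)
      else if ?b t = 2 * (?b s div 2 - 1) + 1 then Some (\<lambda>a b. b) else None) else None)" for s t
  have p2: "2 * p s = (1 / 2) ^ (M - ?b s div 2)" if "good s" for s
  proof -
    have "M - (?b s div 2 - 1) = Suc (M - ?b s div 2)" using that NM unfolding good_def by linarith
    then show ?thesis by (simp add: p_def)
  qed
  have pow1: "(1 / 2 :: real) ^ q \<le> 1" for q by (simp add: power_le_one)
  have p0: "0 \<le> p s" for s by (simp add: p_def)
  have A0: "0 \<le> A s a b" for s a b
    using p0[of s] p2[of s] pow1[of "M - ?b s div 2"] by (simp add: A_def)
  have "\<exists>P. no_signaling ver ?x P \<and> (\<forall>s t E. pr (length ?x) P s t (\<lambda>y z. E (hdb y) (hdb (tl y)) (hdb z))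
     = joint_pr A beta link s t E)"
  proof (rule linked_strategy_exists[OF n A0])
    show "A s True True + A s True False + A s False True + A s False False = 1" for s by (simp add: A_def)
    show "0 \<le> beta t" "beta t \<le> 1" for t using pow1 by (simp_all add: beta_def)
    show "A s True True * of_bool (f True True) + A s True False * of_bool (f True False)
        + A s False True * of_bool (f False True) + A s False False * of_bool (f False False) = beta t"
      if f: "link s t = Some f" for s t f
    proof -
      have g: "good s" using f by (auto simp: link_def split: if_splits)
      then have gN: "?b s < N" by (simp add: good_def)
      consider "?b t = ?b s" "f = (\<or>)" | "?b t = 2 * (?b s div 2 - 1)" "f = (\<lambda>a b. a)"
        | "?b t = 2 * (?b s div 2 - 1) + 1" "f = (\<lambda>a b. b)"
        using f by (auto simp: link_def split: if_splits)
      then show ?thesis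
      proof cases
        case 1
        then show ?thesis using g gN p2[OF g] by (simp add: A_def beta_def)
      next
        case 2
        then have "?b t < N" "?b t div 2 = ?b s div 2 - 1" using gN by auto
        then show ?thesis using g 2 by (simp add: A_def beta_def p_def)
      next
        case 3
        then have "?b t < N" "?b t div 2 = ?b s div 2 - 1" using gN g by (auto simp: good_def)
        then show ?thesis using g 3 by (simp add: A_def beta_def p_def)
      qed
    qed
  qed
  then obtain P where ns: "no_signaling ver ?x P" and pr: "\<And>s t E. pr (length ?x) P s t (\<lambda>y z. E (hdb y) (hdb (tl y)) (hdb z))
     = joint_pr A beta link s t E" by blast
  have "pr (length ?x) P (tok r) (tok (rest r)) (\<lambda>y z. \<not> dec ?x r y z) \<le> (1 / 2) ^ M" for r
  proof -
    define s where "s = tok r"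
    define t where "t = tok (rest r)"
    define E where "E a b c = (length s = Suc L \<and> length (tok (rest (rest r))) = length gs \<and>
      (?b t = N - 1 \<and> \<not> c \<or> ?b s < N \<and> (?b t = ?b s \<and> c \<noteq> gate_val (kind_of_code (D_code (fam_circuit L) (?b s))) a b
       \<or> ?b t = D_in1 (fam_circuit L) (?b s) \<and> c \<noteq> a \<or> ?b t = D_in2 (fam_circuit L) (?b s) \<and> c \<noteq> b)))" for a b c
    have "(\<lambda>y z. \<not> dec ?x r y z) = (\<lambda>y z. E (hdb y) (hdb (tl y)) (hdb z))"
      unfolding x dec_scv_enc[OF wf] E_def rej_def s_def t_def D prod.case by (simp only: not_not)
    then have eq: "pr (length ?x) P (tok r) (tok (rest r)) (\<lambda>y z. \<not> dec ?x r y z)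
       = joint_pr A beta link s t E"
      using pr[of s t E] by (simp add: s_def t_def)
    have h0: "0 \<le> (1 / 2 :: real) ^ M" by simp
    show ?thesis
    proof (cases "length s = Suc L")
      case False
      then show ?thesis unfolding eq joint_pr_def E_def using h0 by simp
    next
      case True
      then have sN: "?b s < N" using bits_to_nat_less[of s] by (simp add: N_def)
      then have sN': "?b s < 2 ^ Suc L" by (simp add: N_def)
      note fD = fam_D[OF sN', folded M_def]
      have b1: "beta t = 1" if "?b t div 2 = M" "?b t < N" using that by (simp add: beta_def)
      show ?thesis
      proof (cases "?b s div 2 = 0")
        case d: True
        \<comment> \<open>For a ZERO gate the input tests compare 1 with 1. Only asking Bob for the
          same gate can fail, namely when he answers 1, which has probability (1 / 2) ^ M.\<close>
        have "joint A beta link s t a b c * of_bool (E a b c) \<le> of_bool (a \<and> b \<and> c) * (1 / 2) ^ M" for a b c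
        proof (cases "a \<and> b")
          case ab: True
          have nl: "link s t = None" "A s a b = 1" using d ab by (simp_all add: link_def good_def A_def)
          show ?thesis
          proof (cases c)
            case True
            have "E a b c \<Longrightarrow> ?b t = ?b s" using fD d ab True by (auto simp: E_def)
            then show ?thesis using nl ab True sN d by (auto simp: joint_def beta_def)
          next
            case False
            have "E a b c \<Longrightarrow> ?b t = N - 1 \<or> ?b t = 2 * M \<or> ?b t = 2 * M + 1" using fD d ab False
              by (auto simp: E_def gate_val_def)
            then have "E a b c \<Longrightarrow> beta t = 1" using NM b1 by auto
            then show ?thesis using nl ab False by (auto simp: joint_def)
          qed
        next
          case False
          then show ?thesis using d by (auto simp: joint_def A_def good_def)
        qed
        then have "joint_pr A beta link s t E
           \<le> (\<Sum>a\<in>UNIV. \<Sum>b\<in>UNIV. \<Sum>c\<in>UNIV. of_bool (a \<and> b \<and> c) * (1 / 2) ^ M)"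
          unfolding joint_pr_def by (intro sum_mono)
        then show ?thesis unfolding eq by (simp add: sum_bool)
      next
        case d: False
        then have g: "good s" using sN by (simp add: good_def)
        \<comment> \<open>Above level 0 nothing is ever refuted: linked bits pass the gate and input
          tests by construction, and Bob's bit at the output gate is 1 with certainty.\<close>
        have z: "joint A beta link s t a b c * of_bool (E a b c) = 0" for a b c
        proof (rule ccontr)
          assume nz: "joint A beta link s t a b c * of_bool (E a b c) \<noteq> 0"
          then have E: "E a b c" and j: "joint A beta link s t a b c \<noteq> 0" by auto
          have dM: "?b s div 2 \<le> M" using sN NM by linarith
          consider "?b t = ?b s" | "?b t = 2 * (?b s div 2 - 1)" "?b t \<noteq> ?b s"
            | "?b t = 2 * (?b s div 2 - 1) + 1" "?b t \<noteq> ?b s"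
            | "?b t \<noteq> ?b s" "?b t \<noteq> 2 * (?b s div 2 - 1)" "?b t \<noteq> 2 * (?b s div 2 - 1) + 1" by blast
          then show False
          proof cases
            case 1
            then have c: "c = (a \<or> b)" "A s a b \<noteq> 0" using j g by (auto simp: joint_def link_def)
            have ne: "?b s \<noteq> 2 * (?b s div 2 - 1)" "?b s \<noteq> 2 * (?b s div 2 - 1) + 1" using d by presburger+
            \<comment> \<open>The remaining possibility is the output test. At level M, Alice's bits
              are both 0 with probability 1 - 2 * \<open>p s\<close> = 0, so the linked bit of Bob
              cannot be 0.\<close>
            then have "?b s = N - 1" "\<not> c" using E fD d 1 c by (auto simp: E_def gate_val_def)
            then have "?b s div 2 = M" using NM by simp
            then show False using p2[OF g] c \<open>\<not> c\<close> g by (simp add: A_def)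
          next
            case 2
            then have c: "c = a" using j g by (auto simp: joint_def link_def)
            have "2 * (?b s div 2 - 1) \<noteq> N - 1" using NM by presburger
            then show False using E fD d 2 c by (auto simp: E_def)
          next
            case 3
            then have c: "c = b" using j g by (auto simp: joint_def link_def)
            have "2 * (?b s div 2 - 1) + 1 \<noteq> N - 1" using NM dM d by presburger
            then show False using E fD d 3 c by (auto simp: E_def)
          next
            case 4
            then have "?b t = N - 1" "\<not> c" using E fD d by (auto simp: E_def)
            then have "beta t = 1" "\<not> c" using b1 NM by auto
            then show False using j g 4 by (simp add: joint_def link_def)
          qed
        qed
        show ?thesis unfolding eq joint_pr_def z using h0 by simp
      qed
    qed
  qed
  from accept_prob_ge[OF ns this] ns show ?thesis unfolding M_def by blast
qed

text \<open>The length is quadratic in L, so its fourth root eventually falls below L - 1. Aiming at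
  L - 1 instead of L leaves room for 2 ^ (L - 1) \<le> 2 ^ L - 1.\<close>

lemma fam_growth:
  assumes L: "20 \<le> L" and n: "n \<le> 200 * (Suc L)\<^sup>2"
  shows "(1 / 2) ^ (2 ^ L - 1) \<le> 1 / (2 powr (2 powr (real n powr (1 / 4))))"
proof -
  have "200 * (Suc L)\<^sup>2 \<le> (L - 1) ^ 4"
  proof -
    define q where "q = L - 20"
    have q: "L = q + 20" using L by (simp add: q_def)
    \<comment> \<open>The square root of the claim, with 200 rounded up to 225 = 15 * 15; the
      threshold 20 makes it true at q = 0.\<close>
    have "15 * (q + 21) \<le> (q + 19)\<^sup>2" by (simp add: power2_eq_square algebra_simps)
    then have "(15 * (q + 21))\<^sup>2 \<le> ((q + 19)\<^sup>2)\<^sup>2" by (rule power_mono) simp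
    moreover have "((q + 19)\<^sup>2)\<^sup>2 = (q + 19) ^ 4" unfolding power_mult[symmetric] by simp
    moreover have "(15 * (q + 21))\<^sup>2 = 225 * (q + 21)\<^sup>2" unfolding power_mult_distrib by simp
    ultimately have "225 * (q + 21)\<^sup>2 \<le> (q + 19) ^ 4" by simp
    then have "200 * (q + 21)\<^sup>2 \<le> (q + 19) ^ 4" by linarith
    moreover have "Suc L = q + 21" "L - 1 = q + 19" using q by simp_all
    ultimately show ?thesis by (simp only:)
  qed
  with n have "n \<le> (L - 1) ^ 4" by (rule le_trans)
  then have "real n \<le> real ((L - 1) ^ 4)" by (simp only: of_nat_le_iff)
  then have "real n \<le> real (L - 1) ^ 4" by (simp only: of_nat_power)
  then have "real n powr (1 / 4) \<le> (real (L - 1) ^ 4) powr (1 / 4)" by (intro powr_mono2) auto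
  also have "(real (L - 1) ^ 4) powr (1 / 4) = real (L - 1)"
  proof -
    have pos: "0 < real (L - 1)" using L by simp
    have "(real (L - 1) ^ 4) powr (1 / 4) = (real (L - 1) powr real 4) powr (1 / 4)"
      unfolding powr_realpow[OF pos] ..
    also have "\<dots> = real (L - 1) powr (real 4 * (1 / 4))" by (rule powr_powr)
    also have "real 4 * (1 / 4) = 1" by simp
    finally show ?thesis using pos by simp
  qed
  finally have "2 powr (real n powr (1 / 4)) \<le> 2 powr real (L - 1)" by simp
  also have "\<dots> = 2 ^ (L - 1)" by (simp add: powr_realpow)
  also have "\<dots> \<le> real (2 ^ L - 1)"
  proof -
    have "(2 :: nat) ^ L = 2 * 2 ^ (L - 1)" using L by (cases L) auto
    moreover have "(1 :: nat) \<le> 2 ^ (L - 1)" by simp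
    ultimately have "(2 :: nat) ^ (L - 1) \<le> 2 ^ L - 1" by linarith
    then have "real (2 ^ (L - 1)) \<le> real (2 ^ L - 1)" by (simp only: of_nat_le_iff)
    then show ?thesis by (simp only: of_nat_power of_nat_numeral)
  qed
  finally have "2 powr (2 powr (real n powr (1 / 4))) \<le> 2 powr real (2 ^ L - 1)" by simp
  also have "\<dots> = 2 ^ (2 ^ L - 1)" by (rule powr_realpow) simp
  finally have "1 / 2 ^ (2 ^ L - 1) \<le> 1 / (2 powr (2 powr (real n powr (1 / 4))))"
    by (intro divide_left_mono) auto
  then show ?thesis by (simp add: power_one_over)
qed

theorem theorem2:
  shows "\<exists>p \<in> poly. \<exists>\<alpha>::real. \<alpha> > 0 \<and> (\<exists>V. poly_verifier V \<and>
     (\<forall>x \<in> SCV_yes. \<exists>P. no_signaling V x P \<and> accept_prob V x P = 1) \<and>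
     (\<forall>x \<in> SCV_no. \<forall>P. no_signaling V x P \<longrightarrow>
        accept_prob V x P \<le> 1 - 1 / 2 ^ (2 ^ p (length x))) \<and>
     infinite {x \<in> SCV_no. \<exists>P. no_signaling V x P \<and>
        accept_prob V x P \<ge> 1 - 1 / (2 powr (2 powr (real (length x) powr \<alpha>)))})"
proof (intro bexI[OF _ id_in_poly] exI[of _ "1 / 4"] exI[of _ ver] conjI ballI allI impI)
  show "poly_verifier ver" by (rule poly_verifier_ver)
next
  fix x assume "x \<in> SCV_yes"
  then show "\<exists>P. no_signaling ver x P \<and> accept_prob ver x P = 1"
    unfolding SCV_yes_def using ver_complete by auto
next
  fix x P assume "x \<in> SCV_no" "no_signaling ver x P"
  then show "accept_prob ver x P \<le> 1 - 1 / 2 ^ (2 ^ length x)"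
    unfolding SCV_no_def using ver_sound by auto
next
  let ?S = "{x \<in> SCV_no. \<exists>P. no_signaling ver x P \<and>
        accept_prob ver x P \<ge> 1 - 1 / (2 powr (2 powr (real (length x) powr (1 / 4))))}"
  show "infinite ?S"
  proof
    assume fin: "finite ?S"
    \<comment> \<open>An instance longer than every member of the set gives the contradiction. The
      20 is the threshold of \<open>fam_growth\<close>, and \<open>insert 0\<close> covers the empty
      set.\<close>
    define L where "L = Max (insert 0 (length ` ?S)) + 20"
    let ?x = "scv_enc (fam L)"
    have L: "20 \<le> L" "1 \<le> L" "2 \<le> L" by (simp_all add: L_def)
    have "scv_value (fam L) = gate_value (fam_circuit L) (2 ^ Suc L - 1)"
      unfolding fam_def scv_value_def gate_value_def prod.case ..
    then have "\<not> scv_value (fam L)" using fam_value[OF L(2), of "2 ^ Suc L - 1"] by simp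
    then have "?x \<in> SCV_no" unfolding SCV_no_def using fam_wf[OF L(2)] by blast
    moreover obtain P where "no_signaling ver ?x P" "1 - (1 / 2) ^ (2 ^ L - 1) \<le> accept_prob ver ?x P"
      using fam_cheat[OF L(2)] by blast
    ultimately have "?x \<in> ?S" using fam_growth[OF L(1) fam_length(1)[OF L(3)]] by force
    then have "length ?x \<le> Max (insert 0 (length ` ?S))" using fin by (intro Max_ge) auto
    then show False using fam_length(2)[OF L(3)] unfolding L_def by linarith
  qed
qed simp

end
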